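(* Let $(q,b,h)$ be a potential with $q$ of class $C^1$ (on $[0,b)$), and let $A(\alpha,x)$ be its $x$-dependent $A$-function on $S=\{(\alpha,x)\in\mathbb{R}^2: 0\le x<b,\ 0<\alpha<b-x\}$. Then $A$ is jointly $C^1$ on $S$ and $$\frac{\partial A}{\partial x}(\alpha,x)=\frac{\partial A}{\partial\alpha}(\alpha,x)+\int_0^\alpha A(\beta,x)A(\alpha-\beta,x)\,d\beta .$$
   Context: A potential is a triple $(q,b,h)$ with $0<b\le\infty$ and $q$ a real-valued measurable function on $(0,b)$. If $b<\infty$, assume $\int_0^b|q(x)|\,dx<\infty$ and $h\in\mathbb{R}\cup\{\infty\}$, specifying the boundary condition $u'(b)+hu(b)=0$ ($h=\infty$ means $u(b)=0$). If $b=\infty$, there is no $h$, and assume $\int_y^{y+1}|q(x)|\,dx<\infty$ for all $y\ge0$ and $\sup_{y>0}\int_y^{y+1}\max(-q(x),0)\,dx<\infty$ (so that $-\frac{d^2}{dx^2}+q$ is limit point at infinity). For $z\in\mathbb{C}\setminus[\beta,\infty)$ with $-\beta$ sufficiently large there is, up to a constant multiple, a unique nonzero solution $u(x,z)$ of $-u''+qu=zu$ on $(0,b)$ which satisfies the boundary condition at $b$ if $b<\infty$, or is $L^2$ at infinity if $b=\infty$. Put $m(z,x)=u'(x,z)/u(x,z)$ for $x\in[0,b)$. For each $x\in[0,b)$, $A(\cdot,x)$ is the (a.e. unique, and always existing) locally integrable function on $(0,b-x)$ such that for every $0<a<b-x$, $m(-\kappa^2,x)=-\kappa-\int_0^aA(\alpha,x)e^{-2\alpha\kappa}\,d\alpha+\tilde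 O(e^{-2a\kappa})$ as $\kappa\to\infty$. One has $A(\alpha,x)=q(\alpha+x)+E(\alpha,x)$ with $E$ having a continuous representative; this representative is used, so that $A$ is defined pointwise. Notation: if $g\to0$ as $x\to x_0$, then $f=\tilde O(g)$ as $x\to x_0$ means $\lim_{x\to x_0}|f(x)|/|g(x)|^{1-\varepsilon}=0$ for every $\varepsilon>0$. *)

theory Defs
  imports "HOL-Analysis.Analysis"
begin

(* The right end is b :: ereal and the boundary parameter is h :: ereal, where h = \<infinity> is the
   Dirichlet condition. If b = \<infinity> there is no boundary parameter: h is then ignored in every
   definition below. Only the values of q on (0,b) matter for these definitions. *)
definition potential :: "(real \<Rightarrow> real) \<Rightarrow> ereal \<Rightarrow> ereal \<Rightarrow> bool" where
  "potential q b h \<longleftrightarrow>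
     0 < b \<and> set_borel_measurable lebesgue {x. 0 < x \<and> ereal x < b} q \<and>
     (if b = \<infinity>
      then (\<forall>y\<ge>0. q absolutely_integrable_on {y..y + 1}) \<and>
           bdd_above ((\<lambda>y. integral {y..y + 1} (\<lambda>x. max (- q x) 0)) ` {0<..})
      else q absolutely_integrable_on {0<..<real_of_ereal b} \<and> h \<noteq> -\<infinity>)"

(* [0,b] if b is finite and [0,\<infinity>) otherwise. *)
definition closed_dom :: "ereal \<Rightarrow> real set" where
  "closed_dom b = {x. 0 \<le> x \<and> ereal x \<le> b}"

(* Solutions in the Caratheodory sense: u is C^1, u' is locally absolutely continuous and
   u'' = (q - z) u almost everywhere, the last two conditions in integrated form. As q is integrable
   near 0, and near b if b is finite, u and u' extend continuously to these regular endpoints, and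
   closed_dom includes them. The second function is the derivative of u. *)
definition schroedinger_solution ::
  "(real \<Rightarrow> real) \<Rightarrow> ereal \<Rightarrow> complex \<Rightarrow> (real \<Rightarrow> complex) \<Rightarrow> (real \<Rightarrow> complex) \<Rightarrow> bool" where
  "schroedinger_solution q b z u u' \<longleftrightarrow>
     (\<forall>x\<in>closed_dom b. (u has_vector_derivative u' x) (at x within closed_dom b)) \<and>
     (\<forall>x\<in>closed_dom b. ((\<lambda>t. (complex_of_real (q t) - z) * u t) has_integral (u' x - u' 0)) {0..x})"

definition right_end_condition ::
  "ereal \<Rightarrow> ereal \<Rightarrow> (real \<Rightarrow> complex) \<Rightarrow> (real \<Rightarrow> complex) \<Rightarrow> bool" where
  "right_end_condition b h u u' \<longleftrightarrow>
     (if b = \<infinity> then \<exists>R\<ge>0. (\<lambda>x. (cmod (u x))\<^sup>2) absolutely_integrable_on {R..}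
      else if h = \<infinity> then u (real_of_ereal b) = 0
      else u' (real_of_ereal b) + complex_of_real (real_of_ereal h) * u (real_of_ereal b) = 0)"

definition weyl_solution ::
  "(real \<Rightarrow> real) \<Rightarrow> ereal \<Rightarrow> ereal \<Rightarrow> complex \<Rightarrow> (real \<Rightarrow> complex) \<Rightarrow> (real \<Rightarrow> complex) \<Rightarrow> bool" where
  "weyl_solution q b h z u u' \<longleftrightarrow>
     schroedinger_solution q b z u u' \<and> (\<exists>x\<in>closed_dom b. u x \<noteq> 0) \<and> right_end_condition b h u u'"

(* Meaningful for z outside a half-line [\<beta>,\<infinity>), where the Weyl solution is unique up to a constant
   multiple and so determines the quotient; below it is used only for z = - \<kappa>^2, \<kappa> \<longrightarrow> \<infinity>. *)
definition m_function ::
  "(real \<Rightarrow> real) \<Rightarrow> ereal \<Rightarrow> ereal \<Rightarrow> complex \<Rightarrow> real \<Rightarrow> complex" where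
  "m_function q b h z x = (THE w. \<exists>u u'. weyl_solution q b h z u u' \<and> w = u' x / u x)"

definition tilde_O ::
  "('a \<Rightarrow> 'b::real_normed_vector) \<Rightarrow> ('a \<Rightarrow> 'c::real_normed_vector) \<Rightarrow> 'a filter \<Rightarrow> bool" where
  "tilde_O f g F \<longleftrightarrow>
     (\<forall>\<epsilon>>0. ((\<lambda>x. norm (f x) / norm (g x) powr (1 - \<epsilon>)) \<longlongrightarrow> 0) F)"

(* A \<alpha> x is the value of the A-function at (\<alpha>,x). The asymptotics determines A(\<cdot>,x) up to null sets;
   the continuity condition, on E(\<alpha>,x) = A(\<alpha>,x) - q(\<alpha>+x), then determines it pointwise
   for 0 < \<alpha> < b - x. *)
definition is_A_function ::
  "(real \<Rightarrow> real) \<Rightarrow> ereal \<Rightarrow> ereal \<Rightarrow> (real \<Rightarrow> real \<Rightarrow> real) \<Rightarrow> bool" where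
  "is_A_function q b h A \<longleftrightarrow>
     (\<forall>x. 0 \<le> x \<and> ereal x < b \<longrightarrow>
        (\<forall>a. 0 < a \<and> ereal (a + x) < b \<longrightarrow>
           (\<lambda>\<alpha>. A \<alpha> x) absolutely_integrable_on {0..a} \<and>
           tilde_O
             (\<lambda>\<kappa>::real. m_function q b h (- (complex_of_real \<kappa>)\<^sup>2) x
                - complex_of_real (- \<kappa> - integral {0..a} (\<lambda>\<alpha>. A \<alpha> x * exp (- 2 * \<alpha> * \<kappa>))))
             (\<lambda>\<kappa>. exp (- 2 * a * \<kappa>)) at_top) \<and>
        continuous_on {\<alpha>. 0 < \<alpha> \<and> ereal (\<alpha> + x) < b} (\<lambda>\<alpha>. A \<alpha> x - q (\<alpha> + x)))"

(* The derivative is taken within S, hence is one-sided at boundary points belonging to S. *)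
definition C1_on :: "('a::real_normed_vector \<Rightarrow> 'b::real_normed_vector) \<Rightarrow> 'a set \<Rightarrow> bool" where
  "C1_on f S \<longleftrightarrow>
     (\<exists>f' :: 'a \<Rightarrow> 'a \<Rightarrow>\<^sub>L 'b. continuous_on S f' \<and>
        (\<forall>p\<in>S. (f has_derivative blinfun_apply (f' p)) (at p within S)))"

definition A_domain :: "ereal \<Rightarrow> (real \<times> real) set" where
  "A_domain b = {(\<alpha>, x). 0 \<le> x \<and> ereal x < b \<and> 0 < \<alpha> \<and> ereal (\<alpha> + x) < b}"

end

theory Submission
  imports Defs
begin

text \<open>
  In the coordinates \<open>(\<alpha>, s)\<close> with \<open>s = x + \<alpha>\<close> the differential equation for \<open>A\<close> reads
  \<open>\<partial>B/\<partial>\<alpha> = - (A * A)\<close>, which together with \<open>B(0, s) = q(s)\<close> is a Volterra equation. In a weighted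
  supremum norm it is a contraction, on \<open>B\<close> jointly with its \<open>s\<close>-derivative, so it has a \<open>C\<^sup>1\<close>
  solution, global in \<open>\<alpha>\<close>. For this solution \<open>N(t) = - \<kappa> - \<integral>\<^sub>0\<^sup>y\<^sup>-\<^sup>t A(\<alpha>, t) exp (- 2 \<alpha> \<kappa>) d\<alpha>\<close> satisfies the Riccati
  equation \<open>N' = q + \<kappa>\<^sup>2 - N\<^sup>2\<close> of \<open>m(-\<kappa>\<^sup>2, \<cdot>)\<close> up to an error \<open>O(exp (- 2 \<kappa> (y - t)))\<close>. As the Weyl
  solution is positive and decays at least like \<open>exp ((C - \<kappa>) t)\<close>, this error propagates from \<open>y\<close> to \<open>x\<close>
  only as \<open>O(\<kappa>\<^sup>2 exp (- 2 \<kappa> (y - x)))\<close>. Hence the constructed solution has the defining asymptotics of the A-function,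
  and the uniqueness theorem for truncated Laplace transforms identifies the two.
\<close>

section \<open>Calculus on the line\<close>

text \<open>The hypothesis \<open>is_A_function\<close> fixes A for each x separately and says
  nothing about its dependence on x. Smoothness therefore has to come from a candidate with the
  right asymptotics, to which uniqueness then forces A to be equal. At fixed s = x + \<alpha> the
  combination of partial derivatives in the equation is a plain \<alpha>-derivative, so no
  derivative is lost in solving it; and since exp (- \<mu> \<beta>) * exp (- \<mu> (\<alpha> -
  \<beta>)) = exp (- \<mu> \<alpha>), the weight passes through the convolution unchanged, which
  excludes blow-up in spite of the quadratic term. The convolution matches the square in the Riccati
  equation, because Laplace integrals turn convolutions into products. \<open>m_function\<close> is
  a definite description, so it has a usable value only after existence and uniqueness of the Weyl
  solution are proved for large \<kappa>; a bounded subsolution of the Riccati equation, the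
  barrier, serves for this. The factor \<kappa>^2 in the error is harmless because
  \<open>tilde_O\<close> concedes an exponential of arbitrarily small rate. All constructions take
  place below some Y < b, as q is C^1 only on [0,b).\<close>

lemma leibniz_upper_limit:
  fixes h h' :: "real \<Rightarrow> real \<Rightarrow> real"
  assumes deriv: "\<And>v s. ((\<lambda>v. h v s) has_real_derivative h' v s) (at v)"
    and h: "continuous_on UNIV (\<lambda>(v, s). h v s)"
    and h': "continuous_on UNIV (\<lambda>(v, s). h' v s)"
    and t: "t \<in> {l..r}"
  shows "((\<lambda>t. integral {l..t} (h t)) has_real_derivative h t t + integral {l..t} (h' t)) (at t within {l..r})"
proof -
  let ?F = "\<lambda>(v, u). integral {l..u} (h v)"
  have cont: "continuous_on A (h v)" for v A
    using continuous_on_compose2[OF h, of A "\<lambda>s. (v, s)"] by (simp add: continuous_intros)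
  \<comment> \<open>The variable t is both parameter and limit. \<open>?F\<close> is differentiated
    jointly in the two roles and then restricted to the diagonal.\<close>
  have "(?F has_derivative (\<lambda>(tv, tu). integral {l..t} (h' t) * tv + blinfun_scaleR_left (h t t) tu))
      (at (t, t) within UNIV \<times> {l..r})"
  proof (rule has_derivative_partialsI[where fy = "\<lambda>v u. blinfun_scaleR_left (h v u)"])
    show "((\<lambda>v. integral {l..t} (h v)) has_derivative (*) (integral {l..t} (h' t))) (at t within UNIV)"
      unfolding has_field_derivative_def[symmetric]
      using leibniz_rule_field_derivative[of UNIV l t h h' t] deriv cont
        continuous_on_subset[OF h'] by (auto intro!: integrable_continuous_real)
  next
    fix v u :: real assume "v \<in> UNIV" "u \<in> {l..r}"
    show "((\<lambda>u. integral {l..u} (h v)) has_derivative blinfun_apply (blinfun_scaleR_left (h v u))) (at u within {l..r})"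
      using integral_has_vector_derivative[OF cont \<open>u \<in> {l..r}\<close>, of v]
      by (simp add: has_vector_derivative_def blinfun_scaleR_left.rep_eq)
  next
    have "continuous_on UNIV (\<lambda>(v, u). blinfun_scaleR_left (h v u))"
      using h by (auto simp: case_prod_unfold intro!: continuous_intros)
    then show "continuous (at (t, t) within UNIV \<times> {l..r}) (\<lambda>(v, u). blinfun_scaleR_left (h v u))"
      by (metis UNIV_I continuous_on_eq_continuous_within continuous_on_subset continuous_within_subset subset_UNIV)
  qed (use t in auto)
  then have "(?F \<circ> (\<lambda>t. (t, t)) has_derivative
      (\<lambda>(tv, tu). integral {l..t} (h' t) * tv + blinfun_scaleR_left (h t t) tu) \<circ> (\<lambda>t. (t, t))) (at t within {l..r})"
    by (intro diff_chain_within has_derivative_Pair has_derivative_ident)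
      (auto elim: has_derivative_subset)
  then show ?thesis
    unfolding has_field_derivative_def comp_def prod.case
    by (rule has_derivative_eq_rhs) (auto simp: fun_eq_iff blinfun_scaleR_left.rep_eq algebra_simps)
qed

lemma leibniz_lower_limit:
  fixes h h' :: "real \<Rightarrow> real \<Rightarrow> real"
  assumes deriv: "\<And>v s. ((\<lambda>v. h v s) has_real_derivative h' v s) (at v)"
    and h: "continuous_on UNIV (\<lambda>(v, s). h v s)"
    and h': "continuous_on UNIV (\<lambda>(v, s). h' v s)"
    and t: "t \<in> {l..r}"
  shows "((\<lambda>t. integral {t..r} (h t)) has_real_derivative integral {t..r} (h' t) - h t t) (at t within {l..r})"
proof -
  have cont: "continuous_on A (h v)" for v A
    using continuous_on_compose2[OF h, of A "\<lambda>s. (v, s)"] by (simp add: continuous_intros)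
  have cont': "continuous_on A (h' v)" for v A
    using continuous_on_compose2[OF h', of A "\<lambda>s. (v, s)"] by (simp add: continuous_intros)
  have split: "integral {l..r} (h v) - integral {l..v} (h v) = integral {v..r} (h v)"
    "integral {l..r} (h' v) - integral {l..v} (h' v) = integral {v..r} (h' v)" if "v \<in> {l..r}" for v
  proof -
    have "integral {l..r} f = integral {l..v} f + integral {v..r} f" if "continuous_on {l..r} f" for f :: "real \<Rightarrow> real"
      using \<open>v \<in> {l..r}\<close> that Henstock_Kurzweil_Integration.integral_combine[of l v r f]
      by (simp add: integrable_continuous_real)
    then show "integral {l..r} (h v) - integral {l..v} (h v) = integral {v..r} (h v)"
      "integral {l..r} (h' v) - integral {l..v} (h' v) = integral {v..r} (h' v)"
      using cont cont' by simp_all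
  qed
  have "((\<lambda>t. integral {l..r} (h t)) has_real_derivative integral {l..r} (h' t)) (at t within UNIV)"
    using leibniz_rule_field_derivative[of UNIV l r h h' t] deriv cont
        continuous_on_subset[OF h'] by (auto intro!: integrable_continuous_real)
  then have "((\<lambda>t. integral {l..r} (h t) - integral {l..t} (h t)) has_real_derivative
      integral {l..r} (h' t) - (h t t + integral {l..t} (h' t))) (at t within {l..r})"
    by (intro DERIV_diff leibniz_upper_limit[OF assms]) (auto elim: DERIV_subset)
  then have "((\<lambda>t. integral {l..r} (h t) - integral {l..t} (h t)) has_real_derivative
      integral {t..r} (h' t) - h t t) (at t within {l..r})"
    using split(2)[OF t] by (simp add: algebra_simps)
  then show ?thesis
    by (rule has_field_derivative_transform_within[where d = 1]) (use t split in auto)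
qed

section \<open>Integrable coefficients and the linear initial value problem\<close>

lemma continuous_on_indefinite_integral:
  fixes f :: "real \<Rightarrow> real"
  assumes "\<And>x. 0 \<le> x \<Longrightarrow> f integrable_on {0..x}"
  shows "continuous_on {0..} (\<lambda>x. integral {0..x} f)"
  unfolding continuous_on_eq_continuous_within
proof
  fix x :: real assume "x \<in> {0..}"
  then have "continuous (at x within {0..x + 1}) (\<lambda>x. integral {0..x} f)"
    using indefinite_integral_continuous_1[OF assms[of "x + 1"]]
    by (simp add: continuous_on_eq_continuous_within)
  moreover have "at x within {0..x + 1} = at x within {0..}"
    by (rule at_within_nhd[where S = "{..<x + 1}"]) auto
  ultimately show "continuous (at x within {0..}) (\<lambda>x. integral {0..x} f)"
    by simp
qed

lemma absolutely_integrable_mult_continuous: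
  fixes W g :: "real \<Rightarrow> real"
  assumes "W absolutely_integrable_on {a..b}" "continuous_on {a..b} g"
  shows "(\<lambda>t. W t * g t) absolutely_integrable_on {a..b}"
proof -
  have "(\<lambda>t. g t * W t) absolutely_integrable_on {a..b}"
  proof (rule absolutely_integrable_bounded_measurable_product_real)
    show "g \<in> borel_measurable (lebesgue_on {a..b})"
      by (intro continuous_imp_measurable_on_sets_lebesgue assms) auto
    show "bounded (g ` {a..b})"
      by (intro compact_imp_bounded compact_continuous_image assms) auto
  qed (use assms in auto)
  then show ?thesis by (simp add: mult.commute)
qed

text \<open>Contraction principle for the Volterra form of u'' = W u in a weighted supremum norm.
  The weight \<open>E\<close> has logarithmic derivative 2 (1 + \<bar>W\<bar>), so each of the two
  nested integrations gains a factor 1/2: the summand \<bar>W\<bar> pays for the inner integral, the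
  summand 1 for the outer one. Hence one contraction, with constant 1/4, gives the solution on the
  whole half-line. Continuity of W off a finite set serves to differentiate
  \<open>E\<close>.\<close>

lemma linear_ivp_exists:
  fixes W :: "real \<Rightarrow> real" and c :: real
  assumes W: "\<And>x. 0 \<le> x \<Longrightarrow> W absolutely_integrable_on {0..x}"
    and S: "finite S" and W_cont: "\<And>t. 0 < t \<Longrightarrow> t \<notin> S \<Longrightarrow> isCont W t"
  obtains u u' where "u 0 = 1" "u' 0 = c" "continuous_on {0..} u'"
    "\<And>x. 0 \<le> x \<Longrightarrow> (u has_real_derivative u' x) (at x within {0..})"
    "\<And>x. 0 \<le> x \<Longrightarrow> ((\<lambda>t. W t * u t) has_integral (u' x - u' 0)) {0..x}"
proof -
  define E where "E x = exp (2 * (x + integral {0..x} (\<lambda>t. \<bar>W t\<bar>)))" for x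
  have absW: "(\<lambda>t. \<bar>W t\<bar>) integrable_on {0..x}" if "0 \<le> x" for x
    using W[OF that] unfolding absolutely_integrable_on_def by simp
  have E_cont: "continuous_on {0..} E"
    unfolding E_def by (intro continuous_intros continuous_on_indefinite_integral absW) auto
  have E_ge: "E x \<ge> exp (2 * x)" "E x \<ge> 1" "E x > 0" if "0 \<le> x" for x
  proof -
    have "0 \<le> integral {0..x} (\<lambda>t. \<bar>W t\<bar>)"
      using that by (intro integral_nonneg absW) auto
    then show "E x \<ge> exp (2 * x)" "E x \<ge> 1" "E x > 0" using that by (auto simp: E_def)
  qed
  have E_int: "((\<lambda>t. 2 * (1 + \<bar>W t\<bar>) * E t) has_integral (E x - 1)) {0..x}" if "0 \<le> x" for x
  proof -
    have "((\<lambda>t. 2 * (1 + \<bar>W t\<bar>) * E t) has_integral (E x - E 0)) {0..x}"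
    proof (rule fundamental_theorem_of_calculus_interior_strong[OF S that])
      fix t assume t: "t \<in> {0<..<x} - S"
      have "((\<lambda>u. integral {0..u} (\<lambda>t. \<bar>W t\<bar>)) has_vector_derivative \<bar>W t\<bar>) (at t within {0..x} - {})"
        using t W_cont[of t] that
        by (intro integral_has_vector_derivative_continuous_at absW continuous_intros)
          (auto simp: continuous_at_imp_continuous_within)
      then have "((\<lambda>u. integral {0..u} (\<lambda>t. \<bar>W t\<bar>)) has_real_derivative \<bar>W t\<bar>) (at t)"
        using t by (simp add: has_real_derivative_iff_has_vector_derivative at_within_Icc_at)
      then have "(E has_real_derivative 2 * (1 + \<bar>W t\<bar>) * E t) (at t)"
        unfolding E_def by (auto intro!: derivative_eq_intros simp: algebra_simps)
      then show "(E has_vector_derivative 2 * (1 + \<bar>W t\<bar>) * E t) (at t)"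
        by (simp add: has_real_derivative_iff_has_vector_derivative)
    qed (rule continuous_on_subset[OF E_cont], auto)
    then show ?thesis by (simp add: E_def)
  qed
  have Wg: "(\<lambda>t. W t * g t) absolutely_integrable_on {0..x}" if "continuous_on {0..} g" "0 \<le> x" for g x
    by (intro absolutely_integrable_mult_continuous W that continuous_on_subset[OF that(1)]) auto
  have Wg_int: "(\<lambda>t. W t * g t) integrable_on {0..x}" if "continuous_on {0..} g" "0 \<le> x" for g x
    using Wg[OF that] by (simp add: absolutely_integrable_on_def)
  have inner_bound: "\<bar>integral {0..x} (\<lambda>t. W t * g t)\<bar> \<le> M / 2 * E x"
    if g: "continuous_on {0..} g" "\<And>t. 0 \<le> t \<Longrightarrow> \<bar>g t\<bar> \<le> M * E t" and "0 \<le> x" for g M x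
  proof -
    have M: "0 \<le> M" using order_trans[OF abs_ge_zero g(2)[of 0]] E_ge(3)[of 0] by (simp add: zero_le_mult_iff)
    have "\<bar>integral {0..x} (\<lambda>t. W t * g t)\<bar> \<le> integral {0..x} (\<lambda>t. M / 2 * (2 * (1 + \<bar>W t\<bar>) * E t))"
      unfolding real_norm_def[of "integral _ _", symmetric]
    proof (rule integral_norm_bound_integral)
      show "(\<lambda>t. W t * g t) integrable_on {0..x}" by (rule Wg_int[OF g(1) \<open>0 \<le> x\<close>])
      show "(\<lambda>t. M / 2 * (2 * (1 + \<bar>W t\<bar>) * E t)) integrable_on {0..x}"
        using has_integral_mult_right[OF E_int[OF \<open>0 \<le> x\<close>]] by blast
      fix t assume t: "t \<in> {0..x}"
      have "\<bar>W t\<bar> * \<bar>g t\<bar> \<le> \<bar>W t\<bar> * (M * E t)" using g(2) t by (intro mult_left_mono) auto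
      also have "\<dots> \<le> (1 + \<bar>W t\<bar>) * (M * E t)" using M E_ge(3)[of t] t by (intro mult_right_mono) auto
      finally show "norm (W t * g t) \<le> M / 2 * (2 * (1 + \<bar>W t\<bar>) * E t)"
        by (simp add: abs_mult algebra_simps)
    qed
    also have "\<dots> = M / 2 * (E x - 1)"
      using has_integral_mult_right[OF E_int[OF \<open>0 \<le> x\<close>]] by (rule integral_unique)
    also have "\<dots> \<le> M / 2 * E x" using M by (intro mult_left_mono) auto
    finally show ?thesis .
  qed
  have inner_cont: "continuous_on {0..} (\<lambda>x. integral {0..x} (\<lambda>t. W t * g t))"
    if "continuous_on {0..} g" for g
    by (intro continuous_on_indefinite_integral Wg_int that)
  have inner_int: "(\<lambda>x. integral {0..x} (\<lambda>t. W t * g t)) integrable_on {0..y}"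
    if "continuous_on {0..} g" for g y
    by (intro integrable_continuous_real continuous_on_subset[OF inner_cont[OF that]]) auto
  define K where "K g x = integral {0..x} (\<lambda>s. integral {0..s} (\<lambda>t. W t * g t))" for g x
  have K_cont: "continuous_on {0..} (K g)" if "continuous_on {0..} g" for g
    unfolding K_def by (intro continuous_on_indefinite_integral inner_int that)
  have K_bound: "\<bar>K g x\<bar> \<le> M / 4 * E x"
    if g: "continuous_on {0..} g" "\<And>t. 0 \<le> t \<Longrightarrow> \<bar>g t\<bar> \<le> M * E t" and "0 \<le> x" for g M x
  proof -
    have M: "0 \<le> M" using order_trans[OF abs_ge_zero g(2)[of 0]] E_ge(3)[of 0] by (simp add: zero_le_mult_iff)
    have "\<bar>K g x\<bar> \<le> integral {0..x} (\<lambda>t. M / 4 * (2 * (1 + \<bar>W t\<bar>) * E t))"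
      unfolding K_def real_norm_def[of "integral _ _", symmetric]
    proof (rule integral_norm_bound_integral)
      show "(\<lambda>s. integral {0..s} (\<lambda>t. W t * g t)) integrable_on {0..x}" by (rule inner_int[OF g(1)])
      show "(\<lambda>t. M / 4 * (2 * (1 + \<bar>W t\<bar>) * E t)) integrable_on {0..x}"
        using has_integral_mult_right[OF E_int[OF \<open>0 \<le> x\<close>]] by blast
      fix t assume t: "t \<in> {0..x}"
      have "M / 2 * E t \<le> (1 + \<bar>W t\<bar>) * (M / 2 * E t)"
        using M E_ge(3)[of t] t by (auto simp: algebra_simps)
      then show "norm (integral {0..t} (\<lambda>t. W t * g t)) \<le> M / 4 * (2 * (1 + \<bar>W t\<bar>) * E t)"
        using inner_bound[OF g, of t] t by (simp add: algebra_simps)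
    qed
    also have "\<dots> = M / 4 * (E x - 1)"
      using has_integral_mult_right[OF E_int[OF \<open>0 \<le> x\<close>]] by (rule integral_unique)
    also have "\<dots> \<le> M / 4 * E x" using M by (intro mult_left_mono) auto
    finally show ?thesis .
  qed
  \<comment> \<open>The Volterra operator acting on u / E. Bounded continuous functions live on the
    whole line, so \<open>max 0 x\<close> continues the values constantly to the left of 0.\<close>
  define T where "T f x = (1 + c * max 0 x + K (\<lambda>t. E t * f t) (max 0 x)) / E (max 0 x)" for f x
  have gf_cont: "continuous_on {0..} (\<lambda>t. E t * apply_bcontfun f t)" for f :: "real \<Rightarrow>\<^sub>C real"
    by (intro continuous_intros E_cont) auto
  have gf_bound: "\<bar>E t * apply_bcontfun f t\<bar> \<le> norm f * E t" if "0 \<le> t" for f :: "real \<Rightarrow>\<^sub>C real" and t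
    using norm_bounded[of f t] E_ge(3)[OF that] by (simp add: abs_mult mult.commute)
  have T_in: "T (apply_bcontfun f) \<in> bcontfun" for f
  proof (rule bcontfun_normI)
    show "continuous_on UNIV (T (apply_bcontfun f))"
      unfolding T_def
      using E_ge(3) by (intro continuous_intros continuous_on_compose2[OF E_cont] continuous_on_compose2[OF K_cont[OF gf_cont]])
        (auto simp: less_imp_neq[symmetric])
    fix x :: real
    define y where "y = max 0 x"
    have y: "0 \<le> y" by (simp add: y_def)
    have "\<bar>1 + c * y\<bar> \<le> (1 + \<bar>c\<bar>) * E y"
    proof -
      have "\<bar>1 + c * y\<bar> \<le> 1 + \<bar>c\<bar> * y" using y by (metis abs_mult abs_one abs_of_nonneg abs_triangle_ineq)
      also have "\<dots> \<le> (1 + \<bar>c\<bar>) * (1 + 2 * y)" using y by (auto simp: algebra_simps)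
      also have "\<dots> \<le> (1 + \<bar>c\<bar>) * E y"
        using order_trans[OF exp_ge_add_one_self[of "2 * y"] E_ge(1)[OF y]] by (intro mult_left_mono) auto
      finally show ?thesis .
    qed
    then have "\<bar>1 + c * y + K (\<lambda>t. E t * f t) y\<bar> \<le> (1 + \<bar>c\<bar> + norm f / 4) * E y"
      using K_bound[OF gf_cont gf_bound y, of f] by (simp add: algebra_simps)
    then show "norm (T f x) \<le> 1 + \<bar>c\<bar> + norm f / 4"
      using E_ge(3)[OF y] unfolding T_def y_def[symmetric] by (simp add: field_simps)
  qed
  have "dist (Bcontfun (T f)) (Bcontfun (T g)) \<le> 1 / 4 * dist f g" for f g :: "real \<Rightarrow>\<^sub>C real"
  proof (rule dist_bound)
    fix x :: real
    define y where "y = max 0 x"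
    have y: "0 \<le> y" by (simp add: y_def)
    have "K (\<lambda>t. E t * f t) y - K (\<lambda>t. E t * g t) y = K (\<lambda>t. E t * (f - g) t) y"
    proof -
      have "integral {0..s} (\<lambda>t. W t * (E t * (f - g) t)) =
        integral {0..s} (\<lambda>t. W t * (E t * f t)) - integral {0..s} (\<lambda>t. W t * (E t * g t))" if "s \<in> {0..y}" for s
        using that Henstock_Kurzweil_Integration.integral_diff[OF Wg_int[OF gf_cont[of f], of s] Wg_int[OF gf_cont[of g], of s]]
        by (simp add: algebra_simps)
      then show ?thesis
        unfolding K_def
        by (subst Henstock_Kurzweil_Integration.integral_diff[symmetric, OF inner_int[OF gf_cont] inner_int[OF gf_cont]])
          (auto intro!: Henstock_Kurzweil_Integration.integral_cong)
    qed
    then have "\<bar>K (\<lambda>t. E t * f t) y - K (\<lambda>t. E t * g t) y\<bar> \<le> norm (f - g) / 4 * E y"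
      using K_bound[OF gf_cont gf_bound y, of "f - g"] by simp
    then have "\<bar>T f x - T g x\<bar> \<le> norm (f - g) / 4"
      using E_ge(3)[OF y] unfolding T_def y_def[symmetric]
      by (simp add: field_simps flip: diff_divide_distrib)
    then show "dist (apply_bcontfun (Bcontfun (T f)) x) (apply_bcontfun (Bcontfun (T g)) x) \<le> 1 / 4 * dist f g"
      by (simp add: Bcontfun_inverse[OF T_in] dist_norm)
  qed
  then have "\<exists>!f. Bcontfun (T (apply_bcontfun f)) = f"
    by (intro banach_fix_type[where c = "1/4"]) auto
  then obtain f where f: "Bcontfun (T (apply_bcontfun f)) = f" by blast
  define u where "u t = E t * apply_bcontfun f t" for t
  define u' where "u' x = c + integral {0..x} (\<lambda>t. W t * u t)" for x
  have u_cont: "continuous_on {0..} u" unfolding u_def by (rule gf_cont)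
  have u: "u x = 1 + c * x + K u x" if "0 \<le> x" for x
  proof -
    have "apply_bcontfun f x = T f x" by (metis f Bcontfun_inverse[OF T_in])
    then show ?thesis using that E_ge(3)[OF that] by (simp add: u_def[abs_def] T_def)
  qed
  have u'_cont: "continuous_on {0..} u'"
    unfolding u'_def by (intro continuous_intros inner_cont u_cont)
  have K_deriv: "(K u has_real_derivative integral {0..x} (\<lambda>t. W t * u t)) (at x within {0..})" if "0 \<le> x" for x
  proof -
    have "(K u has_real_derivative integral {0..x} (\<lambda>t. W t * u t)) (at x within {0..x + 1})"
      unfolding K_def using that
      by (intro integral_has_real_derivative continuous_on_subset[OF inner_cont[OF u_cont]]) auto
    moreover have "at x within {0..x + 1} = at x within {0..}"
      by (rule at_within_nhd[where S = "{..<x + 1}"]) auto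
    ultimately show ?thesis by simp
  qed
  show ?thesis
  proof (rule that[of u u'])
    show "u 0 = 1" by (simp add: u K_def)
    show "u' 0 = c" by (simp add: u'_def)
    show "continuous_on {0..} u'" by (rule u'_cont)
    fix x :: real assume x: "0 \<le> x"
    have "((\<lambda>x. 1 + c * x + K u x) has_real_derivative u' x) (at x within {0..})"
      by (auto intro!: derivative_eq_intros K_deriv x simp: u'_def)
    then show "(u has_real_derivative u' x) (at x within {0..})"
      by (rule has_field_derivative_transform_within[where d = 1]) (use x u in auto)
    show "((\<lambda>t. W t * u t) has_integral (u' x - u' 0)) {0..x}"
      unfolding u'_def using Wg_int[OF u_cont x] by (simp add: integrable_integral)
  qed
qed

section \<open>Growth and barriers\<close>

lemma nondecreasing_within:
  fixes f f' :: "real \<Rightarrow> real"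
  assumes J: "is_interval J" and deriv: "\<And>t. t \<in> J \<Longrightarrow> (f has_real_derivative f' t) (at t within J)"
    and xy: "x \<in> J" "y \<in> J" "x \<le> y" and nonneg: "\<And>t. t \<in> J \<Longrightarrow> x < t \<Longrightarrow> t < y \<Longrightarrow> 0 \<le> f' t"
  shows "f x \<le> f y"
proof -
  have sub: "{x..y} \<subseteq> J" using mem_is_interval_1_I[OF J xy(1,2)] by auto
  show ?thesis
  proof (rule DERIV_nonneg_imp_increasing_open[OF \<open>x \<le> y\<close>])
    fix t assume t: "x < t" "t < y"
    have "{x<..<y} \<subseteq> interior J" using sub by (intro interior_maximal) auto
    then have "at t within J = at t" using t by (intro at_within_interior) auto
    moreover have "t \<in> J" using t by (intro subsetD[OF sub]) simp
    ultimately show "\<exists>d. DERIV f t :> d \<and> 0 \<le> d" using deriv[of t] nonneg[of t] t by auto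
  qed (rule continuous_on_subset[OF DERIV_continuous_on[OF deriv] sub])
qed

text \<open>The barrier g is a subsolution of the Riccati equation for f'/f. As long as f > 0, the
  function (f' - g f) exp (\<integral> g) has the nonnegative derivative (V - g' - g^2) f exp
  (\<integral> g), so f' > g f persists; then f' \<ge> 0 and f cannot come down to 0.\<close>

lemma growth_above_barrier:
  fixes f f' g g' V :: "real \<Rightarrow> real"
  assumes J: "is_interval J" "y \<in> J" "t \<in> J" "y \<le> t"
    and f: "\<And>x. x \<in> J \<Longrightarrow> (f has_real_derivative f' x) (at x within J)"
    and f': "\<And>x. x \<in> J \<Longrightarrow> (f' has_real_derivative V x * f x) (at x within J)"
    and g: "\<And>x. x \<in> J \<Longrightarrow> (g has_real_derivative g' x) (at x within J)"
    and barrier: "\<And>x. x \<in> J \<Longrightarrow> g' x + (g x)\<^sup>2 \<le> V x" and g_nonneg: "\<And>x. x \<in> J \<Longrightarrow> 0 \<le> g x"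
    and start: "0 < f y" "g y * f y < f' y"
  shows "f y \<le> f t \<and> g t * f t < f' t"
proof -
  have sub: "{y..t} \<subseteq> J" using mem_is_interval_1_I[OF J(1-3)] by auto
  have f_cont: "continuous_on J f" and g_cont: "continuous_on J g"
    by (rule DERIV_continuous_on, erule f f' g)+
  define G where "G x = integral {y..x} g" for x
  define w where "w x = (f' x - g x * f x) * exp (G x)" for x
  have sub_deriv: "(F has_real_derivative d) (at x within {y..t})"
    if "(F has_real_derivative d) (at x within J)" for F d x
    using that sub by (rule DERIV_subset)
  have G: "(G has_real_derivative g x) (at x within {y..t})" if "x \<in> {y..t}" for x
    unfolding G_def by (intro integral_has_real_derivative continuous_on_subset[OF g_cont] sub that)
  have w: "(w has_real_derivative (V x - g' x - (g x)\<^sup>2) * f x * exp (G x)) (at x within {y..t})"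
    if "x \<in> {y..t}" for x
  proof -
    have x: "x \<in> J" using that sub by auto
    show ?thesis
      unfolding w_def
      using f[OF x, THEN sub_deriv] f'[OF x, THEN sub_deriv] g[OF x, THEN sub_deriv] G[OF that]
      by (auto intro!: derivative_eq_intros simp: algebra_simps power2_eq_square)
  qed
  have fc: "continuous_on {y..t} f" by (rule continuous_on_subset[OF f_cont sub])
  have step: "f y \<le> f s \<and> g s * f s < f' s" if s: "s \<in> {y..t}" and pos: "\<And>x. y \<le> x \<Longrightarrow> x < s \<Longrightarrow> 0 < f x" for s
  proof -
    have w_pos: "0 < w x" if x: "x \<in> {y..s}" for x
    proof -
      have "w y \<le> w x"
      proof (rule nondecreasing_within[where f = w, OF is_interval_cc w])
        fix z assume "z \<in> {y..t}" "y < z" "z < x"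
        moreover from this have "z \<in> J" by (intro subsetD[OF sub])
        ultimately show "0 \<le> (V z - g' z - (g z)\<^sup>2) * f z * exp (G z)"
          using barrier[of z] pos[of z] x by (intro mult_nonneg_nonneg) auto
      qed (use x s in auto)
      moreover have "0 < w y" using start by (simp add: w_def)
      ultimately show ?thesis by simp
    qed
    then have above: "g x * f x < f' x" if "x \<in> {y..s}" for x
      using w_pos[OF that] by (simp add: w_def zero_less_mult_iff)
    have "f y \<le> f s"
    proof (rule nondecreasing_within[where f = f, OF is_interval_cc sub_deriv[OF f[OF subsetD[OF sub]]]])
      fix z assume z: "z \<in> {y..t}" "y < z" "z < s"
      have "z \<in> J" by (rule subsetD[OF sub z(1)])
      then have "0 \<le> g z * f z"
        using g_nonneg[of z] pos[of z] z by (intro mult_nonneg_nonneg) auto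
      then show "0 \<le> f' z" using above[of z] z by auto
    qed (use s in auto)
    then show ?thesis using above[of s] s by auto
  qed
  have "\<forall>x\<in>{y..t}. 0 < f x"
  proof (rule ccontr)
    \<comment> \<open>At the first point where f is not positive, \<open>step\<close> applies and
      still gives f \<ge> f y > 0 there.\<close>
    define Z where "Z = {x \<in> {y..t}. f x \<le> 0}"
    assume "\<not> (\<forall>x\<in>{y..t}. 0 < f x)"
    then have "Z \<noteq> {}" by (force simp: Z_def not_less)
    moreover have "compact Z"
    proof -
      have "closed Z" unfolding Z_def
        using continuous_on_closed_Collect_le[OF fc continuous_on_const closed_atLeastAtMost] by simp
      moreover have "bounded Z" by (rule bounded_subset[of "{y..t}"]) (auto simp: Z_def)
      ultimately show ?thesis by (simp add: compact_eq_bounded_closed)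
    qed
    ultimately obtain s where s: "s \<in> Z" "\<And>x. x \<in> Z \<Longrightarrow> s \<le> x"
      by (meson compact_attains_inf)
    have "f y \<le> f s \<and> g s * f s < f' s"
    proof (rule step)
      fix x assume "y \<le> x" "x < s"
      then show "0 < f x" using s(2)[of x] s(1) by (force simp: Z_def)
    qed (use s in \<open>auto simp: Z_def\<close>)
    then show False using s(1) start(1) by (auto simp: Z_def)
  qed
  then show ?thesis using step[of t] J by auto
qed

section \<open>The interval [0,b) and the choice of a barrier\<close>

abbreviation (input) half_open_dom :: "ereal \<Rightarrow> real set" where
  "half_open_dom b \<equiv> {x. 0 \<le> x \<and> ereal x < b}"

lemma half_open_dom_cases:
  assumes "0 < b"
  obtains "b = \<infinity>" "half_open_dom b = {0..}" "closed_dom b = {0..}"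
  | B where "0 < B" "b = ereal B" "half_open_dom b = {0..<B}" "closed_dom b = {0..B}"
    using assms
proof (cases b)
  case (real B)
  show ?thesis
    by (rule that(2)[of B]) (use real assms in \<open>auto simp: closed_dom_def\<close>)
qed (use that in \<open>auto simp: closed_dom_def\<close>)

lemma is_interval_half_open_dom: "is_interval (half_open_dom b)"
  unfolding is_interval_1
proof (intro ballI allI impI)
  fix a c x :: real assume "a \<in> half_open_dom b" "c \<in> half_open_dom b" "a \<le> x \<and> x \<le> c"
  then show "x \<in> half_open_dom b" using le_less_trans[of "ereal x" "ereal c" b] by auto
qed

lemma indefinite_integral_deriv_half_open:
  fixes f :: "real \<Rightarrow> 'a::banach"
  assumes f: "continuous_on (half_open_dom b) f" and x: "x \<in> half_open_dom b"
  shows "((\<lambda>x. integral {0..x} f) has_vector_derivative f x) (at x within half_open_dom b)"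
proof -
  obtain y where y: "x < y" "ereal y < b"
    using x ereal_dense2[of "ereal x" b] by auto
  have sub: "{0..y} \<subseteq> half_open_dom b"
    using y le_less_trans[of "ereal _" "ereal y" b] by auto
  have "((\<lambda>x. integral {0..x} f) has_vector_derivative f x) (at x within {0..y})"
    using x y by (intro integral_has_vector_derivative continuous_on_subset[OF f sub]) auto
  moreover have "at x within {0..y} = at x within half_open_dom b"
    using sub y by (intro at_within_nhd[where S = "{..<y}"]) auto
  ultimately show ?thesis by simp
qed

text \<open>The negative part of q may be unbounded, so g' must absorb it while g stays bounded. For
  finite b the choice g' = - \<bar>q\<bar> does this, with a constant large enough to keep g above
  \<bar>h\<bar> + 1, which later controls the boundary condition. For infinite b such a g would not
  stay bounded; subtracting R from its mean over a unit window, where R is an antiderivative of the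
  negative part, gives g' = - r + O(1), and the uniform local bound in \<open>potential\<close>
  keeps g bounded.\<close>

lemma barrier_exists:
  assumes pot: "potential q b h" and q: "continuous_on (half_open_dom b) q"
  obtains g g' C K0 where
    "\<And>x. x \<in> half_open_dom b \<Longrightarrow> (g has_real_derivative g' x) (at x within half_open_dom b)"
    "\<And>x. x \<in> half_open_dom b \<Longrightarrow> 1 \<le> g x" "\<And>x. x \<in> half_open_dom b \<Longrightarrow> g x \<le> C"
    "\<And>x. x \<in> half_open_dom b \<Longrightarrow> g' x + (g x)\<^sup>2 \<le> q x + K0"
    "\<And>x. x \<in> half_open_dom b \<Longrightarrow> b \<noteq> \<infinity> \<Longrightarrow> \<bar>real_of_ereal h\<bar> + 1 \<le> g x"
proof -
  have "0 < b" using pot by (simp add: potential_def)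
  then show thesis
  proof (cases rule: half_open_dom_cases)
    case inf: 1
    define r where "r t = max (- q t) 0" for t
    have r_cont: "continuous_on {0..} r"
      using q unfolding r_def inf(2) by (intro continuous_intros)
    define R where "R x = integral {0..x} r" for x
    define R2 where "R2 x = integral {0..x} R" for x
    have R: "(R has_real_derivative r x) (at x within {0..})" if "0 \<le> x" for x
      using indefinite_integral_deriv_half_open[of b r x, unfolded inf(2)] r_cont that
      by (simp add: R_def[abs_def] has_real_derivative_iff_has_vector_derivative)
    have R_cont: "continuous_on {0..} R"
      by (rule DERIV_continuous_on, rule R) simp
    have R2: "(R2 has_real_derivative R x) (at x within {0..})" if "0 \<le> x" for x
      using indefinite_integral_deriv_half_open[of b R x, unfolded inf(2)] R_cont that
      by (simp add: R2_def[abs_def] has_real_derivative_iff_has_vector_derivative)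
    have split: "integral {0..t} f - integral {0..s} f = integral {s..t} f"
      if "continuous_on {0..} f" "0 \<le> s" "s \<le> t" for f :: "real \<Rightarrow> real" and s t
      using that Henstock_Kurzweil_Integration.integral_combine[of 0 s t f]
      by (simp add: eq_diff_eq integrable_continuous_real[OF continuous_on_subset[OF that(1)]])
    obtain M1 where M1: "\<And>y. 0 < y \<Longrightarrow> integral {y..y + 1} r \<le> M1"
    proof -
      obtain M where "\<forall>y\<in>{0<..}. integral {y..y + 1} (\<lambda>x. max (- q x) 0) \<le> M"
        using pot inf(1) by (auto simp: potential_def bdd_above_def)
      then show thesis using that[of M] by (simp add: r_def[abs_def])
    qed
    \<comment> \<open>The supremum in \<open>potential\<close> runs over y > 0 only, so the window
      starting at 0 is covered by \<open>R 1\<close>.\<close>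
    define M where "M = max M1 (R 1)"
    have R_unit: "0 \<le> R s - R x \<and> R s - R x \<le> M" if "0 \<le> x" "x \<le> s" "s \<le> x + 1" for x s
    proof -
      have int: "r integrable_on {c..d}" if "0 \<le> c" for c d
        using that by (intro integrable_continuous_real continuous_on_subset[OF r_cont]) auto
      have "R s - R x = integral {x..s} r"
        unfolding R_def using that r_cont by (intro split)
      moreover have "0 \<le> integral {x..s} r"
        using that by (intro integral_nonneg int) (auto simp: r_def)
      moreover have "integral {x..s} r \<le> integral {x..x + 1} r"
        using that by (intro integral_subset_le int) (auto simp: r_def)
      moreover have "integral {x..x + 1} r \<le> M"
        using M1[of x] that by (cases "x = 0") (auto simp: M_def R_def)
      ultimately show ?thesis by linarith
    qed
    \<comment> \<open>\<open>R2 (x + 1) - R2 x\<close> is the mean of R over [x, x + 1]. It exceeds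
      \<open>R x\<close> by an amount between 0 and M.\<close>
    define g where "g x = 1 + (R2 (x + 1) - R2 x - R x)" for x
    have bounds: "1 \<le> g x \<and> g x \<le> 1 + M" if x: "0 \<le> x" for x
    proof -
      have int: "R integrable_on {x..x + 1}"
        using x by (intro integrable_continuous_real continuous_on_subset[OF R_cont]) auto
      have eq: "R2 (x + 1) - R2 x = integral {x..x + 1} R"
        unfolding R2_def using x R_cont by (intro split) auto
      have "integral {x..x + 1} (\<lambda>_. R x) \<le> integral {x..x + 1} R"
        by (rule integral_le[OF _ int]) (use R_unit[OF x] in auto)
      moreover have "integral {x..x + 1} R \<le> integral {x..x + 1} (\<lambda>_. R x + M)"
        by (rule integral_le[OF int]) (use R_unit[OF x] in \<open>auto simp: algebra_simps\<close>)
      ultimately show ?thesis unfolding g_def eq by (simp add: algebra_simps)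
    qed
    show ?thesis
    proof (rule that[of g "\<lambda>x. R (x + 1) - R x - r x" "1 + M" "M + (1 + M)\<^sup>2"], unfold inf(2))
      fix x :: real assume "x \<in> {0..}"
      then have x: "0 \<le> x" by simp
      have "(R2 has_real_derivative R (x + 1)) (at (x + 1))"
        using R2[of "x + 1"] x at_within_interior[of "x + 1" "{0..}"] by simp
      then have "((\<lambda>x. R2 (x + 1)) has_real_derivative R (x + 1)) (at x within {0..})"
        by (auto simp: DERIV_shift[symmetric] add.commute intro: has_field_derivative_at_within)
      then show "(g has_real_derivative R (x + 1) - R x - r x) (at x within {0..})"
        unfolding g_def by (auto intro!: derivative_eq_intros R R2 x)
      show "1 \<le> g x" "g x \<le> 1 + M" using bounds[OF x] by auto
      then have "(g x)\<^sup>2 \<le> (1 + M)\<^sup>2" by (intro power_mono) auto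
      moreover have "- r x \<le> q x" by (simp add: r_def)
      ultimately show "R (x + 1) - R x - r x + (g x)\<^sup>2 \<le> q x + (M + (1 + M)\<^sup>2)"
        using R_unit[of x "x + 1"] x by simp
    qed (use inf in auto)
  next
    case fin: (2 B)
    let ?C = "\<bar>real_of_ereal h\<bar> + 1 + integral {0..B} (\<lambda>t. \<bar>q t\<bar>)"
    define g where "g x = ?C - integral {0..x} (\<lambda>t. \<bar>q t\<bar>)" for x
    have "q absolutely_integrable_on {0..B}"
      using pot fin by (simp add: potential_def absolutely_integrable_on_Icc_iff_Ioo)
    then have int: "(\<lambda>t. \<bar>q t\<bar>) integrable_on {0..B}"
      by (simp add: absolutely_integrable_on_def)
    have bounds: "\<bar>real_of_ereal h\<bar> + 1 \<le> g x" "g x \<le> ?C" if x: "x \<in> {0..<B}" for x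
    proof -
      have int_x: "(\<lambda>t. \<bar>q t\<bar>) integrable_on {0..x}"
        using x by (intro integrable_on_subinterval[OF int]) auto
      have "integral {0..x} (\<lambda>t. \<bar>q t\<bar>) \<le> integral {0..B} (\<lambda>t. \<bar>q t\<bar>)"
        using x by (intro integral_subset_le int int_x) auto
      then show "\<bar>real_of_ereal h\<bar> + 1 \<le> g x" by (simp add: g_def)
      have "0 \<le> integral {0..x} (\<lambda>t. \<bar>q t\<bar>)" by (intro integral_nonneg int_x) auto
      then show "g x \<le> ?C" by (simp add: g_def)
    qed
    show ?thesis
    proof (rule that[of g "\<lambda>x. - \<bar>q x\<bar>" ?C "?C\<^sup>2"], unfold fin(3))
      fix x assume x: "x \<in> {0..<B}"
      have "((\<lambda>x. integral {0..x} (\<lambda>t. \<bar>q t\<bar>)) has_real_derivative \<bar>q x\<bar>) (at x within {0..<B})"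
        using indefinite_integral_deriv_half_open[of b "\<lambda>t. \<bar>q t\<bar>" x] x q
        unfolding fin(3) has_real_derivative_iff_has_vector_derivative by (auto intro: continuous_intros)
      then show "(g has_real_derivative - \<bar>q x\<bar>) (at x within {0..<B})"
        unfolding g_def by (auto intro!: derivative_eq_intros)
      show "1 \<le> g x" "g x \<le> ?C" "\<bar>real_of_ereal h\<bar> + 1 \<le> g x"
        using bounds[OF x] abs_ge_zero[of "real_of_ereal h"] by linarith+
      then have "(g x)\<^sup>2 \<le> ?C\<^sup>2" by (intro power_mono) auto
      then show "- \<bar>q x\<bar> + (g x)\<^sup>2 \<le> q x + ?C\<^sup>2" by linarith
    qed
  qed
qed

section \<open>Solutions with a continuous potential\<close>

text \<open>q is continuous only on [0,b) and may be unbounded near b. The equation for u' is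
  therefore required pointwise on the half-open interval, and continuity of u' on
  \<open>closed_dom b\<close> carries the boundary values at a finite b.\<close>

definition classical_solution ::
  "(real \<Rightarrow> real) \<Rightarrow> ereal \<Rightarrow> real \<Rightarrow> (real \<Rightarrow> 'a::real_normed_vector) \<Rightarrow> (real \<Rightarrow> 'a) \<Rightarrow> bool" where
  "classical_solution q b K u u' \<longleftrightarrow>
     (\<forall>x\<in>closed_dom b. (u has_vector_derivative u' x) (at x within closed_dom b)) \<and>
     continuous_on (closed_dom b) u' \<and>
     (\<forall>x\<in>half_open_dom b. (u' has_vector_derivative (q x + K) *\<^sub>R u x) (at x within half_open_dom b))"

lemma half_open_dom_subset_closed_dom: "half_open_dom b \<subseteq> closed_dom b"
  by (auto simp: closed_dom_def)

lemma classical_solutionD: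
  assumes "classical_solution q b K u u'"
  shows "continuous_on (closed_dom b) u" "continuous_on (closed_dom b) u'"
    "\<And>x. x \<in> half_open_dom b \<Longrightarrow> (u has_vector_derivative u' x) (at x within half_open_dom b)"
    "\<And>x. x \<in> half_open_dom b \<Longrightarrow> (u' has_vector_derivative (q x + K) *\<^sub>R u x) (at x within half_open_dom b)"
    "\<And>x. x \<in> closed_dom b \<Longrightarrow> (u has_vector_derivative u' x) (at x within closed_dom b)"
proof -
  show *: "\<And>x. x \<in> closed_dom b \<Longrightarrow> (u has_vector_derivative u' x) (at x within closed_dom b)"
    and "continuous_on (closed_dom b) u'"
    and "\<And>x. x \<in> half_open_dom b \<Longrightarrow> (u' has_vector_derivative (q x + K) *\<^sub>R u x) (at x within half_open_dom b)"
    using assms by (simp_all add: classical_solution_def)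
  show "continuous_on (closed_dom b) u" by (rule continuous_on_vector_derivative[OF *])
  show "(u has_vector_derivative u' x) (at x within half_open_dom b)" if "x \<in> half_open_dom b" for x
    by (rule has_vector_derivative_within_subset[OF * half_open_dom_subset_closed_dom])
      (rule subsetD[OF half_open_dom_subset_closed_dom that])
qed

lemma classical_solution_of_real:
  assumes "classical_solution q b K u u'"
  shows "classical_solution q b K (\<lambda>x. complex_of_real (u x)) (\<lambda>x. complex_of_real (u' x))"
  unfolding classical_solution_def
proof (intro conjI ballI)
  have of_real_deriv: "((\<lambda>x. complex_of_real (f x)) has_vector_derivative complex_of_real d) F"
    if "(f has_vector_derivative d) F" for f d F
    by (rule bounded_linear.has_vector_derivative[OF bounded_linear_of_real that])
  show "((\<lambda>x. complex_of_real (u x)) has_vector_derivative complex_of_real (u' x)) (at x within closed_dom b)"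
    if "x \<in> closed_dom b" for x
    by (rule of_real_deriv[OF classical_solutionD(5)[OF assms that]])
  show "continuous_on (closed_dom b) (\<lambda>x. complex_of_real (u' x))"
    by (intro continuous_on_of_real classical_solutionD(2)[OF assms])
  show "((\<lambda>x. complex_of_real (u' x)) has_vector_derivative (q x + K) *\<^sub>R complex_of_real (u x)) (at x within half_open_dom b)"
    if "x \<in> half_open_dom b" for x
    using of_real_deriv[OF classical_solutionD(4)[OF assms that]]
    by (simp add: scaleR_conv_of_real)
qed

lemma integral_of_vector_derivative:
  fixes u' :: "real \<Rightarrow> 'a::banach"
  assumes b: "0 < b" and cont: "continuous_on (closed_dom b) u'"
    and deriv: "\<And>x. x \<in> half_open_dom b \<Longrightarrow> (u' has_vector_derivative u'' x) (at x within half_open_dom b)"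
    and x: "x \<in> closed_dom b"
  shows "(u'' has_integral (u' x - u' 0)) {0..x}"
proof (rule fundamental_theorem_of_calculus_interior)
  have x': "0 \<le> x" "ereal x \<le> b" using x by (simp_all add: closed_dom_def)
  have half: "t \<in> half_open_dom b" if "0 \<le> t" "t < x" for t
    using that x' less_le_trans[of "ereal t" "ereal x" b] by simp
  have closed: "t \<in> closed_dom b" if "0 \<le> t" "t \<le> x" for t
    using that x' order_trans[of "ereal t" "ereal x" b] by (simp add: closed_dom_def)
  show "0 \<le> x" by (rule x')
  show "continuous_on {0..x} u'"
    by (rule continuous_on_subset[OF cont]) (simp add: subset_iff closed)
  fix t assume t: "t \<in> {0<..<x}"
  have "{0<..<x} \<subseteq> interior (half_open_dom b)"
    by (intro interior_maximal subsetI half) simp_all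
  then have "at t within half_open_dom b = at t"
    by (intro at_within_interior) (rule subsetD[OF _ t])
  then show "(u' has_vector_derivative u'' t) (at t)" using deriv[OF half, of t] t by simp
qed

lemma schroedinger_solution_iff_classical:
  assumes b: "0 < b" and q: "continuous_on (half_open_dom b) q"
  shows "schroedinger_solution q b (- (complex_of_real \<kappa>)\<^sup>2) u u' \<longleftrightarrow> classical_solution q b (\<kappa>\<^sup>2) u u'"
proof -
  have eq: "(\<lambda>t. (complex_of_real (q t) - (- (complex_of_real \<kappa>)\<^sup>2)) * u t) = (\<lambda>t. (q t + \<kappa>\<^sup>2) *\<^sub>R u t)"
    by (simp add: scaleR_conv_of_real)
  show ?thesis unfolding schroedinger_solution_def eq
  proof
    assume sol: "(\<forall>x\<in>closed_dom b. (u has_vector_derivative u' x) (at x within closed_dom b)) \<and>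
      (\<forall>x\<in>closed_dom b. ((\<lambda>t. (q t + \<kappa>\<^sup>2) *\<^sub>R u t) has_integral (u' x - u' 0)) {0..x})"
    note deriv = conjunct1[OF sol] and int = conjunct2[OF sol]
    have u_cont: "continuous_on (closed_dom b) u"
      by (rule continuous_on_vector_derivative[OF bspec[OF deriv]])
    have u'_eq: "u' x = u' 0 + integral {0..x} (\<lambda>t. (q t + \<kappa>\<^sup>2) *\<^sub>R u t)" if "x \<in> closed_dom b" for x
      using integral_unique[OF bspec[OF int that]] by simp
    have u'_deriv: "(u' has_vector_derivative (q x + \<kappa>\<^sup>2) *\<^sub>R u x) (at x within half_open_dom b)"
      if x: "x \<in> half_open_dom b" for x
    proof -
      have "((\<lambda>x. integral {0..x} (\<lambda>t. (q t + \<kappa>\<^sup>2) *\<^sub>R u t)) has_vector_derivative (q x + \<kappa>\<^sup>2) *\<^sub>R u x)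
          (at x within half_open_dom b)"
        by (intro indefinite_integral_deriv_half_open x continuous_intros q
            continuous_on_subset[OF u_cont half_open_dom_subset_closed_dom])
      then have "((\<lambda>x. u' 0 + integral {0..x} (\<lambda>t. (q t + \<kappa>\<^sup>2) *\<^sub>R u t)) has_vector_derivative (q x + \<kappa>\<^sup>2) *\<^sub>R u x)
          (at x within half_open_dom b)"
        by (auto intro!: derivative_eq_intros)
      then show ?thesis
        by (rule has_vector_derivative_transform[OF x, rotated])
          (rule u'_eq[OF subsetD[OF half_open_dom_subset_closed_dom]])
    qed
    have "continuous_on (closed_dom b) u'"
      using b
    proof (cases rule: half_open_dom_cases)
      case 1
      show ?thesis unfolding 1(3) by (rule continuous_on_vector_derivative[OF u'_deriv[unfolded 1(2)]])
    next
      case (2 B)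
      have "(\<lambda>t. (q t + \<kappa>\<^sup>2) *\<^sub>R u t) integrable_on {0..B}"
        using bspec[OF int, of B] 2(1,4) by (auto intro: has_integral_integrable)
      then have "continuous_on {0..B} (\<lambda>x. u' 0 + integral {0..x} (\<lambda>t. (q t + \<kappa>\<^sup>2) *\<^sub>R u t))"
        by (intro continuous_intros indefinite_integral_continuous_1)
      then show ?thesis
        unfolding 2(4) by (rule continuous_on_eq) (rule u'_eq[unfolded 2(4), symmetric])
    qed
    then show "classical_solution q b (\<kappa>\<^sup>2) u u'"
      using deriv u'_deriv by (simp add: classical_solution_def)
  next
    assume cl: "classical_solution q b (\<kappa>\<^sup>2) u u'"
    show "(\<forall>x\<in>closed_dom b. (u has_vector_derivative u' x) (at x within closed_dom b)) \<and>
      (\<forall>x\<in>closed_dom b. ((\<lambda>t. (q t + \<kappa>\<^sup>2) *\<^sub>R u t) has_integral (u' x - u' 0)) {0..x})"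
      by (intro conjI ballI classical_solutionD(5)[OF cl]
          integral_of_vector_derivative[OF b classical_solutionD(2,4)[OF cl]])
  qed
qed

lemma classical_solution_exists:
  fixes c :: real
  assumes pot: "potential q b h" and q: "continuous_on (half_open_dom b) q"
  obtains u u' :: "real \<Rightarrow> real" where "classical_solution q b K u u'" "u 0 = 1" "u' 0 = c"
proof -
  have b: "0 < b" using pot by (simp add: potential_def)
  define W where "W t = (if 0 < t \<and> ereal t < b then q t + K else 0)" for t
  \<comment> \<open>\<open>real_of_ereal b\<close> is where the extension of q + K by zero can jump.
    For infinite b it is 0, which 0 < t excludes anyway.\<close>
  have W_cont: "isCont W t" if t: "0 < t" "t \<notin> {real_of_ereal b}" for t
  proof (cases "ereal t < b")
    case True
    have "open {t. 0 < t \<and> ereal t < b}"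
      by (cases b) (auto intro!: open_Collect_conj open_Collect_less continuous_intros)
    moreover have "continuous_on {t. 0 < t \<and> ereal t < b} W"
      by (rule continuous_on_eq[where f = "\<lambda>t. q t + K"])
        (auto intro!: continuous_intros continuous_on_subset[OF q] simp: W_def)
    ultimately show ?thesis using True t by (simp add: continuous_on_eq_continuous_at)
  next
    case False
    then obtain B where B: "b = ereal B" "B < t"
      using t b by (cases b) auto
    have "continuous_on {B<..} W"
      by (rule continuous_on_eq[where f = "\<lambda>t. 0"]) (use B in \<open>auto simp: W_def\<close>)
    then show ?thesis using B by (simp add: continuous_on_eq_continuous_at)
  qed
  have W_int: "W absolutely_integrable_on {0..x}" if x: "0 \<le> x" for x
    using b
  proof (cases rule: half_open_dom_cases)
    case 1
    have "(\<lambda>t. q t + K) absolutely_integrable_on {0..x}"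
      using q 1 by (intro absolutely_integrable_continuous_real continuous_intros) (auto elim: continuous_on_subset)
    then show ?thesis
      by (rule absolutely_integrable_spike[where S = "{0}"]) (auto simp: W_def 1)
  next
    case (2 B)
    have "q absolutely_integrable_on {0<..<B}" using pot 2 by (simp add: potential_def)
    moreover have "(\<lambda>t. K) absolutely_integrable_on {0<..<B}"
      by (subst absolutely_integrable_on_Icc_iff_Ioo[symmetric]) (auto intro: absolutely_integrable_continuous_real)
    ultimately have "(\<lambda>t. q t + K) absolutely_integrable_on {0<..<B}"
      by (rule set_integral_add(1))
    then have "(\<lambda>t. if t \<in> {0<..<B} then q t + K else 0) absolutely_integrable_on UNIV"
      by (simp only: absolutely_integrable_restrict_UNIV)
    moreover have "(\<lambda>t. if t \<in> {0<..<B} then q t + K else 0) = W"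
      using 2 by (auto simp: W_def fun_eq_iff)
    ultimately have "W absolutely_integrable_on UNIV" by simp
    then show ?thesis by (rule absolutely_integrable_on_subinterval) simp
  qed
  obtain u u' where u: "u 0 = 1" "u' 0 = c" "continuous_on {0..} u'"
    "\<And>x. 0 \<le> x \<Longrightarrow> (u has_real_derivative u' x) (at x within {0..})"
    "\<And>x. 0 \<le> x \<Longrightarrow> ((\<lambda>t. W t * u t) has_integral (u' x - u' 0)) {0..x}"
    using linear_ivp_exists[OF W_int _ W_cont, of "{real_of_ereal b}" c] by auto
  have sub: "half_open_dom b \<subseteq> {0..}" "closed_dom b \<subseteq> {0..}" by (auto simp: closed_dom_def)
  have u_cont: "continuous_on {0..} u" by (rule DERIV_continuous_on, rule u(4)) simp
  have u'_deriv: "(u' has_vector_derivative (q x + K) *\<^sub>R u x) (at x within half_open_dom b)"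
    if x: "x \<in> half_open_dom b" for x
  proof -
    have "((\<lambda>x. integral {0..x} (\<lambda>t. (q t + K) *\<^sub>R u t)) has_vector_derivative (q x + K) *\<^sub>R u x)
        (at x within half_open_dom b)"
      by (intro indefinite_integral_deriv_half_open x continuous_intros q
          continuous_on_subset[OF u_cont sub(1)])
    then have *: "((\<lambda>x. c + integral {0..x} (\<lambda>t. (q t + K) *\<^sub>R u t)) has_vector_derivative (q x + K) *\<^sub>R u x)
        (at x within half_open_dom b)"
      by (auto intro!: derivative_eq_intros)
    have eq: "u' y = c + integral {0..y} (\<lambda>t. (q t + K) *\<^sub>R u t)" if y: "y \<in> half_open_dom b" for y
    proof -
      have "((\<lambda>t. (q t + K) *\<^sub>R u t) has_integral (u' y - u' 0)) {0..y}"
      proof (rule has_integral_spike_finite[OF _ _ u(5)])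
        fix t assume t: "t \<in> {0..y} - {0}"
        then have "ereal t < b" using y le_less_trans[of "ereal t" "ereal y" b] by auto
        then show "(q t + K) *\<^sub>R u t = W t * u t" using t by (simp add: W_def)
      qed (use y in auto)
      then show ?thesis using u(2) by (simp add: integral_unique)
    qed
    show ?thesis
      by (rule has_vector_derivative_transform[OF x _ *]) (use eq in auto)
  qed
  have "classical_solution q b K u u'"
    unfolding classical_solution_def
  proof (intro conjI ballI)
    fix x assume "x \<in> closed_dom b"
    then show "(u has_vector_derivative u' x) (at x within closed_dom b)"
      using DERIV_subset[OF u(4) sub(2), of x] sub by (auto simp: has_real_derivative_iff_has_vector_derivative)
  qed (use u'_deriv continuous_on_subset[OF u(3) sub(2)] in auto)
  with u(1,2) show ?thesis by (intro that)
qed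

section \<open>The Weyl solution for large negative energies\<close>

lemma continuous_ge_at_right_end:
  fixes F :: "real \<Rightarrow> real"
  assumes "continuous_on {y..B} F" "y < B" "\<And>x. y \<le> x \<Longrightarrow> x < B \<Longrightarrow> a \<le> F x"
  shows "a \<le> F B"
proof -
  have closure: "closure {y..<B} = {y..B}" using assms(2) by simp
  show ?thesis
    by (rule continuous_ge_on_closure[of "{y..<B}"]) (use assms closure in auto)
qed

text \<open>Reduction of order. The solution \<phi> starts with slope C + 1 > g 0, stays above the
  barrier and so has no zero; then \<phi> (J - \<integral> 1/\<phi>^2) is a second solution with
  Wronskian 1, and the constant J is tuned to the condition at b. If u' > g u held at some point,
  \<open>growth_above_barrier\<close> would keep u at least as large from there to the right end,
  against its decay or its boundary condition.\<close>

lemma decaying_solution_exists: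
  fixes g g' q :: "real \<Rightarrow> real" and C K :: real
  assumes pot: "potential q b h" and q: "continuous_on (half_open_dom b) q"
    and g: "\<And>x. x \<in> half_open_dom b \<Longrightarrow> (g has_real_derivative g' x) (at x within half_open_dom b)"
    and g_ge: "\<And>x. x \<in> half_open_dom b \<Longrightarrow> 1 \<le> g x" and g_le: "\<And>x. x \<in> half_open_dom b \<Longrightarrow> g x \<le> C"
    and barrier: "\<And>x. x \<in> half_open_dom b \<Longrightarrow> g' x + (g x)\<^sup>2 \<le> q x + K"
    and g_h: "\<And>x. x \<in> half_open_dom b \<Longrightarrow> b \<noteq> \<infinity> \<Longrightarrow> \<bar>real_of_ereal h\<bar> + 1 \<le> g x"
  obtains \<phi> \<phi>' u u' :: "real \<Rightarrow> real" where
    "classical_solution q b K \<phi> \<phi>'" "classical_solution q b K u u'"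
    "\<And>x. x \<in> closed_dom b \<Longrightarrow> u x * \<phi>' x - u' x * \<phi> x = 1"
    "\<And>x. x \<in> half_open_dom b \<Longrightarrow> 0 < u x" "\<And>x. x \<in> half_open_dom b \<Longrightarrow> u' x \<le> g x * u x"
    "\<And>x. b = \<infinity> \<Longrightarrow> 0 \<le> x \<Longrightarrow> 1 \<le> \<phi> x" "\<And>x. b = \<infinity> \<Longrightarrow> 0 \<le> x \<Longrightarrow> u x \<le> exp (- x)"
    "\<And>B. b = ereal B \<Longrightarrow> h = \<infinity> \<Longrightarrow> u B = 0 \<and> \<phi> B \<noteq> 0"
    "\<And>B. b = ereal B \<Longrightarrow> h \<noteq> \<infinity> \<Longrightarrow>
       u' B + real_of_ereal h * u B = 0 \<and> \<phi>' B + real_of_ereal h * \<phi> B \<noteq> 0"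
proof -
  let ?I = "half_open_dom b" and ?D = "closed_dom b"
  have b: "0 < b" using pot by (simp add: potential_def)
  have zero: "0 \<in> ?I" using b by (simp add: zero_ereal_def)
  note [simp] = has_real_derivative_iff_has_vector_derivative[symmetric] and [simp del] = abs_real_of_ereal
  obtain \<phi> \<phi>' where \<phi>: "classical_solution q b K \<phi> \<phi>'" "\<phi> 0 = 1" "\<phi>' 0 = C + 1"
    by (rule classical_solution_exists[OF pot q])
  note \<phi>D = classical_solutionD[OF \<phi>(1), unfolded has_real_derivative_iff_has_vector_derivative[symmetric] real_scaleR_def]
  have growth: "f y \<le> f t \<and> g t * f t < f' t"
    if "classical_solution q b K f f'" "y \<in> ?I" "t \<in> ?I" "y \<le> t" "0 < f y" "g y * f y < f' y" for f f' y t
    by (rule growth_above_barrier[OF is_interval_half_open_dom that(2-4) classical_solutionD(3,4)[OF that(1), simplified]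
          g barrier _ that(5,6)]) (use g_ge in force)+
  have \<phi>_I: "1 \<le> \<phi> x" "g x * \<phi> x < \<phi>' x" if "x \<in> ?I" for x
    using growth[OF \<phi>(1) zero that] that \<phi>(2,3) g_le[OF zero] by auto
  have \<phi>_D: "1 \<le> \<phi> x" if "x \<in> ?D" for x
    using b
  proof (cases rule: half_open_dom_cases)
    case 1
    then show ?thesis using \<phi>_I(1) that by simp
  next
    case (2 B)
    have "1 \<le> \<phi> B"
      by (rule continuous_ge_at_right_end[of 0]) (use 2 \<phi>D(1) \<phi>_I(1) in auto)
    then show ?thesis using \<phi>_I(1)[of x] that 2 by (cases "x = B") auto
  qed
  define L where "L x = integral {0..x} (\<lambda>t. 1 / (\<phi> t)\<^sup>2)" for x
  have \<phi>_ne: "\<phi> x \<noteq> 0" if "x \<in> ?D" for x using \<phi>_D[OF that] by simp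
  have inv_cont: "continuous_on ?D (\<lambda>t. 1 / (\<phi> t)\<^sup>2)"
    by (intro continuous_intros \<phi>D(1)) (use \<phi>_ne in auto)
  have L: "(L has_real_derivative 1 / (\<phi> x)\<^sup>2) (at x within ?D)" if x: "x \<in> ?D" for x
    using b
  proof (cases rule: half_open_dom_cases)
    case 1
    show ?thesis
      using indefinite_integral_deriv_half_open[of b "\<lambda>t. 1 / (\<phi> t)\<^sup>2" x, unfolded 1(2)] inv_cont x
      unfolding 1(3) L_def[abs_def] by simp
  next
    case (2 B)
    show ?thesis
      unfolding 2(4) L_def[abs_def]
      using inv_cont x unfolding 2(4) by (rule integral_has_real_derivative)
  qed
  have L_cont: "continuous_on ?D L" by (rule DERIV_continuous_on, rule L)
  have L_less: "L x < L y" if "x \<in> ?D" "y \<in> ?D" "x < y" for x y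
  proof (rule DERIV_pos_imp_increasing_open[OF that(3)])
    have D: "is_interval ?D" using b by (cases rule: half_open_dom_cases) auto
    have sub: "{x..y} \<subseteq> ?D" using mem_is_interval_1_I[OF D that(1,2)] by auto
    then show "continuous_on {x..y} L" by (rule continuous_on_subset[OF L_cont])
    fix t assume t: "x < t" "t < y"
    have "{x<..<y} \<subseteq> interior ?D" using sub by (intro interior_maximal) auto
    then have "at t within ?D = at t" using t by (intro at_within_interior) auto
    moreover have "t \<in> ?D" using t by (intro subsetD[OF sub]) simp
    ultimately show "\<exists>d. DERIV L t :> d \<and> 0 < d"
      using L[of t] \<phi>_ne[of t] by (intro exI[of _ "1 / (\<phi> t)\<^sup>2"]) auto
  qed
  \<comment> \<open>The derivative of L + 1/(2 \<phi>^2) is (\<phi> - \<phi>')/\<phi>^3, negative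
    because \<phi>' > g \<phi> \<ge> \<phi>. In the limit this bounds the tail of \<integral>
    1/\<phi>^2 beyond x by 1/(2 \<phi>^2), so u is at most 1/(2 \<phi>).\<close>
  have inf_upper: "L t + 1 / (2 * (\<phi> t)\<^sup>2) \<le> L x + 1 / (2 * (\<phi> x)\<^sup>2)"
    if inf: "b = \<infinity>" and xt: "0 \<le> x" "x \<le> t" for x t
  proof -
    have D: "?D = {0..}" "?I = {0..}" using inf by (auto simp: closed_dom_def)
    define F where "F x = - (L x + 1 / (2 * (\<phi> x)\<^sup>2))" for x
    have F: "(F has_real_derivative (\<phi>' x - \<phi> x) / (\<phi> x) ^ 3) (at x within ?D)" if x: "x \<in> ?D" for x
      unfolding F_def using L[OF x] \<phi>D(5)[OF x] \<phi>_ne[OF x]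
      by (auto intro!: derivative_eq_intros simp: field_simps power2_eq_square power3_eq_cube)
    have "F x \<le> F t"
    proof (rule nondecreasing_within[where f = F, OF _ F])
      show "is_interval ?D" unfolding D by simp
      fix s assume "s \<in> ?D"
      then have s: "s \<in> ?I" unfolding D .
      have "1 * \<phi> s \<le> g s * \<phi> s" using g_ge[OF s] \<phi>_I(1)[OF s] by (intro mult_right_mono) auto
      then show "0 \<le> (\<phi>' s - \<phi> s) / (\<phi> s) ^ 3"
        using \<phi>_I[OF s] by (intro divide_nonneg_nonneg zero_le_power) linarith+
    qed (use xt D in auto)
    then show ?thesis by (simp add: F_def)
  qed
  \<comment> \<open>For infinite b this is the total integral of 1/\<phi>^2, for the Dirichlet
    condition the integral up to B. Otherwise u' B + h u B = P (\<open>J\<^sub>0\<close> - L B) -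
    1/\<phi> B with P = \<phi>' B + h \<phi> B, which dictates the extra term 1/(\<phi> B * P); the
    bound g \<ge> \<bar>h\<bar> + 1 makes P positive.\<close>
  obtain J\<^sub>0 where J0: "\<And>x. x \<in> ?I \<Longrightarrow> L x < J\<^sub>0"
    "\<And>x. b = \<infinity> \<Longrightarrow> 0 \<le> x \<Longrightarrow> J\<^sub>0 - L x \<le> 1 / (2 * (\<phi> x)\<^sup>2)"
    "\<And>B. b = ereal B \<Longrightarrow> h = \<infinity> \<Longrightarrow> J\<^sub>0 = L B"
    "\<And>B. b = ereal B \<Longrightarrow> h \<noteq> \<infinity> \<Longrightarrow> J\<^sub>0 = L B + 1 / (\<phi> B * (\<phi>' B + real_of_ereal h * \<phi> B))
       \<and> 0 < \<phi>' B + real_of_ereal h * \<phi> B"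
    using b
  proof (cases rule: half_open_dom_cases)
    case 1
    have bound: "L t \<le> L x + 1 / (2 * (\<phi> x)\<^sup>2)" if "0 \<le> x" "x \<le> t" for x t
    proof -
      have "0 \<le> 1 / (2 * (\<phi> t)\<^sup>2)" by simp
      then show ?thesis using inf_upper[OF 1(1) that] by linarith
    qed
    have bdd: "bdd_above (L ` {0..})"
      by (rule bdd_aboveI[of _ "L 0 + 1 / (2 * (\<phi> 0)\<^sup>2)"]) (auto intro!: bound)
    show ?thesis
    proof (rule that[of "SUP x\<in>{0..}. L x"])
      fix x assume "x \<in> ?I"
      then have x: "0 \<le> x" by simp
      have "L x < L (x + 1)" using x 1 by (intro L_less) auto
      also have "\<dots> \<le> (SUP x\<in>{0..}. L x)" using x by (intro cSUP_upper bdd) auto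
      finally show "L x < (SUP x\<in>{0..}. L x)" .
    next
      fix x :: real assume x: "0 \<le> x"
      have "(SUP x\<in>{0..}. L x) \<le> L x + 1 / (2 * (\<phi> x)\<^sup>2)"
      proof (rule cSUP_least)
        fix t :: real assume t: "t \<in> {0..}"
        show "L t \<le> L x + 1 / (2 * (\<phi> x)\<^sup>2)"
        proof (cases "x \<le> t")
          case False
          then have "L t < L x" using x t 1 by (intro L_less) auto
          moreover have "0 \<le> 1 / (2 * (\<phi> x)\<^sup>2)" by simp
          ultimately show ?thesis by linarith
        qed (use x bound in auto)
      qed auto
      then show "(SUP x\<in>{0..}. L x) - L x \<le> 1 / (2 * (\<phi> x)\<^sup>2)" by simp
    qed (use 1 in auto)
  next
    case (2 B)
    have B: "B \<in> ?D" using 2 by simp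
    have "real_of_ereal h * \<phi> B \<ge> - \<bar>real_of_ereal h\<bar> * \<phi> B"
      using \<phi>_D[OF B] by (intro mult_right_mono) linarith+
    moreover have "(\<bar>real_of_ereal h\<bar> + 1) * \<phi> B \<le> \<phi>' B"
    proof -
      have "0 \<le> \<phi>' B - (\<bar>real_of_ereal h\<bar> + 1) * \<phi> B"
      proof (rule continuous_ge_at_right_end[of 0 B "\<lambda>x. \<phi>' x - (\<bar>real_of_ereal h\<bar> + 1) * \<phi> x"])
        show "continuous_on {0..B} (\<lambda>x. \<phi>' x - (\<bar>real_of_ereal h\<bar> + 1) * \<phi> x)"
          using \<phi>D(1,2) unfolding 2(4) by (intro continuous_intros)
        fix x assume "0 \<le> x" "x < B"
        then have x: "x \<in> ?I" using 2 by simp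
        have "(\<bar>real_of_ereal h\<bar> + 1) * \<phi> x \<le> g x * \<phi> x"
          using g_h[OF x] \<phi>_I(1)[OF x] 2 by (intro mult_right_mono) auto
        then show "0 \<le> \<phi>' x - (\<bar>real_of_ereal h\<bar> + 1) * \<phi> x" using \<phi>_I(2)[OF x] by simp
      qed (use 2 in auto)
      then show ?thesis by simp
    qed
    ultimately have pos: "0 < \<phi>' B + real_of_ereal h * \<phi> B"
      using \<phi>_D[OF B] by (simp add: algebra_simps)
    have less: "L x < L B" if "x \<in> ?I" for x
      using that 2 by (intro L_less) auto
    show ?thesis
    proof (rule that[of "if h = \<infinity> then L B else L B + 1 / (\<phi> B * (\<phi>' B + real_of_ereal h * \<phi> B))"])
      have "0 < 1 / (\<phi> B * (\<phi>' B + real_of_ereal h * \<phi> B))"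
        using pos \<phi>_D[OF B] by simp
      then show "L x < (if h = \<infinity> then L B else L B + 1 / (\<phi> B * (\<phi>' B + real_of_ereal h * \<phi> B)))"
        if "x \<in> ?I" for x
        using less[OF that] by (simp del: zero_less_divide_1_iff)
    qed (use 2 pos in auto)
  qed
  define u where "u x = \<phi> x * (J\<^sub>0 - L x)" for x
  define u' where "u' x = \<phi>' x * (J\<^sub>0 - L x) - 1 / \<phi> x" for x
  have u: "classical_solution q b K u u'"
    unfolding classical_solution_def
  proof (intro conjI ballI)
    fix x assume x: "x \<in> ?D"
    have "(u has_real_derivative u' x) (at x within ?D)"
      unfolding u_def u'_def using L[OF x] \<phi>D(5)[OF x] \<phi>_ne[OF x]
      by (auto intro!: derivative_eq_intros simp: power2_eq_square)
    then show "(u has_vector_derivative u' x) (at x within ?D)" by simp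
  next
    show "continuous_on ?D u'"
      unfolding u'_def by (intro continuous_intros \<phi>D(1,2) L_cont) (use \<phi>_ne in auto)
  next
    fix x assume x: "x \<in> ?I"
    have xD: "x \<in> ?D" by (rule subsetD[OF half_open_dom_subset_closed_dom x])
    have "(u' has_real_derivative (q x + K) * u x) (at x within ?I)"
      unfolding u_def u'_def
      using DERIV_subset[OF L[OF xD] half_open_dom_subset_closed_dom] \<phi>D(3,4)[OF x] \<phi>_ne[OF xD]
      by (auto intro!: derivative_eq_intros simp: power2_eq_square)
    then show "(u' has_vector_derivative (q x + K) *\<^sub>R u x) (at x within ?I)" by simp
  qed
  note uD = classical_solutionD[OF u, unfolded has_real_derivative_iff_has_vector_derivative[symmetric] real_scaleR_def]
  have u_pos: "0 < u x" if "x \<in> ?I" for x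
    using J0(1)[OF that] \<phi>_I(1)[OF that] by (simp add: u_def)
  have u_decay: "u x \<le> exp (- x)" if inf: "b = \<infinity>" and x: "0 \<le> x" for x
  proof -
    have D: "?D = {0..}" "?I = {0..}" using inf by (auto simp: closed_dom_def)
    define F where "F x = \<phi> x * exp (- x)" for x
    have F: "(F has_real_derivative (\<phi>' x - \<phi> x) * exp (- x)) (at x within ?D)" if x: "x \<in> ?D" for x
      unfolding F_def using \<phi>D(5)[OF x]
      by (auto intro!: derivative_eq_intros simp: algebra_simps)
    have "F 0 \<le> F x"
    proof (rule nondecreasing_within[where f = F, OF _ F])
      show "is_interval ?D" unfolding D by simp
      fix s assume "s \<in> ?D"
      then have s: "s \<in> ?I" unfolding D .
      have "1 * \<phi> s \<le> g s * \<phi> s" using g_ge[OF s] \<phi>_I(1)[OF s] by (intro mult_right_mono) auto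
      then show "0 \<le> (\<phi>' s - \<phi> s) * exp (- s)"
        using \<phi>_I[OF s] by (intro mult_nonneg_nonneg exp_ge_zero) linarith
    qed (use x D in auto)
    then have \<phi>_ge: "exp x \<le> \<phi> x" using \<phi>(2) by (simp add: F_def exp_minus field_simps)
    have \<phi>_pos: "0 < \<phi> x" using \<phi>_ge exp_gt_zero[of x] by linarith
    have "u x \<le> \<phi> x * (1 / (2 * (\<phi> x)\<^sup>2))"
      unfolding u_def using J0(2)[OF inf x] \<phi>_pos by (intro mult_left_mono) auto
    also have "\<dots> \<le> 1 / \<phi> x" using \<phi>_pos by (simp add: field_simps power2_eq_square)
    also have "\<dots> \<le> 1 / exp x" using \<phi>_ge by (intro divide_left_mono) (auto simp: \<phi>_pos)
    finally show ?thesis by (simp add: exp_minus field_simps)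
  qed
  have u_dirichlet: "u B = 0" if "b = ereal B" "h = \<infinity>" for B
    using J0(3)[OF that] by (simp add: u_def)
  have u_robin: "u' B + real_of_ereal h * u B = 0" "\<phi>' B + real_of_ereal h * \<phi> B \<noteq> 0"
    if B: "b = ereal B" "h \<noteq> \<infinity>" for B
  proof -
    have "B \<in> ?D" using B b by (auto simp: closed_dom_def)
    then have \<phi>_B: "\<phi> B \<noteq> 0" by (rule \<phi>_ne)
    define P where "P = \<phi>' B + real_of_ereal h * \<phi> B"
    have P: "J\<^sub>0 - L B = 1 / (\<phi> B * P)" "0 < P" using J0(4)[OF B] by (simp_all add: P_def)
    have "u' B + real_of_ereal h * u B = P * (J\<^sub>0 - L B) - 1 / \<phi> B"
      by (simp add: u_def u'_def P_def algebra_simps)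
    then show "u' B + real_of_ereal h * u B = 0" using P \<phi>_B by simp
    show "\<phi>' B + real_of_ereal h * \<phi> B \<noteq> 0" using P(2) by (simp add: P_def)
  qed
  have u'_le: "u' y \<le> g y * u y" if y: "y \<in> ?I" for y
  proof (rule ccontr)
    assume "\<not> u' y \<le> g y * u y"
    then have up: "u y \<le> u t \<and> g t * u t < u' t" if "t \<in> ?I" "y \<le> t" for t
      using growth[OF u y that(1,2) u_pos[OF y]] by simp
    show False using b
    proof (cases rule: half_open_dom_cases)
      case 1
      \<comment> \<open>The point is so far out that exp (- t) \<le> u y / exp 1, which contradicts
        u y \<le> u t.\<close>
      define t where "t = max y (1 - ln (u y))"
      have t: "y \<le> t" "0 \<le> t" using y by (auto simp: t_def)
      have "u y \<le> exp (- t)" using up[of t] u_decay[OF 1(1) t(2)] t 1 by auto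
      also have "\<dots> \<le> exp (ln (u y) - 1)" by (simp add: t_def)
      also have "\<dots> < exp (ln (u y))" by simp
      finally show False using u_pos[OF y] by simp
    next
      case (2 B)
      have yB: "y < B" "0 \<le> y" using y 2 by auto
      have cont: "continuous_on {y..B} u" "continuous_on {y..B} u'"
        using uD(1,2) yB unfolding 2(4) by (auto elim: continuous_on_subset)
      have "u y \<le> u B"
        by (rule continuous_ge_at_right_end[OF cont(1) yB(1)]) (use up yB 2 in auto)
      then have uB: "0 < u B" using u_pos[OF y] by simp
      show False
      proof (cases "h = \<infinity>")
        case True
        then show False using u_dirichlet[OF 2(2)] uB by simp
      next
        case False
        have "0 \<le> u' B - (\<bar>real_of_ereal h\<bar> + 1) * u B"
        proof (rule continuous_ge_at_right_end[of y B "\<lambda>t. u' t - (\<bar>real_of_ereal h\<bar> + 1) * u t"])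
          show "continuous_on {y..B} (\<lambda>t. u' t - (\<bar>real_of_ereal h\<bar> + 1) * u t)"
            by (intro continuous_intros cont)
          fix t assume "y \<le> t" "t < B"
          then have t: "t \<in> ?I" "y \<le> t" using yB 2 by auto
          have "(\<bar>real_of_ereal h\<bar> + 1) * u t \<le> g t * u t"
            using g_h[OF t(1)] u_pos[OF t(1)] 2 by (intro mult_right_mono) auto
          then show "0 \<le> u' t - (\<bar>real_of_ereal h\<bar> + 1) * u t" using up[OF t] by simp
        qed (rule yB)
        moreover have "u' B = - real_of_ereal h * u B" using u_robin(1)[OF 2(2) False] by simp
        moreover have "- real_of_ereal h * u B \<le> \<bar>real_of_ereal h\<bar> * u B"
          using uB by (intro mult_right_mono) linarith+
        ultimately show False using uB by (simp add: algebra_simps)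
      qed
    qed
  qed
  show thesis
  proof (rule that[OF \<phi>(1) u])
    show "u x * \<phi>' x - u' x * \<phi> x = 1" if "x \<in> ?D" for x
      using \<phi>_ne[OF that] by (simp add: u_def u'_def field_simps)
    show "1 \<le> \<phi> x" if "b = \<infinity>" "0 \<le> x" for x using that by (intro \<phi>_I(1)) auto
    show "u B = 0 \<and> \<phi> B \<noteq> 0" if B: "b = ereal B" "h = \<infinity>" for B
      using u_dirichlet[OF B] \<phi>_ne[of B] B b by (auto simp: closed_dom_def)
  qed (use u_pos u'_le u_decay u_robin in auto)
qed

section \<open>Wronskians and uniqueness of the Weyl solution\<close>

lemma wronskian_constant:
  fixes u v u' v' :: "real \<Rightarrow> complex"
  assumes b: "0 < b" and u: "classical_solution q b K u u'" and v: "classical_solution q b K v v'"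
    and x: "x \<in> closed_dom b"
  shows "u x * v' x - u' x * v x = u 0 * v' 0 - u' 0 * v 0"
proof -
  define w where "w x = u x * v' x - u' x * v x" for x
  have w: "(w has_vector_derivative 0) (at x within half_open_dom b)" if x: "x \<in> half_open_dom b" for x
  proof -
    have "(w has_vector_derivative (u x * ((q x + K) *\<^sub>R v x) + u' x * v' x) -
        (u' x * v' x + ((q x + K) *\<^sub>R u x) * v x)) (at x within half_open_dom b)"
      unfolding w_def
      by (intro has_vector_derivative_diff has_vector_derivative_mult classical_solutionD(3,4)[OF u x]
          classical_solutionD(3,4)[OF v x])
    then show ?thesis by (simp add: scaleR_conv_of_real algebra_simps)
  qed
  have "convex (half_open_dom b)"
    using is_interval_half_open_dom[of b] by (simp add: is_interval_convex_1)
  then obtain c where c: "\<And>x. x \<in> half_open_dom b \<Longrightarrow> w x = c"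
    using has_vector_derivative_zero_constant[of "half_open_dom b" w] w by blast
  have cont: "continuous_on (closed_dom b) w"
    unfolding w_def by (intro continuous_intros classical_solutionD(1,2)[OF u] classical_solutionD(1,2)[OF v])
  have all: "w x = c" if x: "x \<in> closed_dom b" for x
    using b
  proof (cases rule: half_open_dom_cases)
    case 1
    then show ?thesis using c x by simp
  next
    case (2 B)
    have closure: "closure {0..<B} = {0..B}" using 2(1) by simp
    show ?thesis
      by (rule continuous_constant_on_closure[of "{0..<B}"]) (use c x cont closure 2 in auto)
  qed
  have "0 \<in> closed_dom b" using b by (simp add: closed_dom_def less_imp_le zero_ereal_def)
  then show ?thesis using all[OF x] all[of 0] by (simp add: w_def)
qed

text \<open>Used as the test that a solution with a component along the growing \<phi> is not square
  integrable at infinity.\<close>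

lemma integrable_ge_constant:
  fixes F :: "real \<Rightarrow> real"
  assumes F: "F integrable_on {R..}" and ge: "\<And>x. R \<le> x \<Longrightarrow> a \<le> F x" and "0 \<le> a"
  shows "a = 0"
proof -
  have "a * real n \<le> integral {R..} F" for n
  proof -
    have "a * real n = integral {R..R + real n} (\<lambda>_. a)" by simp
    also have "\<dots> \<le> integral {R..R + real n} F"
      using ge by (intro integral_le integrable_on_subinterval[OF F]) auto
    also have "\<dots> \<le> integral {R..} F"
      using F order_trans[OF \<open>0 \<le> a\<close> ge] by (intro integral_subset_le integrable_on_subinterval[OF F]) auto
    finally show ?thesis .
  qed
  show ?thesis
  proof (rule ccontr)
    assume "a \<noteq> 0"
    then have "0 < a" using \<open>0 \<le> a\<close> by simp
    then obtain n :: nat where "integral {R..} F / a < real n" using reals_Archimedean2 by blast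
    then show False using \<open>0 < a\<close> \<open>a * real n \<le> integral {R..} F\<close> by (simp add: field_simps)
  qed
qed

text \<open>C bounds the logarithmic derivative from above. The predicate is used first on [0,b)
  with a constant C, then on compact intervals with - \<kappa> + C in its place, which is the decay
  that the error estimate needs.\<close>

definition positive_weyl_solution ::
  "(real \<Rightarrow> real) \<Rightarrow> ereal \<Rightarrow> ereal \<Rightarrow> real \<Rightarrow> real \<Rightarrow> real set \<Rightarrow> (real \<Rightarrow> real) \<Rightarrow> (real \<Rightarrow> real) \<Rightarrow> bool" where
  "positive_weyl_solution q b h \<kappa> C S u u' \<longleftrightarrow>
     (\<forall>x\<in>S. 0 < u x \<and> (u has_real_derivative u' x) (at x within S) \<and>
       (u' has_real_derivative (q x + \<kappa>\<^sup>2) * u x) (at x within S) \<and> u' x \<le> C * u x \<and>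
       m_function q b h (- (complex_of_real \<kappa>)\<^sup>2) x = complex_of_real (u' x / u x))"

text \<open>Here the definite description in \<open>m_function\<close> receives its value: the
  growing \<phi> violates the condition at b, so every Weyl solution is a multiple of the positive
  u. The constants do not depend on \<kappa>, because a barrier for q + K0 is one for q + \<kappa>^2
  as soon as K0 \<le> \<kappa>^2.\<close>

lemma weyl_solution_real:
  assumes pot: "potential q b h" and q: "continuous_on (half_open_dom b) q"
  obtains C \<kappa>\<^sub>0 where "\<And>\<kappa>. \<kappa>\<^sub>0 \<le> \<kappa> \<Longrightarrow> \<exists>u u'. positive_weyl_solution q b h \<kappa> C (half_open_dom b) u u'"
proof -
  let ?I = "half_open_dom b" and ?D = "closed_dom b"
  have b: "0 < b" using pot by (simp add: potential_def)
  obtain g g' C K0 where g: "\<And>x. x \<in> ?I \<Longrightarrow> (g has_real_derivative g' x) (at x within ?I)"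
    "\<And>x. x \<in> ?I \<Longrightarrow> 1 \<le> g x" "\<And>x. x \<in> ?I \<Longrightarrow> g x \<le> C"
    "\<And>x. x \<in> ?I \<Longrightarrow> g' x + (g x)\<^sup>2 \<le> q x + K0"
    "\<And>x. x \<in> ?I \<Longrightarrow> b \<noteq> \<infinity> \<Longrightarrow> \<bar>real_of_ereal h\<bar> + 1 \<le> g x"
    using barrier_exists[OF pot q] by blast
  show thesis
  proof (rule that[of "max 1 K0" C])
    fix \<kappa> assume \<kappa>: "max 1 K0 \<le> \<kappa>"
    have K0: "K0 \<le> \<kappa>\<^sup>2"
    proof -
      have "\<kappa> * 1 \<le> \<kappa> * \<kappa>" using \<kappa> by (intro mult_left_mono) auto
      then show ?thesis using \<kappa> unfolding power2_eq_square by linarith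
    qed
    obtain \<phi> \<phi>' u u' :: "real \<Rightarrow> real" where
      \<phi>: "classical_solution q b (\<kappa>\<^sup>2) \<phi> \<phi>'" and u: "classical_solution q b (\<kappa>\<^sup>2) u u'"
      and wronskian: "\<And>x. x \<in> ?D \<Longrightarrow> u x * \<phi>' x - u' x * \<phi> x = 1"
      and u_pos: "\<And>x. x \<in> ?I \<Longrightarrow> 0 < u x" and u'_le: "\<And>x. x \<in> ?I \<Longrightarrow> u' x \<le> g x * u x"
      and \<phi>_ge: "\<And>x. b = \<infinity> \<Longrightarrow> 0 \<le> x \<Longrightarrow> 1 \<le> \<phi> x" and u_decay: "\<And>x. b = \<infinity> \<Longrightarrow> 0 \<le> x \<Longrightarrow> u x \<le> exp (- x)"
      and dirichlet: "\<And>B. b = ereal B \<Longrightarrow> h = \<infinity> \<Longrightarrow> u B = 0 \<and> \<phi> B \<noteq> 0"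
      and robin: "\<And>B. b = ereal B \<Longrightarrow> h \<noteq> \<infinity> \<Longrightarrow>
        u' B + real_of_ereal h * u B = 0 \<and> \<phi>' B + real_of_ereal h * \<phi> B \<noteq> 0"
      by (rule decaying_solution_exists[OF pot q g(1-3) _ g(5), where K = "\<kappa>\<^sup>2"])
        (use g(4) K0 in force)+
    define cu cu' c\<phi> c\<phi>' where "cu x = complex_of_real (u x)" and "cu' x = complex_of_real (u' x)"
      and "c\<phi> x = complex_of_real (\<phi> x)" and "c\<phi>' x = complex_of_real (\<phi>' x)" for x
    note c_defs = cu_def cu'_def c\<phi>_def c\<phi>'_def
    have cu: "classical_solution q b (\<kappa>\<^sup>2) cu cu'" and c\<phi>: "classical_solution q b (\<kappa>\<^sup>2) c\<phi> c\<phi>'"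
      unfolding c_defs[abs_def] by (intro classical_solution_of_real u \<phi>)+
    have zero: "0 \<in> ?I" "0 \<in> ?D" using b by (auto simp: closed_dom_def less_imp_le zero_ereal_def)
    have c_wronskian: "cu x * c\<phi>' x - cu' x * c\<phi> x = 1" if "x \<in> ?D" for x
      using wronskian[OF that] unfolding c_defs by (metis of_real_1 of_real_diff of_real_mult)
    have u_decay2: "(u x)\<^sup>2 \<le> exp (- 2 * x)" if "b = \<infinity>" "0 \<le> x" for x
    proof -
      have "(u x)\<^sup>2 \<le> (exp (- x))\<^sup>2"
        using u_decay[OF that] u_pos[of x] that by (intro power_mono) auto
      then show ?thesis by (simp add: power2_eq_square flip: exp_add)
    qed
    have exp_int: "(\<lambda>x::real. exp (- 2 * x)) integrable_on {R..}" for R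
      using integrable_on_exp_minus_to_infinity[of 2 R] by simp
    have weyl_u: "weyl_solution q b h (- (complex_of_real \<kappa>)\<^sup>2) cu cu'"
      unfolding weyl_solution_def schroedinger_solution_iff_classical[OF b q]
    proof (intro conjI cu)
      show "\<exists>x\<in>?D. cu x \<noteq> 0" using u_pos[OF zero(1)] zero(2) by (auto simp: cu_def intro!: bexI[of _ 0])
      show "right_end_condition b h cu cu'"
        using b
      proof (cases rule: half_open_dom_cases)
        case 1
        have "(\<lambda>x. (cmod (cu x))\<^sup>2) absolutely_integrable_on {0..}"
        proof (rule measurable_bounded_by_integrable_imp_absolutely_integrable[OF _ _ exp_int])
          have "continuous_on {0..} (\<lambda>x. (cmod (cu x))\<^sup>2)"
            using classical_solutionD(1)[OF cu] unfolding 1(3) by (intro continuous_intros)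
          then show "(\<lambda>x. (cmod (cu x))\<^sup>2) \<in> borel_measurable (lebesgue_on {0..})"
            by (rule continuous_imp_measurable_on_sets_lebesgue) simp
          fix x :: real assume "x \<in> {0..}"
          then show "norm ((cmod (cu x))\<^sup>2) \<le> exp (- 2 * x)" using u_decay2[OF 1(1)] by (simp add: cu_def)
        qed simp
        then show ?thesis using 1(1) by (auto simp: right_end_condition_def)
      next
        case (2 B)
        have "cu' B + complex_of_real (real_of_ereal h) * cu B = 0" if "h \<noteq> \<infinity>"
          using robin[OF 2(2) that] unfolding c_defs by (metis of_real_0 of_real_add of_real_mult)
        then show ?thesis using dirichlet[OF 2(2)] 2(2) by (simp add: right_end_condition_def cu_def)
      qed
    qed
    have unique: "v' x / v x = cu' x / cu x"
      if weyl_v: "weyl_solution q b h (- (complex_of_real \<kappa>)\<^sup>2) v v'" and x: "x \<in> ?I" for v v' x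
    proof -
      have v: "classical_solution q b (\<kappa>\<^sup>2) v v'" and v_ne: "\<exists>x\<in>?D. v x \<noteq> 0"
        and v_end: "right_end_condition b h v v'"
        using weyl_v by (auto simp: weyl_solution_def schroedinger_solution_iff_classical[OF b q])
      \<comment> \<open>As \<open>cu\<close> and \<open>c\<phi>\<close> have Wronskian 1, these two
        Wronskians are the coordinates of v in the basis (\<open>c\<phi>\<close>,
        \<open>cu\<close>). The right-end condition has to kill the first one.\<close>
      define \<alpha> \<beta> where "\<alpha> = cu 0 * v' 0 - cu' 0 * v 0" and "\<beta> = v 0 * c\<phi>' 0 - v' 0 * c\<phi> 0"
      have comb: "v x = \<alpha> * c\<phi> x + \<beta> * cu x" "v' x = \<alpha> * c\<phi>' x + \<beta> * cu' x" if x: "x \<in> ?D" for x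
      proof -
        have eqs: "\<alpha> = cu x * v' x - cu' x * v x" "\<beta> = v x * c\<phi>' x - v' x * c\<phi> x"
          unfolding \<alpha>_def \<beta>_def using wronskian_constant[OF b cu v x] wronskian_constant[OF b v c\<phi> x] by simp_all
        have "\<alpha> * c\<phi> x + \<beta> * cu x = v x * (cu x * c\<phi>' x - cu' x * c\<phi> x)"
          "\<alpha> * c\<phi>' x + \<beta> * cu' x = v' x * (cu x * c\<phi>' x - cu' x * c\<phi> x)"
          unfolding eqs by (simp_all add: algebra_simps)
        then show "v x = \<alpha> * c\<phi> x + \<beta> * cu x" "v' x = \<alpha> * c\<phi>' x + \<beta> * cu' x"
          using c_wronskian[OF x] by simp_all
      qed
      have "\<alpha> = 0"
        using b
      proof (cases rule: half_open_dom_cases)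
        case 1
        obtain R where R: "0 \<le> R" "(\<lambda>x. (cmod (v x))\<^sup>2) absolutely_integrable_on {R..}"
          using v_end 1 by (auto simp: right_end_condition_def)
        \<comment> \<open>Since \<phi> \<ge> 1, the modulus of \<alpha> is at most that of \<alpha>
          \<phi> = v - \<beta> u. So a constant is dominated by an integrable function on a
          half-line.\<close>
        have "(cmod \<alpha>)\<^sup>2 = 0"
        proof (rule integrable_ge_constant)
          show "(\<lambda>x. 2 * (cmod (v x))\<^sup>2 + 2 * (cmod \<beta>)\<^sup>2 * exp (- 2 * x)) integrable_on {R..}"
            using R(2) exp_int by (intro integrable_add integrable_on_mult_right)
              (auto simp: absolutely_integrable_on_def)
          fix x assume "R \<le> x"
          then have x: "0 \<le> x" "x \<in> ?D" using R(1) 1 by auto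
          have "cmod \<alpha> * 1 \<le> cmod \<alpha> * \<phi> x" using \<phi>_ge[OF 1(1) x(1)] by (intro mult_left_mono) auto
          also have "\<dots> = cmod (v x - \<beta> * cu x)"
            using comb(1)[OF x(2)] \<phi>_ge[OF 1(1) x(1)] by (simp add: norm_mult c_defs)
          also have "\<dots> \<le> cmod (v x) + cmod \<beta> * \<bar>u x\<bar>"
            by (metis cu_def norm_mult norm_of_real norm_triangle_ineq4)
          finally have "(cmod \<alpha>)\<^sup>2 \<le> (cmod (v x) + cmod \<beta> * \<bar>u x\<bar>)\<^sup>2" by (intro power_mono) auto
          also have "\<dots> \<le> 2 * (cmod (v x))\<^sup>2 + 2 * (cmod \<beta> * \<bar>u x\<bar>)\<^sup>2"
            using sum_squares_bound[of "cmod (v x)" "cmod \<beta> * \<bar>u x\<bar>"] by (simp add: power2_sum)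
          also have "(cmod \<beta> * \<bar>u x\<bar>)\<^sup>2 \<le> (cmod \<beta>)\<^sup>2 * exp (- 2 * x)"
            unfolding power_mult_distrib power2_abs using u_decay2[OF 1(1) x(1)] by (intro mult_left_mono) auto
          finally show "(cmod \<alpha>)\<^sup>2 \<le> 2 * (cmod (v x))\<^sup>2 + 2 * (cmod \<beta>)\<^sup>2 * exp (- 2 * x)"
            by simp
        qed simp
        then show ?thesis by simp
      next
        case (2 B)
        have B: "B \<in> ?D" using 2 by simp
        show ?thesis
        proof (cases "h = \<infinity>")
          case True
          then show ?thesis
            using v_end dirichlet[OF 2(2) True] comb(1)[OF B] 2(2) by (simp add: right_end_condition_def c_defs)
        next
          case False
          let ?h = "complex_of_real (real_of_ereal h)"
          have "0 = v' B + ?h * v B" using v_end False 2(2) by (simp add: right_end_condition_def)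
          also have "\<dots> = \<alpha> * (c\<phi>' B + ?h * c\<phi> B) + \<beta> * (cu' B + ?h * cu B)"
            unfolding comb[OF B] by (simp add: algebra_simps)
          also have "cu' B + ?h * cu B = 0"
            using robin[OF 2(2) False] unfolding c_defs by (metis of_real_0 of_real_add of_real_mult)
          finally have "\<alpha> * (c\<phi>' B + ?h * c\<phi> B) = 0" by simp
          moreover have "c\<phi>' B + ?h * c\<phi> B \<noteq> 0"
            using robin[OF 2(2) False] unfolding c_defs by (metis of_real_eq_0_iff of_real_add of_real_mult)
          ultimately show ?thesis by simp
        qed
      qed
      moreover from this have "\<beta> \<noteq> 0" using v_ne comb(1) by auto
      moreover have "x \<in> ?D" by (rule subsetD[OF half_open_dom_subset_closed_dom x])
      ultimately show ?thesis using comb[of x] by simp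
    qed
    have m: "m_function q b h (- (complex_of_real \<kappa>)\<^sup>2) x = complex_of_real (u' x / u x)" if x: "x \<in> ?I" for x
      unfolding m_function_def
    proof (rule the_equality)
      show "\<exists>v v'. weyl_solution q b h (- (complex_of_real \<kappa>)\<^sup>2) v v' \<and> complex_of_real (u' x / u x) = v' x / v x"
        using weyl_u by (intro exI[of _ cu] exI[of _ cu']) (simp add: c_defs)
    qed (use unique[OF _ x] in \<open>auto simp: c_defs\<close>)
    have "u' x \<le> C * u x" if x: "x \<in> ?I" for x
      using u'_le[OF x] mult_right_mono[OF g(3)[OF x] less_imp_le[OF u_pos[OF x]]] by linarith
    then show "\<exists>u u'. positive_weyl_solution q b h \<kappa> C ?I u u'"
      unfolding positive_weyl_solution_def
      using u_pos classical_solutionD(3,4)[OF u] m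
      by (intro exI[of _ u] exI[of _ u'] ballI conjI)
        (simp_all add: has_real_derivative_iff_has_vector_derivative)
  qed
qed

text \<open>u' + \<omega> u and u' - \<omega> u separate the growing from the decaying exponential;
  after multiplication by exp (- \<omega> x) and exp (\<omega> x) both are nondecreasing, because V
  \<ge> \<omega>^2. The bound at Y keeps u away from the growing behaviour: it compares the first
  quantity at t with (3/2) \<omega> u Y and the second with - (1/2) \<omega> u Y. Eliminating u Y
  yields u' + \<omega> u \<le> 6 e^2 \<omega> u with e = exp (- \<omega> (Y - t)), and s \<le> exp s
  turns 6 e^2 \<omega> into 3/(Y - t), which is free of \<omega>.\<close>

lemma positive_solution_decay:
  fixes u u' V :: "real \<Rightarrow> real"
  assumes u: "\<And>x. x \<in> {0..Y} \<Longrightarrow> (u has_real_derivative u' x) (at x within {0..Y})"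
    and u': "\<And>x. x \<in> {0..Y} \<Longrightarrow> (u' has_real_derivative V x * u x) (at x within {0..Y})"
    and pos: "\<And>x. x \<in> {0..Y} \<Longrightarrow> 0 < u x" and V: "\<And>x. x \<in> {0..Y} \<Longrightarrow> \<omega>\<^sup>2 \<le> V x"
    and \<omega>: "0 < \<omega>" and right: "u' Y \<le> \<omega> / 2 * u Y" and t: "0 \<le> t" "t < Y"
  shows "u' t \<le> (- \<omega> + 3 / (Y - t)) * u t"
proof -
  define w where "w x = (u' x + \<omega> * u x) * exp (- \<omega> * x)" for x
  define z where "z x = (u' x - \<omega> * u x) * exp (\<omega> * x)" for x
  have w: "(w has_real_derivative (V x - \<omega>\<^sup>2) * u x * exp (- \<omega> * x)) (at x within {0..Y})" if "x \<in> {0..Y}" for x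
    unfolding w_def using u[OF that] u'[OF that]
    by (auto intro!: derivative_eq_intros simp: algebra_simps power2_eq_square)
  have z: "(z has_real_derivative (V x - \<omega>\<^sup>2) * u x * exp (\<omega> * x)) (at x within {0..Y})" if "x \<in> {0..Y}" for x
    unfolding z_def using u[OF that] u'[OF that]
    by (auto intro!: derivative_eq_intros simp: algebra_simps power2_eq_square)
  have "w t \<le> w Y"
  proof (rule nondecreasing_within[where f = w, OF is_interval_cc w])
    fix x assume x: "x \<in> {0..Y}"
    show "0 \<le> (V x - \<omega>\<^sup>2) * u x * exp (- \<omega> * x)"
      using V[OF x] pos[OF x] by (intro mult_nonneg_nonneg) auto
  qed (use t in auto)
  moreover have "z t \<le> z Y"
  proof (rule nondecreasing_within[where f = z, OF is_interval_cc z])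
    fix x assume x: "x \<in> {0..Y}"
    show "0 \<le> (V x - \<omega>\<^sup>2) * u x * exp (\<omega> * x)"
      using V[OF x] pos[OF x] by (intro mult_nonneg_nonneg) auto
  qed (use t in auto)
  moreover define e where "e = exp (- \<omega> * (Y - t))"
  ultimately have wY: "u' t + \<omega> * u t \<le> (u' Y + \<omega> * u Y) * e" and zY: "(u' t - \<omega> * u t) * e \<le> u' Y - \<omega> * u Y"
    by (simp_all add: w_def z_def e_def field_simps exp_diff exp_minus exp_add)
  have e: "0 < e" by (simp add: e_def)
  have t_in: "t \<in> {0..Y}" "Y \<in> {0..Y}" using t by auto
  have "(u' t + \<omega> * u t) \<le> 6 * e\<^sup>2 * \<omega> * u t"
  proof (cases "u' t + \<omega> * u t \<le> 0")
    case True
    also have "0 \<le> 6 * e\<^sup>2 * \<omega> * u t" using \<omega> pos[OF t_in(1)] by simp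
    finally show ?thesis .
  next
    case False
    have "u' t + \<omega> * u t \<le> (3 * \<omega> / 2 * u Y) * e"
      using wY right e mult_right_mono[of "u' Y + \<omega> * u Y" "3 * \<omega> / 2 * u Y" e] by linarith
    moreover have "\<omega> / 2 * u Y \<le> (\<omega> * u t - u' t) * e"
      using zY right by (simp add: algebra_simps)
    then have "(\<omega> / 2 * u Y) * (3 * e) \<le> ((\<omega> * u t - u' t) * e) * (3 * e)"
      using e by (intro mult_right_mono) auto
    ultimately have "u' t + \<omega> * u t \<le> 3 * e\<^sup>2 * (2 * \<omega> * u t - (u' t + \<omega> * u t))"
      by (simp add: algebra_simps power2_eq_square)
    also have "\<dots> \<le> 3 * e\<^sup>2 * (2 * \<omega> * u t)"
      using False e by (intro mult_left_mono) auto
    finally show ?thesis by (simp add: algebra_simps)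
  qed
  moreover have "6 * e\<^sup>2 * \<omega> \<le> 3 / (Y - t)"
  proof -
    have "2 * \<omega> * (Y - t) \<le> exp (2 * \<omega> * (Y - t))"
      using exp_ge_add_one_self[of "2 * \<omega> * (Y - t)"] by linarith
    moreover have "e\<^sup>2 * exp (2 * \<omega> * (Y - t)) = 1"
      by (simp add: e_def power2_eq_square flip: exp_add)
    ultimately have "e\<^sup>2 * (2 * \<omega> * (Y - t)) \<le> 1"
      using mult_left_mono[of "2 * \<omega> * (Y - t)" "exp (2 * \<omega> * (Y - t))" "e\<^sup>2"] by simp
    then show ?thesis using t by (simp add: field_simps)
  qed
  then have "6 * e\<^sup>2 * \<omega> * u t \<le> 3 / (Y - t) * u t"
    using pos[OF t_in(1)] by (intro mult_right_mono) auto
  ultimately show ?thesis by (simp add: algebra_simps)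
qed

text \<open>Too steep a descent at y would push u below 0 before z: u'' \<le> M u y because u
  decreases, so a second-order Taylor estimate at z leaves 0 < u z only if u' y is not too
  negative.\<close>

lemma decreasing_solution_log_derivative_ge:
  fixes u u' V :: "real \<Rightarrow> real"
  assumes yz: "y < z"
    and u: "\<And>x. x \<in> {y..z} \<Longrightarrow> (u has_real_derivative u' x) (at x within {y..z})"
    and u': "\<And>x. x \<in> {y..z} \<Longrightarrow> (u' has_real_derivative V x * u x) (at x within {y..z})"
    and pos: "\<And>x. x \<in> {y..z} \<Longrightarrow> 0 < u x" and V: "\<And>x. x \<in> {y..z} \<Longrightarrow> 0 \<le> V x \<and> V x \<le> M"
    and decr: "\<And>x. x \<in> {y..z} \<Longrightarrow> u' x \<le> 0"
  shows "- (1 / (z - y) + M * (z - y)) * u y \<le> u' y"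
proof -
  have u_le: "u x \<le> u y" if "x \<in> {y..z}" for x
  proof -
    have "- u y \<le> - u x"
      by (rule nondecreasing_within[where f = "\<lambda>x. - u x", OF is_interval_cc DERIV_minus[OF u]])
        (use that decr yz in auto)
    then show ?thesis by simp
  qed
  define F where "F s = u' y + M * (s - y) * u y - u' s" for s
  have F: "(F has_real_derivative M * u y - V s * u s) (at s within {y..z})" if "s \<in> {y..z}" for s
    unfolding F_def using u'[OF that] by (auto intro!: derivative_eq_intros)
  have F_nonneg: "0 \<le> F s" if s: "s \<in> {y..z}" for s
  proof -
    have "F y \<le> F s"
    proof (rule nondecreasing_within[where f = F, OF is_interval_cc F])
      fix r assume r: "r \<in> {y..z}"
      have "V r * u r \<le> M * u y"
        using V[OF r] u_le[OF r] pos[OF r] by (intro mult_mono) auto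
      then show "0 \<le> M * u y - V r * u r" by simp
    qed (use s yz in auto)
    then show ?thesis by (simp add: F_def)
  qed
  define G where "G s = u y + u' y * (s - y) + M * u y * ((s - y)\<^sup>2 / 2) - u s" for s
  have G: "(G has_real_derivative F s) (at s within {y..z})" if "s \<in> {y..z}" for s
    unfolding G_def F_def using u[OF that] by (auto intro!: derivative_eq_intros)
  have "G y \<le> G z"
    by (rule nondecreasing_within[where f = G, OF is_interval_cc G]) (use yz F_nonneg in auto)
  moreover have "0 < u z" using pos yz by auto
  ultimately have *: "0 \<le> u y + u' y * (z - y) + M * u y * ((z - y)\<^sup>2 / 2)" by (simp add: G_def)
  have M: "0 \<le> M * u y" using V[of y] pos[of y] yz by auto
  have "M * u y * ((z - y)\<^sup>2 / 2) \<le> M * u y * (z - y)\<^sup>2"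
    using M by (intro mult_left_mono) auto
  with * have "0 \<le> (u y + u' y * (z - y) + M * u y * (z - y)\<^sup>2) / (z - y)"
    using yz by (intro divide_nonneg_nonneg) auto
  also have "\<dots> = u' y + (1 / (z - y) + M * (z - y)) * u y"
    using yz by (simp add: field_simps power2_eq_square)
  finally show ?thesis by (simp only: mult_minus_left)
qed

text \<open>Two points y < z < Y < b give the room for both estimates. The loss 3/(Y - t) of
  \<open>positive_solution_decay\<close> is bounded on [0,z], and on [y,z] the solution still
  decreases, so that its slope at y is bounded below. As V is of size \<kappa>^2, the lower bound is
  of that order.\<close>

lemma weyl_solution_real_decay:
  assumes pot: "potential q b h" and q: "continuous_on (half_open_dom b) q"
    and y: "0 \<le> y" "ereal y < b"
  obtains C L \<kappa>\<^sub>0 where "0 \<le> L" "1 \<le> \<kappa>\<^sub>0" "\<And>\<kappa>. \<kappa>\<^sub>0 \<le> \<kappa> \<Longrightarrow>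
    \<exists>u u'. positive_weyl_solution q b h \<kappa> (- \<kappa> + C) {0..y} u u' \<and> - L * \<kappa>\<^sup>2 * u y \<le> u' y"
proof -
  obtain Y where Y: "y < Y" "ereal Y < b" using ereal_dense2[OF y(2)] by auto
  have sub: "{0..Y} \<subseteq> half_open_dom b"
  proof
    fix x assume "x \<in> {0..Y}"
    then show "x \<in> half_open_dom b" using Y le_less_trans[of "ereal x" "ereal Y" b] by simp
  qed
  define z where "z = (y + Y) / 2"
  have z: "y < z" "z < Y" using Y by (auto simp: z_def)
  have "compact (q ` {0..Y})" by (intro compact_continuous_image continuous_on_subset[OF q sub]) auto
  then have "bounded (q ` {0..Y})" by (rule compact_imp_bounded)
  then obtain K where K: "0 < K" "\<And>x. x \<in> {0..Y} \<Longrightarrow> \<bar>q x\<bar> \<le> K"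
    by (auto simp: bounded_pos)
  obtain C0 \<kappa>1 where C0: "\<And>\<kappa>. \<kappa>1 \<le> \<kappa> \<Longrightarrow> \<exists>u u'. positive_weyl_solution q b h \<kappa> C0 (half_open_dom b) u u'"
    by (rule weyl_solution_real[OF pot q], rule that)
  define C where "C = (K + 1) + 3 / (Y - z)"
  define \<kappa>2 where "\<kappa>2 = 1 + \<bar>\<kappa>1\<bar> + 2 * \<bar>C0\<bar> + (K + 1) + C"
  define L where "L = 1 / (z - y) + (1 + K) * (z - y)"
  have C: "0 < C" using K z by (simp add: C_def add_pos_pos)
  have L: "0 \<le> L" using K z by (simp add: L_def)
  have "\<exists>u u'. positive_weyl_solution q b h \<kappa> (- \<kappa> + C) {0..y} u u' \<and> - L * \<kappa>\<^sup>2 * u y \<le> u' y"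
    if \<kappa>: "\<kappa>2 \<le> \<kappa>" for \<kappa>
  proof -
    \<comment> \<open>The shift K + 1 gives \<omega>^2 \<le> \<kappa>^2 - K \<le> q + \<kappa>^2
      once \<kappa> \<ge> K + 1. The threshold \<open>\<kappa>2\<close> also provides C0 \<le>
      \<omega>/2, the condition at the right end Y, and C \<le> \<kappa>, which makes u
      decreasing.\<close>
    define \<omega> where "\<omega> = \<kappa> - (K + 1)"
    have \<kappa>_ge: "1 \<le> \<kappa>" "\<kappa>1 \<le> \<kappa>" "C \<le> \<kappa>" using \<kappa> C K(1) by (auto simp: \<kappa>2_def)
    have \<omega>: "0 < \<omega>" "C0 \<le> \<omega> / 2" using \<kappa> C K(1) by (auto simp: \<omega>_def \<kappa>2_def)
    obtain u u' where u: "\<And>x. x \<in> half_open_dom b \<Longrightarrow> 0 < u x"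
      "\<And>x. x \<in> half_open_dom b \<Longrightarrow> (u has_real_derivative u' x) (at x within half_open_dom b)"
      "\<And>x. x \<in> half_open_dom b \<Longrightarrow> (u' has_real_derivative (q x + \<kappa>\<^sup>2) * u x) (at x within half_open_dom b)"
      "\<And>x. x \<in> half_open_dom b \<Longrightarrow> u' x \<le> C0 * u x"
      "\<And>x. x \<in> half_open_dom b \<Longrightarrow> m_function q b h (- (complex_of_real \<kappa>)\<^sup>2) x = complex_of_real (u' x / u x)"
      using C0[OF \<kappa>_ge(2)] unfolding positive_weyl_solution_def by blast
    have u_sub: "(u has_real_derivative u' x) (at x within S)"
      "(u' has_real_derivative (q x + \<kappa>\<^sup>2) * u x) (at x within S)" "0 < u x"
      if "x \<in> S" "S \<subseteq> {0..Y}" for x S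
    proof -
      have S: "S \<subseteq> half_open_dom b" by (rule order_trans[OF that(2) sub])
      have x: "x \<in> half_open_dom b" by (rule subsetD[OF S that(1)])
      show "(u has_real_derivative u' x) (at x within S)"
        "(u' has_real_derivative (q x + \<kappa>\<^sup>2) * u x) (at x within S)" "0 < u x"
        by (rule DERIV_subset[OF u(2)[OF x] S], rule DERIV_subset[OF u(3)[OF x] S], rule u(1)[OF x])
    qed
    have V_ge: "\<omega>\<^sup>2 \<le> q x + \<kappa>\<^sup>2" if "x \<in> {0..Y}" for x
    proof -
      have "K + 1 \<le> \<kappa>" using \<omega> by (simp add: \<omega>_def)
      then have "(K + 1) * (K + 1) \<le> (K + 1) * \<kappa>" "(K + 1) * 1 \<le> (K + 1) * \<kappa>"
        using K(1) \<kappa>_ge by (auto intro!: mult_left_mono)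
      then show ?thesis using K(2)[OF that] by (simp add: \<omega>_def power2_eq_square algebra_simps abs_le_iff)
    qed
    have "Y \<in> half_open_dom b" using y Y by simp
    have right: "u' Y \<le> \<omega> / 2 * u Y"
      using u(4)[OF \<open>Y \<in> half_open_dom b\<close>] mult_right_mono[OF \<omega>(2) less_imp_le[OF u(1)[OF \<open>Y \<in> half_open_dom b\<close>]]]
      by linarith
    have decay: "u' t \<le> (- \<kappa> + C) * u t" if t: "t \<in> {0..z}" for t
    proof -
      have tY: "t \<in> {0..Y}" using t z by auto
      have "u' t \<le> (- \<omega> + 3 / (Y - t)) * u t"
      proof (rule positive_solution_decay[where Y = Y and u = u and u' = u' and V = "\<lambda>x. q x + \<kappa>\<^sup>2"])
        fix x assume x: "x \<in> {0..Y}"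
        show "(u has_real_derivative u' x) (at x within {0..Y})"
          "(u' has_real_derivative (q x + \<kappa>\<^sup>2) * u x) (at x within {0..Y})" "0 < u x"
          by (rule u_sub[OF x order_refl])+
      qed (use t z V_ge \<omega>(1) right in auto)
      also have "- \<omega> + 3 / (Y - t) \<le> - \<kappa> + C"
        using t z by (auto simp: \<omega>_def C_def intro!: divide_left_mono mult_pos_pos)
      then have "(- \<omega> + 3 / (Y - t)) * u t \<le> (- \<kappa> + C) * u t"
        using u_sub(3)[OF tY] by (intro mult_right_mono) auto
      finally show ?thesis .
    qed
    have sub_yz: "{y..z} \<subseteq> {0..Y}" "{0..y} \<subseteq> {0..Y}" using y z by auto
    have "- (1 / (z - y) + (K + \<kappa>\<^sup>2) * (z - y)) * u y \<le> u' y"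
    proof (rule decreasing_solution_log_derivative_ge[where V = "\<lambda>x. q x + \<kappa>\<^sup>2"])
      fix x assume x: "x \<in> {y..z}"
      then have xY: "x \<in> {0..Y}" using sub_yz by auto
      show "0 \<le> q x + \<kappa>\<^sup>2 \<and> q x + \<kappa>\<^sup>2 \<le> K + \<kappa>\<^sup>2"
        using order_trans[OF zero_le_power2 V_ge[OF xY]] K(2)[OF xY] by (auto simp: abs_le_iff)
      have "(- \<kappa> + C) * u x \<le> 0"
        using \<kappa>_ge u_sub(3)[OF x sub_yz(1)] by (intro mult_nonpos_nonneg) auto
      then show "u' x \<le> 0" using decay[of x] x y by auto
      show "(u has_real_derivative u' x) (at x within {y..z})"
        "(u' has_real_derivative (q x + \<kappa>\<^sup>2) * u x) (at x within {y..z})" "0 < u x"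
        by (rule u_sub[OF x sub_yz(1)])+
    qed (use z in auto)
    moreover have "1 / (z - y) + (K + \<kappa>\<^sup>2) * (z - y) \<le> L * \<kappa>\<^sup>2"
    proof -
      have k: "1 \<le> \<kappa>\<^sup>2" using \<kappa>_ge(1) by simp
      have "1 / (z - y) * 1 \<le> 1 / (z - y) * \<kappa>\<^sup>2" using z k by (intro mult_left_mono) auto
      moreover have "K * (z - y) * 1 \<le> K * (z - y) * \<kappa>\<^sup>2" using z k K by (intro mult_left_mono) auto
      ultimately show ?thesis by (simp add: L_def algebra_simps)
    qed
    then have "(1 / (z - y) + (K + \<kappa>\<^sup>2) * (z - y)) * u y \<le> L * \<kappa>\<^sup>2 * u y"
      using u_sub(3)[of y "{0..Y}"] y Y by (intro mult_right_mono) auto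
    ultimately have "- L * \<kappa>\<^sup>2 * u y \<le> u' y" unfolding mult_minus_left by linarith
    moreover have "m_function q b h (- (complex_of_real \<kappa>)\<^sup>2) x = complex_of_real (u' x / u x)" if "x \<in> {0..y}" for x
      by (rule u(5)[OF subsetD[OF sub subsetD[OF sub_yz(2) that]]])
    moreover have "u' x \<le> (- \<kappa> + C) * u x" if "x \<in> {0..y}" for x
      using that z by (intro decay) auto
    ultimately show ?thesis
      unfolding positive_weyl_solution_def
      using u_sub[OF _ sub_yz(2)] by (intro exI[of _ u] exI[of _ u'] conjI ballI)
  qed
  moreover have "1 \<le> \<kappa>2" using C K(1) by (simp add: \<kappa>2_def)
  ultimately show thesis by (intro that[OF L, of \<kappa>2 C])
qed

section \<open>Asymptotics of the m-function\<close>

lemma antiderivative_real_line: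
  fixes f :: "real \<Rightarrow> real"
  assumes f: "continuous_on UNIV f"
  obtains F where "\<And>t. (F has_real_derivative f t) (at t)" "F 0 = 0"
    "\<And>s t. s \<le> t \<Longrightarrow> F t - F s = integral {s..t} f"
proof -
  define F where "F t = integral {0..t} f - integral {t..0} f" for t
  have int: "f integrable_on {s..t}" for s t
    by (intro integrable_continuous_real continuous_on_subset[OF f]) auto
  have diff: "F t - F s = integral {s..t} f" if "s \<le> t" for s t
  proof -
    have comb: "integral {x..y} f + integral {y..z} f = integral {x..z} f" if "x \<le> y" "y \<le> z" for x y z
      by (rule Henstock_Kurzweil_Integration.integral_combine[OF that int])
    consider "0 \<le> s" | "s \<le> 0" "0 \<le> t" | "t \<le> 0" by linarith
    then show ?thesis
    proof cases
      case 1
      have "integral {t..0} f = 0" "integral {s..0} f = 0"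
        using 1 that by (cases "t = 0"; cases "s = 0"; simp)+
      then show ?thesis using comb[of 0 s t] 1 that by (simp add: F_def)
    next
      case 2
      have "integral {t..0} f = 0" "integral {0..s} f = 0"
        using 2 by (cases "t = 0"; cases "s = 0"; simp)+
      then show ?thesis using comb[of s 0 t] 2 by (simp add: F_def)
    next
      case 3
      have "integral {0..t} f = 0" "integral {0..s} f = 0"
        using 3 that by (cases "t = 0"; cases "s = 0"; simp)+
      then show ?thesis using comb[of s t 0] 3 that by (simp add: F_def)
    qed
  qed
  have deriv: "(F has_real_derivative f t) (at t)" for t
  proof -
    have "((\<lambda>x. integral {t - 1..x} f) has_real_derivative f t) (at t within {t - 1..t + 1})"
      by (intro integral_has_real_derivative continuous_on_subset[OF f]) auto
    then have "((\<lambda>x. integral {t - 1..x} f) has_real_derivative f t) (at t)"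
      by (simp add: at_within_Icc_at)
    then have "((\<lambda>x. F (t - 1) + integral {t - 1..x} f) has_real_derivative f t) (at t)"
      by (auto intro!: derivative_eq_intros)
    then show ?thesis
    proof (rule has_field_derivative_transform_within_open[where S = "{t - 1<..}"])
      fix x assume "x \<in> {t - 1<..}"
      then show "F (t - 1) + integral {t - 1..x} f = F x" using diff[of "t - 1" x] by simp
    qed auto
  qed
  show thesis
    by (rule that[OF deriv _ diff]) (simp_all add: F_def)
qed

text \<open>
  Truncating both factors at c, the square of the Laplace integral differs from the Laplace integral
  of the convolution only through the part of the convolution living on [c, 2c].
\<close>

lemma truncated_laplace_convolution:
  fixes a :: "real \<Rightarrow> real" and \<kappa> c M :: real
  assumes a: "continuous_on UNIV a" and M: "\<And>t. t \<in> {0..c} \<Longrightarrow> \<bar>a t\<bar> \<le> M" and c: "0 \<le> c" and \<kappa>: "0 \<le> \<kappa>"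
  shows "\<bar>(integral {0..c} (\<lambda>t. a t * exp (- 2 * \<kappa> * t)))\<^sup>2 -
      integral {0..c} (\<lambda>t. integral {0..t} (\<lambda>s. a s * a (t - s)) * exp (- 2 * \<kappa> * t))\<bar>
    \<le> M\<^sup>2 * c\<^sup>2 * exp (- 2 * \<kappa> * c)"
proof -
  define f where "f t = a t * exp (- 2 * \<kappa> * t)" for t
  have f: "continuous_on A f" for A
    unfolding f_def by (intro continuous_intros continuous_on_subset[OF a]) auto
  obtain F where F: "\<And>t. (F has_real_derivative f t) (at t)" "F 0 = 0"
    "\<And>s t. s \<le> t \<Longrightarrow> F t - F s = integral {s..t} f"
    using antiderivative_real_line[OF f] by blast
  have F_cont: "continuous_on A F" for A
    by (rule DERIV_continuous_on, rule has_field_derivative_at_within, rule F(1))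
  have F_at: "continuous_on A (\<lambda>x. F (g x))" if "continuous_on A g" for A and g :: "'b::topological_space \<Rightarrow> real"
    by (rule continuous_on_compose2[OF F_cont[of UNIV] that]) auto
  \<comment> \<open>An antiderivative of the weighted self-convolution: differentiation moves F to
    f, and the exponentials combine to exp (- 2 \<kappa> t). This takes the place of an interchange
    of a double integral.\<close>
  define \<Phi> where "\<Phi> t = integral {0..t} (\<lambda>s. f s * F (t - s))" for t
  have \<Phi>: "(\<Phi> has_real_derivative integral {0..t} (\<lambda>s. a s * a (t - s)) * exp (- 2 * \<kappa> * t)) (at t within {0..c})"
    if t: "t \<in> {0..c}" for t
  proof -
    have "(\<Phi> has_real_derivative f t * F (t - t) + integral {0..t} (\<lambda>s. f s * f (t - s))) (at t within {0..c})"
      unfolding \<Phi>_def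
    proof (rule leibniz_upper_limit[OF _ _ _ t])
      fix v s :: real
      have "((\<lambda>v. F (v - s)) has_real_derivative f (v - s) * 1) (at v)"
        by (rule DERIV_chain2[OF F(1)]) (auto intro!: derivative_eq_intros)
      then have "((\<lambda>v. F (v - s)) has_real_derivative f (v - s)) (at v)" by simp
      then show "((\<lambda>v. f s * F (v - s)) has_real_derivative f s * f (v - s)) (at v)"
        by (rule DERIV_cmult)
    next
      show "continuous_on UNIV (\<lambda>(v, s). f s * F (v - s))" "continuous_on UNIV (\<lambda>(v, s). f s * f (v - s))"
        unfolding case_prod_unfold
        by (intro continuous_intros F_at continuous_on_compose2[OF f[of UNIV]]; simp)+
    qed
    moreover have "f s * f (t - s) = a s * a (t - s) * exp (- 2 * \<kappa> * t)" for s
      by (simp add: f_def algebra_simps flip: exp_add)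
    ultimately show ?thesis using F(2) by simp
  qed
  have "((\<lambda>t. integral {0..t} (\<lambda>s. a s * a (t - s)) * exp (- 2 * \<kappa> * t)) has_integral (\<Phi> c - \<Phi> 0)) {0..c}"
    using \<Phi> c by (intro fundamental_theorem_of_calculus)
      (auto simp: has_real_derivative_iff_has_vector_derivative[symmetric])
  then have conv: "integral {0..c} (\<lambda>t. integral {0..t} (\<lambda>s. a s * a (t - s)) * exp (- 2 * \<kappa> * t)) = \<Phi> c"
    by (simp add: integral_unique \<Phi>_def)
  have Fc: "integral {0..c} f = F c" using F(2) F(3)[OF c] by simp
  \<comment> \<open>The difference is the integral of f s * f r over the triangle of the square
    [0,c]^2 where s + r \<ge> c. On it the exponential weight is at most exp (- 2 \<kappa>
    c).\<close>
  have "(F c)\<^sup>2 - \<Phi> c = integral {0..c} (\<lambda>s. f s * (F c - F (c - s)))"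
  proof -
    have "integral {0..c} (\<lambda>s. f s * (F c - F (c - s))) =
        integral {0..c} (\<lambda>s. f s * F c) - integral {0..c} (\<lambda>s. f s * F (c - s))"
      unfolding right_diff_distrib
      by (rule Henstock_Kurzweil_Integration.integral_diff; intro integrable_continuous_real continuous_intros f F_at)
    then show ?thesis by (simp add: Fc \<Phi>_def power2_eq_square)
  qed
  moreover have "norm (integral {0..c} (\<lambda>s. f s * (F c - F (c - s)))) \<le> (c * M\<^sup>2 * exp (- 2 * \<kappa> * c)) * (c - 0)"
  proof (rule integral_bound[OF c])
    show "continuous_on {0..c} (\<lambda>s. f s * (F c - F (c - s)))" by (intro continuous_intros f F_at)
    fix s assume s: "s \<in> {0..c}"
    have M0: "0 \<le> M" using M[OF s] by linarith
    have "norm (integral {c - s..c} f) \<le> (M * exp (- 2 * \<kappa> * (c - s))) * (c - (c - s))"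
    proof (rule integral_bound[OF _ f])
      fix r assume r: "r \<in> {c - s..c}"
      then have "\<bar>a r\<bar> \<le> M" using s by (intro M) auto
      moreover have "exp (- 2 * \<kappa> * r) \<le> exp (- 2 * \<kappa> * (c - s))" using \<kappa> r by (auto intro!: mult_left_mono)
      ultimately show "norm (f r) \<le> M * exp (- 2 * \<kappa> * (c - s))"
        unfolding f_def real_norm_def abs_mult using M0 by (intro mult_mono) auto
    qed (use s in auto)
    then have "\<bar>F c - F (c - s)\<bar> \<le> M * exp (- 2 * \<kappa> * (c - s)) * s" using F(3)[of "c - s" c] s by simp
    also have "\<dots> \<le> M * exp (- 2 * \<kappa> * (c - s)) * c" using s M0 by (intro mult_left_mono) auto
    finally have *: "\<bar>F c - F (c - s)\<bar> \<le> M * exp (- 2 * \<kappa> * (c - s)) * c" .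
    have "\<bar>f s\<bar> * \<bar>F c - F (c - s)\<bar> \<le> (M * exp (- 2 * \<kappa> * s)) * (M * exp (- 2 * \<kappa> * (c - s)) * c)"
      using M[OF s] M0 * by (intro mult_mono) (auto simp: f_def abs_mult)
    also have "\<dots> = c * M\<^sup>2 * (exp (- 2 * \<kappa> * s) * exp (- 2 * \<kappa> * (c - s)))"
      by (simp add: power2_eq_square)
    also have "exp (- 2 * \<kappa> * s) * exp (- 2 * \<kappa> * (c - s)) = exp (- 2 * \<kappa> * c)"
      by (simp add: algebra_simps flip: exp_add)
    finally show "norm (f s * (F c - F (c - s))) \<le> c * M\<^sup>2 * exp (- 2 * \<kappa> * c)" by (simp add: abs_mult)
  qed
  ultimately show ?thesis
    unfolding conv Fc[unfolded f_def] by (simp add: power2_eq_square mult_ac)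
qed

text \<open>B \<alpha> s stands for A(\<alpha>, s - \<alpha>). With s in [t,y] as integration
  variable, t enters the amplitude only through the first argument of B, whose derivative is the
  negative of the convolution of A(., t) with itself. With cutoff y - t the integral is empty at t =
  y, so the approximation there is simply - \<kappa>.\<close>

lemma m_function_expansion:
  fixes q :: "real \<Rightarrow> real" and B B' :: "real \<Rightarrow> real \<Rightarrow> real"
  assumes pot: "potential q b h" and q: "continuous_on (half_open_dom b) q"
    and xy: "0 \<le> x" "x < y" "ereal y < b"
    and B_deriv: "\<And>\<alpha> s. ((\<lambda>\<alpha>. B \<alpha> s) has_real_derivative B' \<alpha> s) (at \<alpha>)"
    and B_cont: "continuous_on UNIV (\<lambda>(\<alpha>, s). B \<alpha> s)" and B'_cont: "continuous_on UNIV (\<lambda>(\<alpha>, s). B' \<alpha> s)"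
    and B_0: "\<And>s. s \<in> {x..y} \<Longrightarrow> B 0 s = q s"
    and B'_eq: "\<And>\<alpha> s. 0 \<le> \<alpha> \<Longrightarrow> \<alpha> \<le> y - x \<Longrightarrow>
      B' \<alpha> s = - integral {0..\<alpha>} (\<lambda>\<beta>. B \<beta> (s - \<alpha> + \<beta>) * B (\<alpha> - \<beta>) (s - \<beta>))"
  shows "\<exists>C \<kappa>\<^sub>0. \<forall>\<kappa>\<ge>\<kappa>\<^sub>0. cmod (m_function q b h (- (complex_of_real \<kappa>)\<^sup>2) x -
      complex_of_real (- \<kappa> - integral {0..y - x} (\<lambda>\<alpha>. B \<alpha> (x + \<alpha>) * exp (- 2 * \<alpha> * \<kappa>))))
    \<le> C * \<kappa>\<^sup>2 * exp (- 2 * (y - x) * \<kappa>)"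
proof -
  have y: "0 \<le> y" using xy by simp
  define c where "c = y - x"
  have c: "0 < c" using xy by (simp add: c_def)
  have Bc: "continuous_on A (\<lambda>z. B (f z) (g z))" if "continuous_on A f" "continuous_on A g"
    for A :: "'z::topological_space set" and f g
    using continuous_on_compose2[OF B_cont continuous_on_Pair[OF that]] by simp
  have B'c: "continuous_on A (\<lambda>z. B' (f z) (g z))" if "continuous_on A f" "continuous_on A g"
    for A :: "'z::topological_space set" and f g
    using continuous_on_compose2[OF B'_cont continuous_on_Pair[OF that]] by simp
  have "compact ((\<lambda>(\<alpha>, t). B \<alpha> (t + \<alpha>)) ` ({0..c} \<times> {x..y}))"
    unfolding case_prod_unfold by (intro compact_continuous_image compact_Times Bc continuous_intros) auto
  then have "bounded ((\<lambda>(\<alpha>, t). B \<alpha> (t + \<alpha>)) ` ({0..c} \<times> {x..y}))" by (rule compact_imp_bounded)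
  then obtain M where M: "0 < M" "\<And>\<alpha> t. \<alpha> \<in> {0..c} \<Longrightarrow> t \<in> {x..y} \<Longrightarrow> \<bar>B \<alpha> (t + \<alpha>)\<bar> \<le> M"
    by (force simp: bounded_pos)
  obtain C0 L \<kappa>1 where L: "0 \<le> L" "1 \<le> \<kappa>1" and weyl: "\<And>\<kappa>. \<kappa>1 \<le> \<kappa> \<Longrightarrow>
      \<exists>u u'. positive_weyl_solution q b h \<kappa> (- \<kappa> + C0) {0..y} u u' \<and> - L * \<kappa>\<^sup>2 * u y \<le> u' y"
    by (rule weyl_solution_real_decay[OF pot q y xy(3)], rule that)
  \<comment> \<open>Absorbs the two factors of exponential growth that do not depend on \<kappa>:
    rate C0 from the decay estimate for u, rate M c from the bound for S.\<close>
  define P where "P = exp ((\<bar>C0\<bar> + M * c) * c)"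
  have P: "0 < P" by (simp add: P_def)
  define C where "C = P * (L + 1 + \<bar>C0\<bar>) + M\<^sup>2 * c\<^sup>2 * P * c"
  have "cmod (m_function q b h (- (complex_of_real \<kappa>)\<^sup>2) x -
      complex_of_real (- \<kappa> - integral {0..y - x} (\<lambda>\<alpha>. B \<alpha> (x + \<alpha>) * exp (- 2 * \<alpha> * \<kappa>))))
    \<le> C * \<kappa>\<^sup>2 * exp (- 2 * (y - x) * \<kappa>)" if \<kappa>1: "\<kappa>1 \<le> \<kappa>" for \<kappa>
  proof -
    have \<kappa>: "1 \<le> \<kappa>" using \<kappa>1 L by simp
    obtain u u' where u: "\<And>t. t \<in> {0..y} \<Longrightarrow> 0 < u t"
      "\<And>t. t \<in> {0..y} \<Longrightarrow> (u has_real_derivative u' t) (at t within {0..y})"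
      "\<And>t. t \<in> {0..y} \<Longrightarrow> (u' has_real_derivative (q t + \<kappa>\<^sup>2) * u t) (at t within {0..y})"
      "\<And>t. t \<in> {0..y} \<Longrightarrow> u' t \<le> (- \<kappa> + C0) * u t"
      "\<And>t. t \<in> {0..y} \<Longrightarrow> m_function q b h (- (complex_of_real \<kappa>)\<^sup>2) t = complex_of_real (u' t / u t)"
      "- L * \<kappa>\<^sup>2 * u y \<le> u' y"
      using weyl[OF \<kappa>1] unfolding positive_weyl_solution_def by blast
    have sub: "{x..y} \<subseteq> {0..y}" using xy by auto
    note u_pos = u(1)[OF subsetD[OF sub]]
      and ud = DERIV_subset[OF u(2)[OF subsetD[OF sub]] sub]
      and ud' = DERIV_subset[OF u(3)[OF subsetD[OF sub]] sub]
    define \<phi> where "\<phi> t s = B (s - t) s * exp (- 2 * \<kappa> * (s - t))" for t s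
    define \<phi>' where "\<phi>' t s = (2 * \<kappa> * B (s - t) s - B' (s - t) s) * exp (- 2 * \<kappa> * (s - t))" for t s
    \<comment> \<open>S is the truncated Laplace integral of A(., t), and R that of B', which is
      minus the Laplace integral of the convolution. Their relation S' = 2 \<kappa> S - R - q comes
      from the lower limit and from the two factors that depend on t.\<close>
    define S where "S t = integral {t..y} (\<phi> t)" for t
    define R where "R t = integral {t..y} (\<lambda>s. B' (s - t) s * exp (- 2 * \<kappa> * (s - t)))" for t
    have S_deriv: "(S has_real_derivative 2 * \<kappa> * S t - R t - q t) (at t within {x..y})" if t: "t \<in> {x..y}" for t
    proof -
      have "(S has_real_derivative integral {t..y} (\<phi>' t) - \<phi> t t) (at t within {x..y})"
        unfolding S_def
      proof (rule leibniz_lower_limit[OF _ _ _ t])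
        fix v s :: real
        have "((\<lambda>v. B (s - v) s) has_real_derivative B' (s - v) s * (- 1)) (at v)"
          by (rule DERIV_chain2[OF B_deriv]) (auto intro!: derivative_eq_intros)
        then show "((\<lambda>v. \<phi> v s) has_real_derivative \<phi>' v s) (at v)"
          unfolding \<phi>_def \<phi>'_def by (auto intro!: derivative_eq_intros simp: algebra_simps)
      next
        show "continuous_on UNIV (\<lambda>(v, s). \<phi> v s)" "continuous_on UNIV (\<lambda>(v, s). \<phi>' v s)"
          unfolding \<phi>_def \<phi>'_def case_prod_unfold by (intro continuous_intros Bc B'c)+
      qed
      moreover have "integral {t..y} (\<phi>' t) = 2 * \<kappa> * S t - R t"
      proof -
        have "integral {t..y} (\<phi>' t) =
            integral {t..y} (\<lambda>s. 2 * \<kappa> * \<phi> t s) - integral {t..y} (\<lambda>s. B' (s - t) s * exp (- 2 * \<kappa> * (s - t)))"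
          unfolding \<phi>_def \<phi>'_def
          by (subst Henstock_Kurzweil_Integration.integral_diff[symmetric])
            (auto intro!: integrable_continuous_real continuous_intros Bc B'c simp: algebra_simps)
        then show ?thesis by (simp add: S_def R_def)
      qed
      moreover have "\<phi> t t = q t" using B_0[OF t] by (simp add: \<phi>_def)
      ultimately show ?thesis by simp
    qed
    have shift: "integral {t..y} f = integral {0..y - t} (\<lambda>\<alpha>. f (t + \<alpha>))" for t and f :: "real \<Rightarrow> real"
      using integral_shift_real_ivl[of t t y f] by (simp add: add.commute)
    have S_eq: "S t = integral {0..y - t} (\<lambda>\<alpha>. B \<alpha> (t + \<alpha>) * exp (- 2 * \<kappa> * \<alpha>))" for t
      unfolding S_def shift by (simp add: \<phi>_def)
    have R_eq: "R t = - integral {0..y - t} (\<lambda>\<alpha>. integral {0..\<alpha>} (\<lambda>\<beta>. B \<beta> (t + \<beta>) * B (\<alpha> - \<beta>) (t + (\<alpha> - \<beta>))) *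
        exp (- 2 * \<kappa> * \<alpha>))" if t: "t \<in> {x..y}" for t
    proof -
      have "R t = integral {0..y - t} (\<lambda>\<alpha>. B' \<alpha> (t + \<alpha>) * exp (- 2 * \<kappa> * \<alpha>))"
        unfolding R_def shift by simp
      also have "\<dots> = integral {0..y - t} (\<lambda>\<alpha>. - (integral {0..\<alpha>} (\<lambda>\<beta>. B \<beta> (t + \<beta>) * B (\<alpha> - \<beta>) (t + (\<alpha> - \<beta>))) *
        exp (- 2 * \<kappa> * \<alpha>)))"
      proof (rule Henstock_Kurzweil_Integration.integral_cong)
        fix \<alpha> assume "\<alpha> \<in> {0..y - t}"
        then have "B' \<alpha> (t + \<alpha>) = - integral {0..\<alpha>} (\<lambda>\<beta>. B \<beta> (t + \<alpha> - \<alpha> + \<beta>) * B (\<alpha> - \<beta>) (t + \<alpha> - \<beta>))"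
          using t by (intro B'_eq) auto
        then show "B' \<alpha> (t + \<alpha>) * exp (- 2 * \<kappa> * \<alpha>) =
            - (integral {0..\<alpha>} (\<lambda>\<beta>. B \<beta> (t + \<beta>) * B (\<alpha> - \<beta>) (t + (\<alpha> - \<beta>))) * exp (- 2 * \<kappa> * \<alpha>))"
          by (simp add: algebra_simps)
      qed
      finally show ?thesis by simp
    qed
    have residual: "\<bar>(S t)\<^sup>2 + R t\<bar> \<le> M\<^sup>2 * c\<^sup>2 * exp (- 2 * \<kappa> * (y - t))" if t: "t \<in> {x..y}" for t
    proof -
      have "\<bar>(S t)\<^sup>2 + R t\<bar> \<le> M\<^sup>2 * (y - t)\<^sup>2 * exp (- 2 * \<kappa> * (y - t))"
        unfolding S_eq R_eq[OF t] add_uminus_conv_diff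
      proof (rule truncated_laplace_convolution)
        show "continuous_on UNIV (\<lambda>\<alpha>. B \<alpha> (t + \<alpha>))" by (intro continuous_intros Bc)
        show "\<bar>B s (t + s)\<bar> \<le> M" if "s \<in> {0..y - t}" for s
          using M(2)[of s t] that t by (auto simp: c_def)
      qed (use t \<kappa> in auto)
      also have "\<dots> \<le> M\<^sup>2 * c\<^sup>2 * exp (- 2 * \<kappa> * (y - t))"
        using t by (intro mult_right_mono mult_left_mono power_mono) (auto simp: c_def)
      finally show ?thesis .
    qed
    have S_bound: "\<bar>S t\<bar> \<le> M * c" if t: "t \<in> {x..y}" for t
    proof -
      have "norm (S t) \<le> M * (y - t - 0)"
        unfolding S_eq
      proof (rule integral_bound)
        fix s assume s: "s \<in> {0..y - t}"
        have "\<bar>B s (t + s)\<bar> * exp (- 2 * \<kappa> * s) \<le> M * 1"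
          using M(2)[of s t] M(1) s t \<kappa> by (intro mult_mono) (auto simp: c_def)
        then show "norm (B s (t + s) * exp (- 2 * \<kappa> * s)) \<le> M" by (simp add: abs_mult)
      qed (use t in \<open>auto intro!: continuous_intros Bc\<close>)
      also have "\<dots> \<le> M * c" using t M(1) by (intro mult_left_mono) (auto simp: c_def)
      finally show ?thesis by simp
    qed
    \<comment> \<open>The candidate for u'/u. Inserting S' gives N' = q + \<kappa>^2 - N^2 + (S^2 +
      R), so \<open>residual\<close> bounds the defect in the Riccati equation.\<close>
    define N where "N t = - \<kappa> - S t" for t
    have S_cont: "continuous_on {x..y} S" by (rule DERIV_continuous_on[OF S_deriv])
    have N_cont: "continuous_on {x..y} N" unfolding N_def by (intro continuous_intros S_cont)
    have N_le: "N t \<le> - \<kappa> + M * c" if "t \<in> {x..y}" for t using S_bound[OF that] by (auto simp: N_def)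
    define E where "E t = integral {x..t} N" for t
    have E: "(E has_real_derivative N t) (at t within {x..y})" if "t \<in> {x..y}" for t
      unfolding E_def by (rule integral_has_real_derivative[OF N_cont that])
    have E_le: "E t \<le> (- \<kappa> + M * c) * (t - x)" if t: "t \<in> {x..y}" for t
    proof -
      have "integral {x..t} N \<le> integral {x..t} (\<lambda>_. - \<kappa> + M * c)"
        using t N_le by (intro integral_le integrable_continuous_real continuous_on_subset[OF N_cont]) auto
      then show ?thesis using t by (simp add: E_def mult.commute)
    qed
    have u_le: "u t \<le> u x * exp ((- \<kappa> + C0) * (t - x))" if t: "t \<in> {x..y}" for t
    proof -
      let ?f = "\<lambda>s. - (u s * exp (- (- \<kappa> + C0) * (s - x)))"
      have deriv: "(?f has_real_derivative ((- \<kappa> + C0) * u s - u' s) * exp (- (- \<kappa> + C0) * (s - x)))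
          (at s within {x..y})" if "s \<in> {x..y}" for s
        using ud[OF that] by (auto intro!: derivative_eq_intros simp: algebra_simps)
      have "?f x \<le> ?f t"
      proof (rule nondecreasing_within[where f = ?f, OF is_interval_cc deriv])
        fix s assume s: "s \<in> {x..y}"
        show "0 \<le> ((- \<kappa> + C0) * u s - u' s) * exp (- (- \<kappa> + C0) * (s - x))"
          using u(4)[OF subsetD[OF sub s]] by (intro mult_nonneg_nonneg) auto
      qed (use t xy in auto)
      then have "u t * exp (- (- \<kappa> + C0) * (t - x)) \<le> u x" by simp
      then have "u t * exp (- (- \<kappa> + C0) * (t - x)) * exp ((- \<kappa> + C0) * (t - x)) \<le> u x * exp ((- \<kappa> + C0) * (t - x))"
        by (rule mult_right_mono) simp
      moreover have "exp (- (- \<kappa> + C0) * (t - x)) * exp ((- \<kappa> + C0) * (t - x)) = 1"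
        unfolding mult_exp_exp by (simp add: algebra_simps)
      ultimately show ?thesis by (simp only: mult.assoc mult_1_right)
    qed
    \<comment> \<open>u and exp E each contribute a factor exp (- \<kappa> (t - x)). Their product
      complements the factor exp (- 2 \<kappa> (y - t)) of the residual, so the error is of size exp
      (- 2 \<kappa> (y - x)) for every t alike.\<close>
    have uE_le: "u t * exp (E t) \<le> P * u x * exp (- 2 * \<kappa> * (t - x))" if t: "t \<in> {x..y}" for t
    proof -
      have "u t * exp (E t) \<le> (u x * exp ((- \<kappa> + C0) * (t - x))) * exp ((- \<kappa> + M * c) * (t - x))"
        using u_le[OF t] E_le[OF t] u_pos[OF t] u_pos[of x] xy by (intro mult_mono) auto
      also have "\<dots> = u x * (exp ((C0 + M * c) * (t - x)) * exp (- 2 * \<kappa> * (t - x)))"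
        by (simp add: algebra_simps flip: exp_add)
      also have "exp ((C0 + M * c) * (t - x)) \<le> P"
        unfolding P_def using t M(1) c by (auto simp: c_def intro!: mult_mono)
      finally show ?thesis using u_pos[of x] xy by (simp add: mult_right_mono mult_left_mono mult_ac)
    qed
    \<comment> \<open>exp E is an integrating factor: in the derivative all terms but the Riccati
      defect, times u exp E, cancel. As E x = 0, the value w x is the wanted difference u'/u - N at
      x, times u x.\<close>
    define w where "w t = (u' t - N t * u t) * exp (E t)" for t
    have w: "(w has_real_derivative - ((S t)\<^sup>2 + R t) * u t * exp (E t)) (at t within {x..y})" if t: "t \<in> {x..y}" for t
      unfolding w_def N_def
      using S_deriv[OF t] ud[OF t] ud'[OF t] E[OF t]
      by (auto intro!: derivative_eq_intros simp: N_def algebra_simps power2_eq_square)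
    have "\<bar>w x - w y\<bar> \<le> M\<^sup>2 * c\<^sup>2 * P * u x * exp (- 2 * \<kappa> * c) * \<bar>x - y\<bar>"
      unfolding real_norm_def[symmetric]
    proof (rule field_differentiable_bound[where S = "{x..y}"])
      fix t assume t: "t \<in> {x..y}"
      show "(w has_real_derivative - ((S t)\<^sup>2 + R t) * u t * exp (E t)) (at t within {x..y})" by (rule w[OF t])
      have "\<bar>(S t)\<^sup>2 + R t\<bar> * (u t * exp (E t)) \<le>
          (M\<^sup>2 * c\<^sup>2 * exp (- 2 * \<kappa> * (y - t))) * (P * u x * exp (- 2 * \<kappa> * (t - x)))"
        using u_pos[OF t] by (intro mult_mono[OF residual[OF t] uE_le[OF t]]) auto
      also have "\<dots> = M\<^sup>2 * c\<^sup>2 * P * u x * (exp (- 2 * \<kappa> * (y - t)) * exp (- 2 * \<kappa> * (t - x)))" by simp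
      also have "exp (- 2 * \<kappa> * (y - t)) * exp (- 2 * \<kappa> * (t - x)) = exp (- 2 * \<kappa> * c)"
        by (simp add: c_def algebra_simps flip: exp_add)
      finally show "norm (- ((S t)\<^sup>2 + R t) * u t * exp (E t)) \<le> M\<^sup>2 * c\<^sup>2 * P * u x * exp (- 2 * \<kappa> * c)"
        by (simp only: abs_mult abs_minus_cancel real_norm_def abs_exp_cancel abs_of_pos[OF u_pos[OF t]] mult.assoc)
    qed (use xy in auto)
    \<comment> \<open>At the far end N y = - \<kappa>, and the two bounds for u' y apply. The lower
      one is of order \<kappa>^2, the origin of this factor in the final estimate.\<close>
    moreover have "\<bar>w y\<bar> \<le> P * (L + 1 + \<bar>C0\<bar>) * \<kappa>\<^sup>2 * u x * exp (- 2 * \<kappa> * c)"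
    proof -
      have yy: "y \<in> {x..y}" "y \<in> {0..y}" using xy by auto
      have \<kappa>2: "1 \<le> \<kappa>\<^sup>2" "\<kappa> \<le> \<kappa>\<^sup>2"
        using \<kappa> self_le_power[of \<kappa> 2] by auto
      have "N y = - \<kappa>" by (simp add: N_def S_def)
      moreover have "u' y + \<kappa> * u y \<le> \<bar>C0\<bar> * u y"
        using u(4)[OF yy(2)] mult_right_mono[OF abs_ge_self[of C0] less_imp_le[OF u_pos[OF yy(1)]]]
        unfolding distrib_right mult_minus_left by linarith
      moreover have "\<bar>C0\<bar> * u y \<le> (L + 1 + \<bar>C0\<bar>) * \<kappa>\<^sup>2 * u y"
      proof -
        have "\<bar>C0\<bar> * 1 \<le> (L + 1 + \<bar>C0\<bar>) * \<kappa>\<^sup>2" using L \<kappa>2 by (intro mult_mono) auto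
        then show ?thesis using u_pos[OF yy(1)] by (intro mult_right_mono) auto
      qed
      moreover have "- ((L + 1 + \<bar>C0\<bar>) * \<kappa>\<^sup>2 * u y) \<le> u' y + \<kappa> * u y"
      proof -
        have "0 \<le> \<kappa> * u y" "0 \<le> (1 + \<bar>C0\<bar>) * \<kappa>\<^sup>2 * u y" using \<kappa> u_pos[OF yy(1)] by auto
        then show ?thesis using u(6) by (simp add: algebra_simps)
      qed
      ultimately have "\<bar>u' y - N y * u y\<bar> \<le> (L + 1 + \<bar>C0\<bar>) * \<kappa>\<^sup>2 * u y" by (simp add: abs_le_iff)
      then have "\<bar>u' y - N y * u y\<bar> * exp (E y) \<le> (L + 1 + \<bar>C0\<bar>) * \<kappa>\<^sup>2 * u y * exp (E y)"
        by (rule mult_right_mono) simp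
      also have "\<dots> \<le> (L + 1 + \<bar>C0\<bar>) * \<kappa>\<^sup>2 * (P * u x * exp (- 2 * \<kappa> * (y - x)))"
        unfolding mult.assoc using uE_le[OF yy(1)] L by (intro mult_left_mono) (auto simp: mult.assoc)
      finally show ?thesis by (simp add: w_def abs_mult c_def mult_ac)
    qed
    ultimately have "\<bar>w x\<bar> \<le> P * (L + 1 + \<bar>C0\<bar>) * \<kappa>\<^sup>2 * u x * exp (- 2 * \<kappa> * c) +
        M\<^sup>2 * c\<^sup>2 * P * u x * exp (- 2 * \<kappa> * c) * c"
      using xy by (simp add: c_def)
    also have "M\<^sup>2 * c\<^sup>2 * P * u x * exp (- 2 * \<kappa> * c) * c \<le> M\<^sup>2 * c\<^sup>2 * P * u x * exp (- 2 * \<kappa> * c) * c * \<kappa>\<^sup>2"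
    proof -
      have "0 \<le> M\<^sup>2 * c\<^sup>2 * P * u x * exp (- 2 * \<kappa> * c) * c" using P u_pos[of x] c xy by simp
      from mult_left_mono[OF _ this, of 1 "\<kappa>\<^sup>2"] show ?thesis using \<kappa> by simp
    qed
    finally have "\<bar>w x\<bar> \<le> C * \<kappa>\<^sup>2 * exp (- 2 * \<kappa> * c) * u x" by (simp add: C_def algebra_simps)
    moreover have "w x = (u' x / u x - N x) * u x"
      using u_pos[of x] xy by (simp add: w_def E_def field_simps)
    ultimately have "\<bar>u' x / u x - N x\<bar> \<le> C * \<kappa>\<^sup>2 * exp (- 2 * \<kappa> * c)"
      using u_pos[of x] xy by (simp add: abs_mult)
    moreover have "m_function q b h (- (complex_of_real \<kappa>)\<^sup>2) x -
      complex_of_real (- \<kappa> - integral {0..y - x} (\<lambda>\<alpha>. B \<alpha> (x + \<alpha>) * exp (- 2 * \<alpha> * \<kappa>))) =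
      complex_of_real (u' x / u x - N x)"
      using u(5)[of x] xy by (simp add: N_def S_eq mult_ac)
    ultimately show ?thesis by (simp only: norm_of_real c_def mult_ac)
  qed
  then show ?thesis by blast
qed

section \<open>Uniqueness of A\<close>

text \<open>
  The series of \<^term>\<open>1 - exp (- exp (2 * n * (\<tau> - \<alpha>)))\<close> in powers of the inner exponential turns
  values of the Laplace integral at multiples of n into a mollified integral over [0,\<tau>].
\<close>

lemma truncated_laplace_unique:
  fixes d :: "real \<Rightarrow> real"
  assumes d: "d absolutely_integrable_on {0..a}" and \<tau>: "0 < \<tau>" "\<tau> < a"
    and small: "\<And>\<epsilon>. 0 < \<epsilon> \<Longrightarrow>
      ((\<lambda>\<kappa>. \<bar>integral {0..a} (\<lambda>\<alpha>. d \<alpha> * exp (- 2 * \<alpha> * \<kappa>))\<bar> / exp (- 2 * a * \<kappa>) powr (1 - \<epsilon>)) \<longlongrightarrow> 0) at_top"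
  shows "integral {0..\<tau>} d = 0"
proof -
  define D where "D \<kappa> = integral {0..a} (\<lambda>\<alpha>. d \<alpha> * exp (- 2 * \<alpha> * \<kappa>))" for \<kappa>
  \<comment> \<open>The hypothesis gives away an arbitrarily small part of the rate a. The midpoint
    \<rho> of \<tau> and a is still beyond \<tau>, and \<epsilon> is solved from a (1 - \<epsilon>)
    = \<rho>.\<close>
  define \<rho> where "\<rho> = (a + \<tau>) / 2"
  have \<rho>: "\<tau> < \<rho>" using \<tau> by (simp add: \<rho>_def)
  define \<epsilon> where "\<epsilon> = (a - \<tau>) / (2 * a)"
  have \<epsilon>: "0 < \<epsilon>" "a * (1 - \<epsilon>) = \<rho>" using \<tau> by (simp_all add: \<epsilon>_def \<rho>_def field_simps)
  have "eventually (\<lambda>\<kappa>. \<bar>D \<kappa>\<bar> / exp (- 2 * a * \<kappa>) powr (1 - \<epsilon>) < 1) at_top"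
    using order_tendstoD(2)[OF small[OF \<epsilon>(1)], of 1] by (simp add: D_def)
  then obtain \<kappa>1 where \<kappa>1: "\<And>\<kappa>. \<kappa>1 \<le> \<kappa> \<Longrightarrow> \<bar>D \<kappa>\<bar> / exp (- 2 * a * \<kappa>) powr (1 - \<epsilon>) < 1"
    by (auto simp: eventually_at_top_linorder)
  have D_bound: "\<bar>D \<kappa>\<bar> \<le> exp (- 2 * \<rho> * \<kappa>)" if "\<kappa>1 \<le> \<kappa>" for \<kappa>
  proof -
    have "exp (- 2 * a * \<kappa>) powr (1 - \<epsilon>) = exp (- 2 * (a * (1 - \<epsilon>)) * \<kappa>)"
      by (simp add: powr_def algebra_simps)
    then show ?thesis using \<kappa>1[OF that] unfolding \<epsilon>(2) by simp
  qed
  have d_int: "(\<lambda>\<alpha>. d \<alpha> * g \<alpha>) integrable_on {0..a}" if "continuous_on {0..a} g" for g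
    using absolutely_integrable_mult_continuous[OF d that] by (simp add: absolutely_integrable_on_def)
  have abs_d: "(\<lambda>\<alpha>. \<bar>d \<alpha>\<bar>) integrable_on {0..a}" using d by (simp add: absolutely_integrable_on_def)
  define X where "X n \<alpha> = exp (2 * real n * (\<tau> - \<alpha>))" for n and \<alpha> :: real
  define S where "S n = integral {0..a} (\<lambda>\<alpha>. d \<alpha> * (1 - exp (- X n \<alpha>)))" for n
  \<comment> \<open>The pointwise limit of the mollified integrand. At \<alpha> = \<tau> the inner
    exponential is 1 for every n, whence the odd value at this single point.\<close>
  define L where "L \<alpha> = d \<alpha> * (if \<alpha> < \<tau> then 1 else if \<alpha> = \<tau> then 1 - exp (- 1) else 0)" for \<alpha>
  have "S \<longlonglongrightarrow> integral {0..a} L"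
    unfolding S_def
  proof (rule dominated_convergence(2)[OF _ abs_d])
    fix n show "(\<lambda>\<alpha>. d \<alpha> * (1 - exp (- X n \<alpha>))) integrable_on {0..a}"
      unfolding X_def by (intro d_int continuous_intros)
  next
    fix n \<alpha> assume "\<alpha> \<in> {0..a}"
    have "\<bar>1 - exp (- X n \<alpha>)\<bar> \<le> 1" by (simp add: X_def)
    then have "\<bar>d \<alpha>\<bar> * \<bar>1 - exp (- X n \<alpha>)\<bar> \<le> \<bar>d \<alpha>\<bar> * 1" by (rule mult_left_mono) simp
    then show "norm (d \<alpha> * (1 - exp (- X n \<alpha>))) \<le> \<bar>d \<alpha>\<bar>" by (simp add: abs_mult)
  next
    fix \<alpha> assume "\<alpha> \<in> {0..a}"
    consider "\<alpha> < \<tau>" | "\<alpha> = \<tau>" | "\<tau> < \<alpha>" by linarith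
    then show "(\<lambda>n. d \<alpha> * (1 - exp (- X n \<alpha>))) \<longlonglongrightarrow> L \<alpha>"
    proof cases
      case 1
      have "filterlim (\<lambda>n. real n * (2 * (\<tau> - \<alpha>))) at_top sequentially"
        using 1 by (intro filterlim_at_top_mult_tendsto_pos[OF tendsto_const _ filterlim_real_sequentially]) simp
      then have "filterlim (\<lambda>n. X n \<alpha>) at_top sequentially"
        unfolding X_def by (intro filterlim_compose[OF exp_at_top]) (simp add: mult_ac)
      then have "(\<lambda>n. exp (- X n \<alpha>)) \<longlonglongrightarrow> 0"
        by (intro filterlim_compose[OF exp_at_bot]) (simp add: filterlim_uminus_at_bot)
      from tendsto_mult[OF tendsto_const[of "d \<alpha>"] tendsto_diff[OF tendsto_const[of 1] this]]
      show ?thesis using 1 by (simp add: L_def)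
    next
      case 3
      have "filterlim (\<lambda>n. real n * (2 * (\<alpha> - \<tau>))) at_top sequentially"
        using 3 by (intro filterlim_at_top_mult_tendsto_pos[OF tendsto_const _ filterlim_real_sequentially]) simp
      then have "filterlim (\<lambda>n. - (real n * (2 * (\<alpha> - \<tau>)))) at_bot sequentially"
        by (simp add: filterlim_uminus_at_bot)
      then have "(\<lambda>n. exp (- (real n * (2 * (\<alpha> - \<tau>))))) \<longlonglongrightarrow> 0"
        by (rule filterlim_compose[OF exp_at_bot])
      then have "(\<lambda>n. X n \<alpha>) \<longlonglongrightarrow> 0" by (simp add: X_def algebra_simps)
      then have "(\<lambda>n. d \<alpha> * (1 - exp (- X n \<alpha>))) \<longlonglongrightarrow> d \<alpha> * (1 - exp (- 0))"
        by (intro tendsto_intros)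
      then show ?thesis using 3 by (simp add: L_def)
    qed (simp add: X_def L_def)
  qed
  also have "integral {0..a} L = integral {0..\<tau>} d"
  proof -
    have "integral {0..a} L = integral {0..a} (\<lambda>\<alpha>. if \<alpha> \<in> {0..\<tau>} then d \<alpha> else 0)"
      by (rule integral_spike[of "{\<tau>}"]) (auto simp: L_def)
    also have "\<dots> = integral {0..\<tau>} d"
      using \<tau> by (simp only: integral_restrict_Int) (simp add: Int_absorb1)
    finally show ?thesis .
  qed
  finally have S_lim: "S \<longlonglongrightarrow> integral {0..\<tau>} d" .
  define y where "y n = exp (- (2 * (\<rho> - \<tau>)) * real n)" for n
  have S_bound: "\<bar>S n\<bar> \<le> exp (y n) - 1" if n: "\<kappa>1 \<le> real n" "1 \<le> n" for n
  proof -
    \<comment> \<open>Partial sums of 1 - exp (- X) in powers of X; the constant term cancels, hence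
      \<open>Suc j\<close>. The power X^(j+1) is exp (2 n \<tau> (j+1)) times exp (- 2 \<alpha> n
      (j+1)), so each term integrates to a multiple of \<open>D\<close> at n (j+1). The decay of
      \<open>D\<close> at rate \<rho> > \<tau> beats the growing coefficient and leaves y n ^ (j+1),
      uniformly in K.\<close>
    define s where "s K \<alpha> = - (\<Sum>j<K. (- X n \<alpha>) ^ Suc j /\<^sub>R fact (Suc j))" for K \<alpha>
    have exp_sums: "(\<lambda>j. z ^ Suc j /\<^sub>R fact (Suc j)) sums (exp z - 1)" for z :: real
      using exp_converges[of z] by (subst sums_Suc_iff) simp
    have partial_sum_le: "(\<Sum>j<K. z ^ Suc j /\<^sub>R fact (Suc j)) \<le> exp z - 1" if "0 \<le> z" for z :: real and K
      unfolding sums_unique[OF exp_sums]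
      by (rule sum_le_suminf[OF sums_summable[OF exp_sums]]) (use that in auto)
    have "(\<lambda>K. integral {0..a} (\<lambda>\<alpha>. d \<alpha> * s K \<alpha>)) \<longlonglongrightarrow> S n"
      unfolding S_def
    proof (rule dominated_convergence(2))
      fix K show "(\<lambda>\<alpha>. d \<alpha> * s K \<alpha>) integrable_on {0..a}"
        unfolding s_def X_def by (intro d_int continuous_intros)
    next
      show "(\<lambda>\<alpha>. \<bar>d \<alpha>\<bar> * exp (X n 0)) integrable_on {0..a}"
        using abs_d by (rule integrable_on_mult_left)
    next
      fix K \<alpha> assume \<alpha>: "\<alpha> \<in> {0..a}"
      have "\<bar>s K \<alpha>\<bar> \<le> (\<Sum>j<K. X n \<alpha> ^ Suc j /\<^sub>R fact (Suc j))"
        unfolding s_def abs_minus_cancel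
        by (rule order_trans[OF sum_abs]) (simp add: abs_mult power_abs X_def)
      also have "\<dots> \<le> exp (X n \<alpha>) - 1"
        by (rule partial_sum_le) (simp add: X_def y_def)
      also have "\<dots> \<le> exp (X n 0)"
      proof -
        have "X n \<alpha> \<le> X n 0" unfolding X_def exp_le_cancel_iff using \<alpha> by (intro mult_left_mono) auto
        then have "exp (X n \<alpha>) \<le> exp (X n 0)" by simp
        then show ?thesis by linarith
      qed
      finally show "norm (d \<alpha> * s K \<alpha>) \<le> \<bar>d \<alpha>\<bar> * exp (X n 0)"
        by (simp add: abs_mult mult_left_mono)
    next
      fix \<alpha>
      have "(\<lambda>K. s K \<alpha>) \<longlonglongrightarrow> - (exp (- X n \<alpha>) - 1)"
        unfolding s_def using exp_sums[of "- X n \<alpha>"] by (intro tendsto_minus) (simp add: sums_def)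
      then show "(\<lambda>K. d \<alpha> * s K \<alpha>) \<longlonglongrightarrow> d \<alpha> * (1 - exp (- X n \<alpha>))"
        by (intro tendsto_mult_left) simp
    qed
    moreover have "\<bar>integral {0..a} (\<lambda>\<alpha>. d \<alpha> * s K \<alpha>)\<bar> \<le> exp (y n) - 1" for K
    proof -
      define w where "w j = exp (2 * real n * \<tau> * real (Suc j))" for j
      have "d \<alpha> * s K \<alpha> = (\<Sum>j<K. (- ((- 1) ^ Suc j * w j / fact (Suc j))) * (d \<alpha> * exp (- 2 * \<alpha> * (real n * real (Suc j)))))" for \<alpha>
      proof -
        have "(X n \<alpha>) ^ Suc j = w j * exp (- 2 * \<alpha> * (real n * real (Suc j)))" for j
          unfolding X_def w_def mult_exp_exp exp_of_nat_mult[symmetric] by (simp add: algebra_simps)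
        then have "- ((- X n \<alpha>) ^ Suc j /\<^sub>R fact (Suc j)) =
            (- ((- 1) ^ Suc j * w j / fact (Suc j))) * exp (- 2 * \<alpha> * (real n * real (Suc j)))" for j
          unfolding power_minus[of "X n \<alpha>"] by (simp add: divide_inverse mult_ac del: power_Suc fact_Suc)
        then show ?thesis
          unfolding s_def sum_negf[symmetric] sum_distrib_left by (simp only: mult_ac)
      qed
      then have "integral {0..a} (\<lambda>\<alpha>. d \<alpha> * s K \<alpha>) =
          (\<Sum>j<K. (- ((- 1) ^ Suc j * w j / fact (Suc j))) * D (real n * real (Suc j)))"
        unfolding D_def
        by (simp only:, subst integral_sum) (auto intro!: integrable_on_mult_right d_int continuous_intros)
      also have "\<bar>\<dots>\<bar> \<le> (\<Sum>j<K. y n ^ Suc j /\<^sub>R fact (Suc j))"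
      proof (rule order_trans[OF sum_abs sum_mono])
        fix j
        have "real n * 1 \<le> real n * real (Suc j)" by (intro mult_left_mono) auto
        then have "\<bar>D (real n * real (Suc j))\<bar> \<le> exp (- 2 * \<rho> * (real n * real (Suc j)))"
          using n by (intro D_bound) linarith
        then have "w j / fact (Suc j) * \<bar>D (real n * real (Suc j))\<bar> \<le>
            w j / fact (Suc j) * exp (- 2 * \<rho> * (real n * real (Suc j)))"
          by (intro mult_left_mono) (auto simp: w_def)
        also have "\<dots> = (w j * exp (- 2 * \<rho> * (real n * real (Suc j)))) / fact (Suc j)" by simp
        also have "w j * exp (- 2 * \<rho> * (real n * real (Suc j))) = y n ^ Suc j"
          unfolding w_def y_def mult_exp_exp exp_of_nat_mult[symmetric] by (simp add: algebra_simps)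
        finally show "\<bar>- ((- 1) ^ Suc j * w j / fact (Suc j)) * D (real n * real (Suc j))\<bar> \<le> y n ^ Suc j /\<^sub>R fact (Suc j)"
          by (simp add: abs_mult w_def power_abs divide_inverse mult_ac del: power_Suc fact_Suc)
      qed
      also have "\<dots> \<le> exp (y n) - 1" by (rule partial_sum_le) (simp add: X_def y_def)
      finally show ?thesis .
    qed
    ultimately show ?thesis
      by (intro Lim_bounded[OF tendsto_rabs]) auto
  qed
  have "y \<longlonglongrightarrow> 0"
  proof -
    have "filterlim (\<lambda>n. real n * (2 * (\<rho> - \<tau>))) at_top sequentially"
      using \<rho> by (intro filterlim_at_top_mult_tendsto_pos[OF tendsto_const _ filterlim_real_sequentially]) simp
    then have "filterlim (\<lambda>n. - (real n * (2 * (\<rho> - \<tau>)))) at_bot sequentially"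
      by (simp add: filterlim_uminus_at_bot)
    then have "(\<lambda>n. exp (- (real n * (2 * (\<rho> - \<tau>))))) \<longlonglongrightarrow> 0"
      by (rule filterlim_compose[OF exp_at_bot])
    then show ?thesis by (simp add: y_def[abs_def] algebra_simps)
  qed
  then have "(\<lambda>n. exp (y n) - 1) \<longlonglongrightarrow> exp 0 - 1" by (intro tendsto_intros)
  moreover have "eventually (\<lambda>n. norm (S n) \<le> exp (y n) - 1) sequentially"
  proof (rule eventually_sequentiallyI[of "nat \<lceil>\<kappa>1\<rceil> + 1"])
    fix n assume "nat \<lceil>\<kappa>1\<rceil> + 1 \<le> n"
    then show "norm (S n) \<le> exp (y n) - 1" using S_bound[of n] by (simp add: nat_le_iff ceiling_le_iff) linarith
  qed
  ultimately have "S \<longlonglongrightarrow> 0" by (intro Lim_null_comparison[of S]) simp_all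
  with S_lim show ?thesis by (rule LIMSEQ_unique)
qed

section \<open>The transport equation for A\<close>

text \<open>The scale c may be negative. This is what makes an integral rescaled to [0,1]
  differentiable in its limit on both sides of 0.\<close>

lemma rescaled_integral:
  fixes f F :: "real \<Rightarrow> real"
  assumes F: "\<And>t. (F has_real_derivative f t) (at t)" "F 0 = 0"
  shows "integral {0..1} (\<lambda>r. c * f (r * c)) = F c"
proof -
  have "((\<lambda>r. F (r * c)) has_real_derivative f (r * c) * c) (at r within {0..1})" for r
    by (rule DERIV_chain2[OF F(1)]) (auto intro!: derivative_eq_intros)
  then have "((\<lambda>r. c * f (r * c)) has_integral (F (1 * c) - F (0 * c))) {0..1}"
    by (intro fundamental_theorem_of_calculus)
      (simp_all add: has_real_derivative_iff_has_vector_derivative[symmetric] mult.commute)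
  then have "integral {0..1} (\<lambda>r. c * f (r * c)) = F (1 * c) - F (0 * c)" by (rule integral_unique)
  then show ?thesis by (simp only: F(2) mult_1 mult_zero_left diff_zero)
qed

lemma rescaled_integral_eq:
  fixes f :: "real \<Rightarrow> real"
  assumes "continuous_on UNIV f" "0 \<le> c"
  shows "integral {0..1} (\<lambda>r. c * f (r * c)) = integral {0..c} f"
proof -
  obtain F where F: "\<And>t. (F has_real_derivative f t) (at t)" "F 0 = 0"
    "\<And>s t. s \<le> t \<Longrightarrow> F t - F s = integral {s..t} f"
    using antiderivative_real_line[OF assms(1)] by blast
  show ?thesis using rescaled_integral[OF F(1,2)] F(2) F(3)[OF assms(2)] by simp
qed

text \<open>
  \<open>oblique_conv\<close> is the convolution in \<open>\<alpha>\<close> at fixed \<open>x\<close>, written in the coordinates \<open>(\<alpha>, s)\<close>, and \<open>damped_integral\<close>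
  is the integral over \<open>[0, c]\<close> after multiplication by the weight \<open>exp (- \<mu> \<alpha>)\<close>. Both are rescaled to the
  unit interval, so that continuity and differentiation under the integral apply directly.
\<close>

definition oblique_conv ::
  "(real \<times> real \<Rightarrow> real) \<Rightarrow> (real \<times> real \<Rightarrow> real) \<Rightarrow> real \<Rightarrow> real \<Rightarrow> real" where
  "oblique_conv u v \<alpha> s =
     integral {0..1} (\<lambda>r. \<alpha> * (u (r * \<alpha>, s - \<alpha> + r * \<alpha>) * v (\<alpha> - r * \<alpha>, s - r * \<alpha>)))"

definition damped_integral :: "real \<Rightarrow> (real \<Rightarrow> real \<Rightarrow> real) \<Rightarrow> real \<Rightarrow> real \<Rightarrow> real" where
  "damped_integral \<mu> w c s = integral {0..1} (\<lambda>t. c * exp (- \<mu> * c * (1 - t)) * w (t * c) s)"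

section \<open>Continuity, bounds and s-derivatives of the two integral operators\<close>

lemma continuous_on_unit_integral:
  fixes f :: "'a::topological_space \<Rightarrow> real \<Rightarrow> real"
  assumes "continuous_on UNIV (\<lambda>(x, t). f x t)"
  shows "continuous_on UNIV (\<lambda>x. integral {0..1} (f x))"
  using integral_continuous_on_param[of UNIV 0 1 f] continuous_on_subset[OF assms] by simp

lemma continuous_on_uncurry:
  assumes "continuous_on UNIV (\<lambda>(x, y). w x y)" "continuous_on A f" "continuous_on A g"
  shows "continuous_on A (\<lambda>z. w (f z) (g z))"
  using continuous_on_compose2[OF assms(1) continuous_on_Pair[OF assms(2,3)]] by simp

lemma continuous_on_oblique_conv:
  assumes "continuous_on UNIV u" "continuous_on UNIV v"
  shows "continuous_on UNIV (\<lambda>(\<alpha>, s). oblique_conv u v \<alpha> s)"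
  unfolding oblique_conv_def case_prod_unfold
  by (rule continuous_on_unit_integral)
    (auto simp: case_prod_unfold intro!: continuous_intros
      continuous_on_compose2[OF assms(1)] continuous_on_compose2[OF assms(2)])

lemma continuous_on_damped_integral:
  assumes "continuous_on UNIV (\<lambda>(\<alpha>, s). w \<alpha> s)"
  shows "continuous_on UNIV (\<lambda>(c, s). damped_integral \<mu> w c s)"
  unfolding damped_integral_def case_prod_unfold
  by (rule continuous_on_unit_integral)
    (auto simp: case_prod_unfold intro!: continuous_intros continuous_on_uncurry[OF assms])

lemma oblique_conv_integrand_integrable:
  fixes u v :: "real \<times> real \<Rightarrow> real"
  assumes "continuous_on UNIV u" "continuous_on UNIV v"
  shows "(\<lambda>r. \<alpha> * (u (r * \<alpha>, s - \<alpha> + r * \<alpha>) * v (\<alpha> - r * \<alpha>, s - r * \<alpha>))) integrable_on {0..1}"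
  by (intro integrable_continuous_real continuous_intros
      continuous_on_compose2[OF assms(1)] continuous_on_compose2[OF assms(2)]) auto

lemma damped_integrand_integrable:
  fixes w :: "real \<Rightarrow> real \<Rightarrow> real"
  assumes "continuous_on UNIV (\<lambda>(\<alpha>, s). w \<alpha> s)"
  shows "(\<lambda>t. c * exp (- \<mu> * c * (1 - t)) * w (t * c) s) integrable_on {0..1}"
  by (intro integrable_continuous_real continuous_intros continuous_on_uncurry[OF assms])

lemma oblique_conv_bound:
  assumes u: "continuous_on UNIV u" "\<And>p. \<bar>u p\<bar> \<le> U" and v: "continuous_on UNIV v" "\<And>p. \<bar>v p\<bar> \<le> V"
    and \<alpha>: "0 \<le> \<alpha>" "\<alpha> \<le> a"
  shows "\<bar>oblique_conv u v \<alpha> s\<bar> \<le> a * (U * V)"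
proof -
  have nonneg: "0 \<le> U" "0 \<le> V" using order_trans[OF abs_ge_zero u(2)] order_trans[OF abs_ge_zero v(2)] by auto
  have "norm (oblique_conv u v \<alpha> s) \<le> a * (U * V) * (1 - 0)"
    unfolding oblique_conv_def
  proof (rule integral_bound)
    show "continuous_on {0..1} (\<lambda>r. \<alpha> * (u (r * \<alpha>, s - \<alpha> + r * \<alpha>) * v (\<alpha> - r * \<alpha>, s - r * \<alpha>)))"
      by (intro continuous_intros continuous_on_compose2[OF u(1)] continuous_on_compose2[OF v(1)]) auto
    show "norm (\<alpha> * (u (r * \<alpha>, s - \<alpha> + r * \<alpha>) * v (\<alpha> - r * \<alpha>, s - r * \<alpha>))) \<le> a * (U * V)" for r
      unfolding real_norm_def abs_mult using \<alpha> nonneg u(2) v(2) by (intro mult_mono) auto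
  qed auto
  then show ?thesis by simp
qed

lemma oblique_conv_diff:
  assumes "continuous_on UNIV u" "continuous_on UNIV v" "continuous_on UNIV u'" "continuous_on UNIV v'"
  shows "oblique_conv u v \<alpha> s - oblique_conv u' v' \<alpha> s =
    oblique_conv (\<lambda>p. u p - u' p) v \<alpha> s + oblique_conv u' (\<lambda>p. v p - v' p) \<alpha> s"
  unfolding oblique_conv_def
  by (subst Henstock_Kurzweil_Integration.integral_diff[symmetric], (intro oblique_conv_integrand_integrable assms)+,
      subst Henstock_Kurzweil_Integration.integral_add[symmetric],
      (intro oblique_conv_integrand_integrable assms continuous_on_diff)+)
    (simp add: algebra_simps)

lemma damped_integral_diff:
  assumes "continuous_on UNIV (\<lambda>(\<alpha>, s). w \<alpha> s)" "continuous_on UNIV (\<lambda>(\<alpha>, s). w' \<alpha> s)"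
  shows "damped_integral \<mu> w c s - damped_integral \<mu> w' c s = damped_integral \<mu> (\<lambda>\<alpha> s. w \<alpha> s - w' \<alpha> s) c s"
  unfolding damped_integral_def
  by (subst Henstock_Kurzweil_Integration.integral_diff[symmetric], (intro damped_integrand_integrable assms)+)
    (simp add: algebra_simps)

text \<open>Source of the contraction: in the unscaled variable the kernel is exp (- \<mu> (c -
  \<alpha>)), whose integral over [0,c] is at most 1/\<mu>, however long the interval is.\<close>

lemma damped_integral_bound:
  assumes w: "continuous_on UNIV (\<lambda>(\<alpha>, s). w \<alpha> s)" "\<And>\<alpha>. 0 \<le> \<alpha> \<Longrightarrow> \<alpha> \<le> a \<Longrightarrow> \<bar>w \<alpha> s\<bar> \<le> W"
    and c: "0 \<le> c" "c \<le> a" and \<mu>: "0 < \<mu>"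
  shows "\<bar>damped_integral \<mu> w c s\<bar> \<le> W / \<mu>"
proof -
  have W: "0 \<le> W" using w(2)[of 0] c by linarith
  have int: "((\<lambda>t. c * exp (- \<mu> * c * (1 - t)) * W) has_integral
      (W / \<mu> * exp (- \<mu> * c * (1 - 1)) - W / \<mu> * exp (- \<mu> * c * (1 - 0)))) {0..1}"
  proof (rule fundamental_theorem_of_calculus)
    fix t :: real
    show "((\<lambda>t. W / \<mu> * exp (- \<mu> * c * (1 - t))) has_vector_derivative c * exp (- \<mu> * c * (1 - t)) * W) (at t within {0..1})"
      unfolding has_real_derivative_iff_has_vector_derivative[symmetric]
      using \<mu> by (auto intro!: derivative_eq_intros)
  qed simp
  have "norm (damped_integral \<mu> w c s) \<le> integral {0..1} (\<lambda>t. c * exp (- \<mu> * c * (1 - t)) * W)"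
    unfolding damped_integral_def
  proof (rule integral_norm_bound_integral)
    show "(\<lambda>t. c * exp (- \<mu> * c * (1 - t)) * W) integrable_on {0..1}" using int by blast
    fix t :: real assume t: "t \<in> {0..1}"
    have "t * c \<le> 1 * c" using t c by (intro mult_right_mono) auto
    then have "\<bar>w (t * c) s\<bar> \<le> W" using t c by (intro w(2)) auto
    then show "norm (c * exp (- \<mu> * c * (1 - t)) * w (t * c) s) \<le> c * exp (- \<mu> * c * (1 - t)) * W"
      using c by (simp add: abs_mult mult_left_mono)
  qed (rule damped_integrand_integrable[OF w(1)])
  also have "\<dots> = W / \<mu> * exp (- \<mu> * c * (1 - 1)) - W / \<mu> * exp (- \<mu> * c * (1 - 0))"
    by (rule integral_unique[OF int])
  also have "\<dots> \<le> W / \<mu>" using W \<mu> by simp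
  finally show ?thesis by simp
qed

lemma oblique_conv_deriv:
  assumes u: "continuous_on UNIV u" "continuous_on UNIV u'"
      "\<And>\<alpha> s. ((\<lambda>s. u (\<alpha>, s)) has_real_derivative u' (\<alpha>, s)) (at s)"
    and v: "continuous_on UNIV v" "continuous_on UNIV v'"
      "\<And>\<alpha> s. ((\<lambda>s. v (\<alpha>, s)) has_real_derivative v' (\<alpha>, s)) (at s)"
  shows "((\<lambda>s. oblique_conv u v \<alpha> s) has_real_derivative oblique_conv u' v \<alpha> s + oblique_conv u v' \<alpha> s) (at s)"
proof -
  let ?d = "\<lambda>s r. \<alpha> * (u' (r * \<alpha>, s - \<alpha> + r * \<alpha>) * v (\<alpha> - r * \<alpha>, s - r * \<alpha>)) +
      \<alpha> * (u (r * \<alpha>, s - \<alpha> + r * \<alpha>) * v' (\<alpha> - r * \<alpha>, s - r * \<alpha>))"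
  have "((\<lambda>s. integral (cbox 0 1) (\<lambda>r. \<alpha> * (u (r * \<alpha>, s - \<alpha> + r * \<alpha>) * v (\<alpha> - r * \<alpha>, s - r * \<alpha>))))
      has_real_derivative integral (cbox 0 1) (?d s)) (at s within UNIV)"
  proof (rule leibniz_rule_field_derivative)
    fix s r :: real
    have "((\<lambda>s. u (r * \<alpha>, s - \<alpha> + r * \<alpha>)) has_real_derivative u' (r * \<alpha>, s - \<alpha> + r * \<alpha>) * 1) (at s)"
      by (rule DERIV_chain2[OF u(3)]) (auto intro!: derivative_eq_intros)
    moreover have "((\<lambda>s. v (\<alpha> - r * \<alpha>, s - r * \<alpha>)) has_real_derivative v' (\<alpha> - r * \<alpha>, s - r * \<alpha>) * 1) (at s)"
      by (rule DERIV_chain2[OF v(3)]) (auto intro!: derivative_eq_intros)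
    ultimately show "((\<lambda>s. \<alpha> * (u (r * \<alpha>, s - \<alpha> + r * \<alpha>) * v (\<alpha> - r * \<alpha>, s - r * \<alpha>))) has_real_derivative ?d s r)
        (at s within UNIV)"
      by (auto intro!: derivative_eq_intros simp: algebra_simps)
  next
    show "continuous_on (UNIV \<times> cbox 0 1) (\<lambda>(s, r). ?d s r)"
      unfolding case_prod_unfold
      by (intro continuous_intros continuous_on_compose2[OF u(1)] continuous_on_compose2[OF v(1)]
          continuous_on_compose2[OF u(2)] continuous_on_compose2[OF v(2)]) auto
  qed (use oblique_conv_integrand_integrable[OF u(1) v(1)] in auto)
  moreover have "integral (cbox 0 1) (?d s) = oblique_conv u' v \<alpha> s + oblique_conv u v' \<alpha> s"
    unfolding oblique_conv_def cbox_interval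
    by (intro Henstock_Kurzweil_Integration.integral_add oblique_conv_integrand_integrable u v)
  ultimately show ?thesis by (simp add: oblique_conv_def)
qed

lemma damped_integral_deriv:
  assumes w: "continuous_on UNIV (\<lambda>(\<alpha>, s). w \<alpha> s)" and w': "continuous_on UNIV (\<lambda>(\<alpha>, s). w' \<alpha> s)"
    and deriv: "\<And>\<alpha> s. ((\<lambda>s. w \<alpha> s) has_real_derivative w' \<alpha> s) (at s)"
  shows "((\<lambda>s. damped_integral \<mu> w c s) has_real_derivative damped_integral \<mu> w' c s) (at s)"
proof -
  have "((\<lambda>s. integral (cbox 0 1) (\<lambda>t. c * exp (- \<mu> * c * (1 - t)) * w (t * c) s)) has_real_derivative
      integral (cbox 0 1) (\<lambda>t. c * exp (- \<mu> * c * (1 - t)) * w' (t * c) s)) (at s within UNIV)"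
  proof (rule leibniz_rule_field_derivative)
    show "((\<lambda>s. c * exp (- \<mu> * c * (1 - t)) * w (t * c) s) has_real_derivative
        c * exp (- \<mu> * c * (1 - t)) * w' (t * c) s) (at s within UNIV)" for s t
      by (intro DERIV_cmult deriv)
    show "continuous_on (UNIV \<times> cbox 0 1) (\<lambda>(s, t). c * exp (- \<mu> * c * (1 - t)) * w' (t * c) s)"
      unfolding case_prod_unfold by (intro continuous_intros continuous_on_uncurry[OF w'])
  qed (use damped_integrand_integrable[OF w] in auto)
  then show ?thesis by (simp add: damped_integral_def)
qed

text \<open>The unknown is the pair of exp (- \<mu> \<alpha>) B and its s-derivative. The integrated
  equation contains the unknown only through its convolution with itself, the equation for the
  s-derivative is obtained by the product rule, and \<open>damped_integral_bound\<close> makes both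
  operators small on a ball once \<mu> is large.\<close>

lemma transported_amplitude_exists:
  fixes q q' :: "real \<Rightarrow> real"
  assumes q: "\<And>s. (q has_real_derivative q' s) (at s)" and q'_cont: "continuous_on UNIV q'"
    and K: "\<And>s. \<bar>q s\<bar> \<le> K" "\<And>s. \<bar>q' s\<bar> \<le> K" and a: "0 < a"
  obtains B B' P :: "real \<Rightarrow> real \<Rightarrow> real" where
    "continuous_on UNIV (\<lambda>(\<alpha>, s). B \<alpha> s)" "continuous_on UNIV (\<lambda>(\<alpha>, s). B' \<alpha> s)"
    "continuous_on UNIV (\<lambda>(\<alpha>, s). P \<alpha> s)" "\<And>s. B 0 s = q s"
    "\<And>\<alpha> s. ((\<lambda>\<alpha>. B \<alpha> s) has_real_derivative B' \<alpha> s) (at \<alpha>)"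
    "\<And>\<alpha> s. \<alpha> \<in> {0..a} \<Longrightarrow> ((\<lambda>s. B \<alpha> s) has_real_derivative P \<alpha> s) (at s)"
    "\<And>\<alpha> s. \<alpha> \<in> {0..a} \<Longrightarrow> B' \<alpha> s = - integral {0..\<alpha>} (\<lambda>\<beta>. B \<beta> (s - \<alpha> + \<beta>) * B (\<alpha> - \<beta>) (s - \<beta>))"
proof -
  have K0: "0 \<le> K" using order_trans[OF abs_ge_zero K(1)] .
  have q_cont: "continuous_on UNIV q" using q by (rule DERIV_continuous_on)
  \<comment> \<open>On the ball of radius R the map is bounded by 2 K + 3 a R^2/\<mu> and has
    Lipschitz constant (2 + 4) a R/\<mu>. With \<mu> = 12 a R these are 2 K + R/4, which is at most
    R, and 1/2.\<close>
  define R where "R = 4 * K + 2"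
  define \<mu> where "\<mu> = 12 * a * R"
  have R: "0 < R" using K0 by (simp add: R_def)
  have \<mu>: "0 < \<mu>" using R a by (simp add: \<mu>_def)
  \<comment> \<open>Clamping \<alpha> to [0,a] lets the iteration run on bounded continuous
    functions of the whole plane. For \<alpha> in [0,a] the integrals involve only first arguments
    in [0,a], where the clamp is the identity.\<close>
  define cl where "cl \<alpha> = max 0 (min a \<alpha>)" for \<alpha>
  have cl: "0 \<le> cl \<alpha>" "cl \<alpha> \<le> a" for \<alpha> using a by (auto simp: cl_def)
  have cl_at: "continuous_on A (\<lambda>z. cl (f z))" if "continuous_on A f" for A :: "'z::topological_space set" and f
    unfolding cl_def by (intro continuous_intros that)
  define f1 f2 where "f1 f p = fst (apply_bcontfun f p)" and "f2 f p = snd (apply_bcontfun f p)"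
    for f :: "(real \<times> real) \<Rightarrow>\<^sub>C (real \<times> real)" and p
  have cont: "continuous_on A (f1 f)" "continuous_on A (f2 f)" for A f
    unfolding f1_def f2_def by (intro continuous_intros; simp)+
  have bound: "\<bar>f1 f p\<bar> \<le> norm f" "\<bar>f2 f p\<bar> \<le> norm f" for f p
    using norm_bounded[of f p] norm_fst_le[of "fst (f p)" "snd (f p)"] norm_snd_le[of "snd (f p)" "fst (f p)"]
    by (auto simp: f1_def f2_def)
  have diff_bound: "\<bar>f1 f p - f1 g p\<bar> \<le> dist f g" "\<bar>f2 f p - f2 g p\<bar> \<le> dist f g" for f g p
    using bound[of "f - g" p] by (auto simp: f1_def f2_def dist_norm)
  define w1 where "w1 f = oblique_conv (f1 f) (f1 f)" for f
  define w2 where "w2 f \<alpha> s = oblique_conv (f2 f) (f1 f) \<alpha> s + oblique_conv (f1 f) (f2 f) \<alpha> s" for f \<alpha> s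
  have w1_cont: "continuous_on UNIV (\<lambda>(\<alpha>, s). w1 f \<alpha> s)" for f
    unfolding w1_def by (rule continuous_on_oblique_conv[OF cont(1) cont(1)])
  have w2_cont: "continuous_on UNIV (\<lambda>(\<alpha>, s). w2 f \<alpha> s)" for f
    using continuous_on_add[OF continuous_on_oblique_conv[OF cont(2) cont(1), of f f]
        continuous_on_oblique_conv[OF cont(1) cont(2), of f f]]
    by (simp add: w2_def case_prod_unfold)
  define T1 where "T1 f p = exp (- \<mu> * cl (fst p)) * q (snd p) - damped_integral \<mu> (w1 f) (cl (fst p)) (snd p)" for f p
  define T2 where "T2 f p = exp (- \<mu> * cl (fst p)) * q' (snd p) - damped_integral \<mu> (w2 f) (cl (fst p)) (snd p)" for f p
  have T_cont: "continuous_on UNIV (\<lambda>p. (T1 f p, T2 f p))" for f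
    unfolding T1_def T2_def
    by (intro continuous_intros cl_at continuous_on_compose2[OF q_cont] continuous_on_compose2[OF q'_cont]
        continuous_on_uncurry[OF continuous_on_damped_integral[OF w1_cont]]
        continuous_on_uncurry[OF continuous_on_damped_integral[OF w2_cont]]) auto
  have w_bound: "\<bar>w1 f \<alpha> s\<bar> \<le> a * (norm f * norm f)" "\<bar>w2 f \<alpha> s\<bar> \<le> 2 * (a * (norm f * norm f))"
    if "0 \<le> \<alpha>" "\<alpha> \<le> a" for f \<alpha> s
    using oblique_conv_bound[OF cont(1) bound(1) cont(1) bound(1) that, of f f s]
      oblique_conv_bound[OF cont(2) bound(2) cont(1) bound(1) that, of f f s]
      oblique_conv_bound[OF cont(1) bound(1) cont(2) bound(2) that, of f f s]
    by (auto simp: w1_def w2_def)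
  have q_bound: "\<bar>exp (- \<mu> * cl \<alpha>) * z\<bar> \<le> K" if "\<bar>z\<bar> \<le> K" for \<alpha> z
  proof -
    have "exp (- \<mu> * cl \<alpha>) * \<bar>z\<bar> \<le> 1 * K"
      using that \<mu> cl(1)[of \<alpha>] by (intro mult_mono) auto
    then show ?thesis by (simp add: abs_mult)
  qed
  have T_bound: "norm (T1 f p, T2 f p) \<le> 2 * K + 3 * (a * (norm f * norm f) / \<mu>)" for f p
  proof -
    have "\<bar>T1 f p\<bar> \<le> K + a * (norm f * norm f) / \<mu>"
      using q_bound[OF K(1), of "fst p" "snd p"]
        damped_integral_bound[OF w1_cont w_bound(1) cl \<mu>, of f "fst p" "snd p"]
      unfolding T1_def by linarith
    moreover have "\<bar>T2 f p\<bar> \<le> K + 2 * (a * (norm f * norm f)) / \<mu>"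
      using q_bound[OF K(2), of "fst p" "snd p"]
        damped_integral_bound[OF w2_cont w_bound(2) cl \<mu>, of f "fst p" "snd p"]
      unfolding T2_def by linarith
    moreover have "2 * (a * (norm f * norm f)) / \<mu> = 2 * (a * (norm f * norm f) / \<mu>)" by simp
    ultimately show ?thesis
      using norm_Pair_le[of "T1 f p" "T2 f p"] unfolding real_norm_def by linarith
  qed
  define T where "T f = Bcontfun (\<lambda>p. (T1 f p, T2 f p))" for f
  have T_apply: "apply_bcontfun (T f) p = (T1 f p, T2 f p)" for f p
    unfolding T_def by (subst Bcontfun_inverse[OF bcontfun_normI[OF T_cont T_bound]]) simp
  \<comment> \<open>The contraction is run on pairs whose second component is the s-derivative of
    the first, so that the fixed point inherits this relation. The set is closed because uniform
    convergence of the functions and of the derivatives preserves it.\<close>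
  define S where "S = {f. norm f \<le> R \<and> (\<forall>\<alpha> s. ((\<lambda>s. f1 f (\<alpha>, s)) has_real_derivative f2 f (\<alpha>, s)) (at s))}"
  have "closed S"
    unfolding closed_sequential_limits
  proof (intro allI impI)
    fix F f assume F: "(\<forall>n. F n \<in> S) \<and> F \<longlonglongrightarrow> f"
    then have lim: "F \<longlonglongrightarrow> f" by simp
    have dist0: "(\<lambda>n. dist (F n) f) \<longlonglongrightarrow> 0" by (rule iffD1[OF tendsto_dist_iff lim])
    have "norm f \<le> R"
    proof (rule Lim_bounded[OF tendsto_norm[OF lim], of 0], intro allI impI)
      fix n have "F n \<in> S" using F by simp
      then show "norm (F n) \<le> R" by (simp add: S_def)
    qed
    moreover have "((\<lambda>s. f1 f (\<alpha>, s)) has_real_derivative f2 f (\<alpha>, s)) (at s)" for \<alpha> s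
    proof -
      have pointwise: "(\<lambda>n. f1 (F n) (\<alpha>, s)) \<longlonglongrightarrow> f1 f (\<alpha>, s)" for s
      proof (rule metric_tendsto_imp_tendsto[OF lim])
        show "eventually (\<lambda>n. dist (f1 (F n) (\<alpha>, s)) (f1 f (\<alpha>, s)) \<le> dist (F n) f) sequentially"
          unfolding dist_real_def by (intro always_eventually allI diff_bound)
      qed
      have "\<exists>g. \<forall>s\<in>UNIV. (\<lambda>n. f1 (F n) (\<alpha>, s)) \<longlonglongrightarrow> g s \<and>
          (g has_derivative (\<lambda>h. f2 f (\<alpha>, s) * h)) (at s within UNIV)"
      proof (rule has_derivative_sequence[where f = "\<lambda>n s. f1 (F n) (\<alpha>, s)" and f' = "\<lambda>n s h. f2 (F n) (\<alpha>, s) * h", OF convex_UNIV _ _ UNIV_I pointwise[of 0]])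
        show "((\<lambda>s. f1 (F n) (\<alpha>, s)) has_derivative (\<lambda>h. f2 (F n) (\<alpha>, s) * h)) (at s within UNIV)" for n s
        proof -
          have "F n \<in> S" using F by simp
          then show ?thesis unfolding has_field_derivative_def[symmetric] by (simp add: S_def)
        qed
        fix e :: real assume "0 < e"
        then have "eventually (\<lambda>n. dist (F n) f < e) sequentially" using order_tendstoD(2)[OF dist0] by simp
        then show "eventually (\<lambda>n. \<forall>s\<in>UNIV. \<forall>h. norm (f2 (F n) (\<alpha>, s) * h - f2 f (\<alpha>, s) * h) \<le> e * norm h) sequentially"
        proof eventually_elim
          case (elim n)
          have "\<bar>f2 (F n) (\<alpha>, s) - f2 f (\<alpha>, s)\<bar> * \<bar>h\<bar> \<le> e * \<bar>h\<bar>" for s h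
            using diff_bound(2)[of "F n" "(\<alpha>, s)" f] elim by (intro mult_right_mono) auto
          then show ?case by (simp add: left_diff_distrib[symmetric] abs_mult)
        qed
      qed
      then obtain g where g: "\<And>s. (\<lambda>n. f1 (F n) (\<alpha>, s)) \<longlonglongrightarrow> g s"
        "\<And>s. (g has_real_derivative f2 f (\<alpha>, s)) (at s)"
        by (auto simp: has_field_derivative_def)
      have "g = (\<lambda>s. f1 f (\<alpha>, s))" using LIMSEQ_unique[OF g(1) pointwise] by auto
      then show ?thesis using g(2) by simp
    qed
    ultimately show "f \<in> S" by (simp add: S_def)
  qed
  have "T ` S \<subseteq> S"
  proof safe
    fix f assume f: "f \<in> S"
    have "norm (T f) \<le> R"
    proof (rule norm_bound)
      fix p
      have "a * (norm f * norm f) / \<mu> \<le> a * (R * R) / \<mu>"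
        using f a \<mu> R by (intro divide_right_mono mult_left_mono mult_mono) (auto simp: S_def)
      also have "\<dots> = R / 12" using a R by (simp add: \<mu>_def field_simps)
      finally have le: "a * (norm f * norm f) / \<mu> \<le> R / 12" .
      have "2 * K + 3 * X \<le> R" if "X \<le> R / 12" for X :: real
        using that K0 by (simp add: R_def field_simps)
      from order_trans[OF T_bound this[OF le]] show "norm (T f p) \<le> R" unfolding T_apply .
    qed
    moreover have "((\<lambda>s. f1 (T f) (\<alpha>, s)) has_real_derivative f2 (T f) (\<alpha>, s)) (at s)" for \<alpha> s
    proof -
      have "((\<lambda>s. w1 f \<alpha> s) has_real_derivative w2 f \<alpha> s) (at s)" for \<alpha> s
        unfolding w1_def w2_def using f by (intro oblique_conv_deriv cont) (auto simp: S_def)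
      then have "((\<lambda>s. damped_integral \<mu> (w1 f) (cl \<alpha>) s) has_real_derivative
          damped_integral \<mu> (w2 f) (cl \<alpha>) s) (at s)"
        by (intro damped_integral_deriv w1_cont w2_cont)
      then show ?thesis
        using q[of s] by (auto simp: f1_def f2_def T_apply T1_def T2_def intro!: derivative_eq_intros)
    qed
    ultimately show "T f \<in> S" by (simp add: S_def)
  qed
  moreover have "dist (T f) (T g) \<le> 1 / 2 * dist f g" if f: "f \<in> S" and g: "g \<in> S" for f g
  proof (rule dist_bound)
    fix p
    let ?D = "dist f g"
    have R': "norm f \<le> R" "norm g \<le> R" using f g by (auto simp: S_def)
    have bR: "\<bar>f1 f p\<bar> \<le> R" "\<bar>f2 f p\<bar> \<le> R" "\<bar>f1 g p\<bar> \<le> R" "\<bar>f2 g p\<bar> \<le> R" for p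
      using bound[of f p] bound[of g p] R' by auto
    have conv_diff: "\<bar>oblique_conv u v \<alpha> s - oblique_conv u' v' \<alpha> s\<bar> \<le> 2 * (a * (R * ?D))"
      if "continuous_on UNIV u" "continuous_on UNIV v" "continuous_on UNIV u'" "continuous_on UNIV v'"
        "\<And>p. \<bar>u p - u' p\<bar> \<le> ?D" "\<And>p. \<bar>v p - v' p\<bar> \<le> ?D" "\<And>p. \<bar>v p\<bar> \<le> R" "\<And>p. \<bar>u' p\<bar> \<le> R"
        "0 \<le> \<alpha>" "\<alpha> \<le> a" for u v u' v' \<alpha> s
    proof -
      have "\<bar>oblique_conv (\<lambda>p. u p - u' p) v \<alpha> s\<bar> \<le> a * (?D * R)"
        by (intro oblique_conv_bound continuous_on_diff that)
      moreover have "\<bar>oblique_conv u' (\<lambda>p. v p - v' p) \<alpha> s\<bar> \<le> a * (R * ?D)"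
        by (intro oblique_conv_bound continuous_on_diff that)
      ultimately show ?thesis
        unfolding oblique_conv_diff[OF that(1-4)] by (simp add: mult.commute[of ?D R])
    qed
    have 1: "\<bar>T1 f p - T1 g p\<bar> \<le> (2 * (a * (R * ?D))) / \<mu>"
    proof -
      have "T1 f p - T1 g p = damped_integral \<mu> (\<lambda>\<alpha> s. w1 g \<alpha> s - w1 f \<alpha> s) (cl (fst p)) (snd p)"
        unfolding damped_integral_diff[OF w1_cont w1_cont, symmetric] by (simp add: T1_def)
      also have "\<bar>\<dots>\<bar> \<le> (2 * (a * (R * ?D))) / \<mu>"
      proof (rule damped_integral_bound[OF _ _ cl \<mu>])
        show "continuous_on UNIV (\<lambda>(\<alpha>, s). w1 g \<alpha> s - w1 f \<alpha> s)"
          using continuous_on_diff[OF w1_cont w1_cont, of g f] by (simp add: case_prod_unfold)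
        show "\<bar>w1 g \<alpha> (snd p) - w1 f \<alpha> (snd p)\<bar> \<le> 2 * (a * (R * ?D))" if "0 \<le> \<alpha>" "\<alpha> \<le> a" for \<alpha>
          unfolding w1_def
          by (intro conv_diff cont bR that) (use diff_bound[of g _ f] in \<open>simp_all add: dist_commute\<close>)
      qed
      finally show ?thesis .
    qed
    have 2: "\<bar>T2 f p - T2 g p\<bar> \<le> (4 * (a * (R * ?D))) / \<mu>"
    proof -
      have "T2 f p - T2 g p = damped_integral \<mu> (\<lambda>\<alpha> s. w2 g \<alpha> s - w2 f \<alpha> s) (cl (fst p)) (snd p)"
        unfolding damped_integral_diff[OF w2_cont w2_cont, symmetric] by (simp add: T2_def)
      also have "\<bar>\<dots>\<bar> \<le> (4 * (a * (R * ?D))) / \<mu>"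
      proof (rule damped_integral_bound[OF _ _ cl \<mu>])
        show "continuous_on UNIV (\<lambda>(\<alpha>, s). w2 g \<alpha> s - w2 f \<alpha> s)"
          using continuous_on_diff[OF w2_cont w2_cont, of g f] by (simp add: case_prod_unfold)
        fix \<alpha> assume \<alpha>: "0 \<le> \<alpha>" "\<alpha> \<le> a"
        have "\<bar>oblique_conv (f2 g) (f1 g) \<alpha> (snd p) - oblique_conv (f2 f) (f1 f) \<alpha> (snd p)\<bar> \<le> 2 * (a * (R * ?D))"
          "\<bar>oblique_conv (f1 g) (f2 g) \<alpha> (snd p) - oblique_conv (f1 f) (f2 f) \<alpha> (snd p)\<bar> \<le> 2 * (a * (R * ?D))"
          by (intro conv_diff cont bR \<alpha>; use diff_bound[of g _ f] in \<open>simp add: dist_commute\<close>)+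
        then show "\<bar>w2 g \<alpha> (snd p) - w2 f \<alpha> (snd p)\<bar> \<le> 4 * (a * (R * ?D))"
          unfolding w2_def by linarith
      qed
      finally show ?thesis .
    qed
    have "dist (T f p) (T g p) \<le> \<bar>T1 f p - T1 g p\<bar> + \<bar>T2 f p - T2 g p\<bar>"
      unfolding T_apply dist_norm diff_Pair
      using norm_Pair_le[of "T1 f p - T1 g p" "T2 f p - T2 g p"] by simp
    also have "\<dots> \<le> (2 * (a * (R * ?D))) / \<mu> + (4 * (a * (R * ?D))) / \<mu>" by (rule add_mono[OF 1 2])
    also have "\<dots> = 1 / 2 * ?D" using a R by (simp add: \<mu>_def field_simps)
    finally show "dist (T f p) (T g p) \<le> 1 / 2 * ?D" .
  qed
  moreover have "0 \<in> S" using R by (simp add: S_def f1_def f2_def)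
  ultimately have "\<exists>!f\<in>S. T f = f"
    using \<open>closed S\<close> by (intro Banach_fix[where c = "1/2"]) (auto simp: complete_eq_closed)
  then obtain f where f: "f \<in> S" "T f = f" by blast
  have fix1: "f1 f (\<alpha>, s) = exp (- \<mu> * cl \<alpha>) * q s - damped_integral \<mu> (w1 f) (cl \<alpha>) s" for \<alpha> s
  proof -
    have "f1 f (\<alpha>, s) = f1 (T f) (\<alpha>, s)" by (simp only: f(2))
    then show ?thesis by (simp add: f1_def T_apply T1_def)
  qed
  \<comment> \<open>The clamped fixed point solves the equation only for \<alpha> in [0,a]. B is
    rebuilt as an \<alpha>-integral of H, which is continuous and constant in \<alpha> beyond both
    ends; so B is differentiable in \<alpha> on the whole line and agrees with exp (\<mu> \<alpha>)
    times the fixed point on [0,a].\<close>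
  define H where "H \<alpha> s = exp (\<mu> * cl \<alpha>) * w1 f (cl \<alpha>) s" for \<alpha> s
  define B where "B \<alpha> s = q s - integral {0..1} (\<lambda>r. \<alpha> * H (r * \<alpha>) s)" for \<alpha> s
  have H_at: "continuous_on A (\<lambda>z. H (g z) (k z))" if "continuous_on A g" "continuous_on A k"
    for A :: "'z::topological_space set" and g k
    unfolding H_def by (intro continuous_intros cl_at continuous_on_uncurry[OF w1_cont] that)
  have B_cont: "continuous_on UNIV (\<lambda>(\<alpha>, s). B \<alpha> s)"
    unfolding B_def case_prod_unfold
    by (intro continuous_on_diff continuous_on_unit_integral continuous_on_compose2[OF q_cont])
      (auto simp: case_prod_unfold intro!: continuous_intros H_at)
  have B_eq: "B \<alpha> s = exp (\<mu> * \<alpha>) * f1 f (\<alpha>, s)" if \<alpha>: "\<alpha> \<in> {0..a}" for \<alpha> s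
  proof -
    have cl\<alpha>: "cl \<alpha> = \<alpha>" using \<alpha> by (simp add: cl_def)
    have "exp (\<mu> * \<alpha>) * damped_integral \<mu> (w1 f) \<alpha> s =
        integral {0..1} (\<lambda>t. exp (\<mu> * \<alpha>) * (\<alpha> * exp (- \<mu> * \<alpha> * (1 - t)) * w1 f (t * \<alpha>) s))"
      by (simp add: damped_integral_def)
    also have "\<dots> = integral {0..1} (\<lambda>t. \<alpha> * H (t * \<alpha>) s)"
    proof (rule Henstock_Kurzweil_Integration.integral_cong)
      fix t :: real assume t: "t \<in> {0..1}"
      then have "0 \<le> t * \<alpha>" "t * \<alpha> \<le> a" using \<alpha> mult_right_mono[of t 1 \<alpha>] by auto
      then have clt: "cl (t * \<alpha>) = t * \<alpha>" by (simp add: cl_def)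
      have exps: "exp (\<mu> * \<alpha>) * exp (- \<mu> * \<alpha> * (1 - t)) = exp (\<mu> * (t * \<alpha>))"
        unfolding mult_exp_exp by (simp add: algebra_simps)
      have "exp (\<mu> * \<alpha>) * (\<alpha> * e * W) = \<alpha> * ((exp (\<mu> * \<alpha>) * e) * W)" for e W :: real by simp
      then show "exp (\<mu> * \<alpha>) * (\<alpha> * exp (- \<mu> * \<alpha> * (1 - t)) * w1 f (t * \<alpha>) s) = \<alpha> * H (t * \<alpha>) s"
        unfolding H_def clt by (simp only: exps)
    qed
    finally have "exp (\<mu> * \<alpha>) * f1 f (\<alpha>, s) = exp (\<mu> * \<alpha>) * exp (- \<mu> * \<alpha>) * q s - integral {0..1} (\<lambda>t. \<alpha> * H (t * \<alpha>) s)"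
      unfolding fix1 cl\<alpha> by (simp add: right_diff_distrib)
    also have "exp (\<mu> * \<alpha>) * exp (- \<mu> * \<alpha>) = 1" unfolding mult_exp_exp by simp
    finally show ?thesis by (simp add: B_def)
  qed
  show thesis
  proof (rule that[of B "\<lambda>\<alpha> s. - H \<alpha> s" "\<lambda>\<alpha> s. exp (\<mu> * cl \<alpha>) * f2 f (\<alpha>, s)"])
    show "continuous_on UNIV (\<lambda>(\<alpha>, s). B \<alpha> s)" by (rule B_cont)
    show "continuous_on UNIV (\<lambda>(\<alpha>, s). - H \<alpha> s)"
      unfolding case_prod_unfold by (intro continuous_intros H_at)
    show "continuous_on UNIV (\<lambda>(\<alpha>, s). exp (\<mu> * cl \<alpha>) * f2 f (\<alpha>, s))"
      unfolding case_prod_unfold by (intro continuous_intros cl_at continuous_on_compose2[OF cont(2)[of UNIV]]) auto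
    show "B 0 s = q s" for s by (simp add: B_def)
    show "((\<lambda>\<alpha>. B \<alpha> s) has_real_derivative - H \<alpha> s) (at \<alpha>)" for \<alpha> s
    proof -
      have H_s: "continuous_on UNIV (\<lambda>\<alpha>. H \<alpha> s)" by (intro H_at continuous_intros)
      obtain F where F: "\<And>t. (F has_real_derivative H t s) (at t)" "F 0 = 0"
        by (rule antiderivative_real_line[OF H_s], rule that)
      have "(\<lambda>\<alpha>. B \<alpha> s) = (\<lambda>\<alpha>. q s - F \<alpha>)" unfolding B_def rescaled_integral[OF F] by (rule refl)
      moreover have "((\<lambda>\<alpha>. q s - F \<alpha>) has_real_derivative - H \<alpha> s) (at \<alpha>)"
        using F(1)[of \<alpha>] by (auto intro!: derivative_eq_intros)
      ultimately show ?thesis by simp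
    qed
    fix \<alpha> s :: real assume \<alpha>: "\<alpha> \<in> {0..a}"
    have cl\<alpha>: "cl \<alpha> = \<alpha>" using \<alpha> by (simp add: cl_def)
    have "((\<lambda>s. f1 f (\<alpha>, s)) has_real_derivative f2 f (\<alpha>, s)) (at s)"
      using f(1) unfolding S_def by blast
    then have "((\<lambda>s. exp (\<mu> * \<alpha>) * f1 f (\<alpha>, s)) has_real_derivative exp (\<mu> * \<alpha>) * f2 f (\<alpha>, s)) (at s)"
      by (rule DERIV_cmult)
    moreover have "(\<lambda>s. B \<alpha> s) = (\<lambda>s. exp (\<mu> * \<alpha>) * f1 f (\<alpha>, s))"
      by (rule ext) (rule B_eq[OF \<alpha>])
    ultimately show "((\<lambda>s. B \<alpha> s) has_real_derivative exp (\<mu> * cl \<alpha>) * f2 f (\<alpha>, s)) (at s)"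
      by (simp only: cl\<alpha>)
    let ?h = "\<lambda>\<beta>. B \<beta> (s - \<alpha> + \<beta>) * B (\<alpha> - \<beta>) (s - \<beta>)"
    have "H \<alpha> s = integral {0..1} (\<lambda>r. exp (\<mu> * \<alpha>) *
        (\<alpha> * (f1 f (r * \<alpha>, s - \<alpha> + r * \<alpha>) * f1 f (\<alpha> - r * \<alpha>, s - r * \<alpha>))))"
      by (simp add: H_def cl\<alpha> w1_def oblique_conv_def)
    also have "\<dots> = integral {0..1} (\<lambda>r. \<alpha> * ?h (r * \<alpha>))"
    proof (rule Henstock_Kurzweil_Integration.integral_cong)
      fix r :: real assume r: "r \<in> {0..1}"
      then have "0 \<le> r * \<alpha>" "r * \<alpha> \<le> \<alpha>" using \<alpha> mult_right_mono[of r 1 \<alpha>] by auto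
      then have r\<alpha>: "r * \<alpha> \<in> {0..a}" "\<alpha> - r * \<alpha> \<in> {0..a}" using \<alpha> by auto
      have "exp (\<mu> * \<alpha>) = exp (\<mu> * (r * \<alpha>)) * exp (\<mu> * (\<alpha> - r * \<alpha>))"
        unfolding mult_exp_exp by (simp add: algebra_simps)
      then show "exp (\<mu> * \<alpha>) * (\<alpha> * (f1 f (r * \<alpha>, s - \<alpha> + r * \<alpha>) * f1 f (\<alpha> - r * \<alpha>, s - r * \<alpha>))) = \<alpha> * ?h (r * \<alpha>)"
        unfolding B_eq[OF r\<alpha>(1)] B_eq[OF r\<alpha>(2)] by simp
    qed
    also have "\<dots> = integral {0..\<alpha>} ?h"
      using \<alpha> by (intro rescaled_integral_eq continuous_intros continuous_on_uncurry[OF B_cont]) auto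
    finally show "- H \<alpha> s = - integral {0..\<alpha>} ?h" by simp
  qed
qed

section \<open>Identification of A and the differential equation\<close>

lemma continuous_on_Icc_bounded:
  fixes f :: "real \<Rightarrow> real"
  assumes "continuous_on {a..b} f"
  shows "\<exists>M. \<forall>x\<in>{a..b}. \<bar>f x\<bar> \<le> M"
  using compact_imp_bounded[OF compact_continuous_image[OF assms compact_Icc]]
  by (auto simp: bounded_iff)

text \<open>The derivative is extended rather than the function: continued constantly beyond [0,Y],
  cut off by a tent that vanishes outside [-1, Y + 1], and integrated. The compact support keeps the
  antiderivative bounded, as the contraction argument requires.\<close>

lemma C1_extension:
  fixes q :: "real \<Rightarrow> real"
  assumes C1: "C1_on q S" and S: "{0..Y} \<subseteq> S" and Y: "0 \<le> Y"
  obtains f f' :: "real \<Rightarrow> real" and K where "\<And>s. (f has_real_derivative f' s) (at s)" "continuous_on UNIV f'"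
    "\<And>s. \<bar>f s\<bar> \<le> K" "\<And>s. \<bar>f' s\<bar> \<le> K" "\<And>s. s \<in> {0..Y} \<Longrightarrow> f s = q s"
proof -
  obtain q' :: "real \<Rightarrow> real \<Rightarrow>\<^sub>L real" where q': "continuous_on S q'"
    "\<And>s. s \<in> S \<Longrightarrow> (q has_derivative blinfun_apply (q' s)) (at s within S)"
    using C1 by (auto simp: C1_on_def)
  define p where "p s = blinfun_apply (q' s) 1" for s
  have p: "(q has_real_derivative p s) (at s within {0..Y})" if "s \<in> {0..Y}" for s
  proof -
    have "blinfun_apply (q' s) = (*) (p s)"
    proof
      fix h show "blinfun_apply (q' s) h = p s * h"
        using blinfun.scaleR_right[of "q' s" h 1] by (simp add: p_def mult.commute)
    qed
    then have "(q has_real_derivative p s) (at s within S)"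
      using q'(2)[of s] that S by (auto simp: has_field_derivative_def)
    then show ?thesis by (rule DERIV_subset[OF _ S])
  qed
  have p_cont: "continuous_on {0..Y} p"
    unfolding p_def by (intro continuous_intros continuous_on_subset[OF q'(1) S])
  define cl where "cl s = max 0 (min Y s)" for s
  have cl: "cl s \<in> {0..Y}" for s using Y by (auto simp: cl_def)
  have cl_cont: "continuous_on A cl" for A unfolding cl_def by (intro continuous_intros)
  define f' where "f' s = p (cl s) * max 0 (1 - \<bar>s - cl s\<bar>)" for s
  have f'_cont: "continuous_on A f'" for A
    unfolding f'_def
    by (intro continuous_intros cl_cont continuous_on_compose2[OF p_cont]) (use cl in auto)
  obtain M where M: "\<And>s. s \<in> {0..Y} \<Longrightarrow> \<bar>p s\<bar> \<le> M"
    using continuous_on_Icc_bounded[OF p_cont] by blast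
  have f'_bound: "\<bar>f' s\<bar> \<le> M" for s
  proof -
    have "\<bar>p (cl s)\<bar> * \<bar>max 0 (1 - \<bar>s - cl s\<bar>)\<bar> \<le> M * 1"
      using M[OF cl[of s]] by (intro mult_mono) auto
    then show ?thesis by (simp add: f'_def abs_mult)
  qed
  obtain F where F: "\<And>t. (F has_real_derivative f' t) (at t)" "F 0 = 0"
    "\<And>s t. s \<le> t \<Longrightarrow> F t - F s = integral {s..t} f'"
    by (rule antiderivative_real_line[OF f'_cont], rule that)
  have F_cont: "continuous_on A F" for A
    by (rule DERIV_continuous_on, rule has_field_derivative_at_within, rule F(1))
  obtain L where L: "\<And>s. s \<in> {-1..Y + 1} \<Longrightarrow> \<bar>F s\<bar> \<le> L"
    using continuous_on_Icc_bounded[OF F_cont] by blast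
  have F_bound: "\<bar>F s\<bar> \<le> L" for s
  proof -
    consider "s < -1" | "s \<in> {-1..Y + 1}" | "Y + 1 < s" by fastforce
    then show ?thesis
    proof cases
      case 1
      have "F (-1) - F s = integral {s..-1} (\<lambda>_. 0)"
        unfolding F(3)[OF less_imp_le[OF 1]]
        by (rule Henstock_Kurzweil_Integration.integral_cong) (use Y in \<open>auto simp: f'_def cl_def\<close>)
      then show ?thesis using L[of "-1"] Y by simp
    next
      case 3
      have "F s - F (Y + 1) = integral {Y + 1..s} (\<lambda>_. 0)"
        unfolding F(3)[OF less_imp_le[OF 3]]
        by (rule Henstock_Kurzweil_Integration.integral_cong) (use Y in \<open>auto simp: f'_def cl_def\<close>)
      then show ?thesis using L[of "Y + 1"] Y by simp
    qed (rule L)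
  qed
  have F_eq: "q 0 + F s = q s" if s: "s \<in> {0..Y}" for s
  proof -
    have "(p has_integral (q s - q 0)) {0..s}"
    proof (rule fundamental_theorem_of_calculus)
      fix t assume "t \<in> {0..s}"
      then show "(q has_vector_derivative p t) (at t within {0..s})"
        unfolding has_real_derivative_iff_has_vector_derivative[symmetric]
        using s by (intro DERIV_subset[OF p]) auto
    qed (use s in auto)
    moreover have "F s = integral {0..s} p"
    proof -
      have "F s = integral {0..s} f'" using F(2) F(3)[of 0 s] s by simp
      also have "\<dots> = integral {0..s} p"
        by (rule Henstock_Kurzweil_Integration.integral_cong) (use s in \<open>auto simp: f'_def cl_def\<close>)
      finally show ?thesis .
    qed
    ultimately show ?thesis by (simp add: integral_unique)
  qed
  show thesis
  proof (rule that[of "\<lambda>s. q 0 + F s" f' "\<bar>q 0\<bar> + L + M"])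
    have "0 \<le> L" "0 \<le> M" using order_trans[OF abs_ge_zero F_bound] order_trans[OF abs_ge_zero f'_bound] by auto
    then show "\<bar>q 0 + F s\<bar> \<le> \<bar>q 0\<bar> + L + M" "\<bar>f' s\<bar> \<le> \<bar>q 0\<bar> + L + M" for s
      using F_bound[of s] f'_bound[of s] by linarith+
    show "((\<lambda>s. q 0 + F s) has_real_derivative f' s) (at s)" for s
      using F(1)[of s] by (auto intro!: derivative_eq_intros)
  qed (use f'_cont F_eq in auto)
qed

text \<open>Division by the power 1 - \<epsilon> leaves \<kappa>^2 exp (- 2 a \<epsilon> \<kappa>).
  This is how an error with a factor \<kappa>^2 still qualifies for \<open>tilde_O\<close>.\<close>

lemma square_exp_ratio_tendsto_0:
  fixes a \<epsilon> C :: real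
  assumes "0 < a" "0 < \<epsilon>"
  shows "((\<lambda>\<kappa>. C * \<kappa>\<^sup>2 * exp (- 2 * a * \<kappa>) / exp (- 2 * a * \<kappa>) powr (1 - \<epsilon>)) \<longlongrightarrow> 0) at_top"
proof -
  define c where "c = 2 * a * \<epsilon>"
  have c: "0 < c" using assms by (simp add: c_def)
  have "((\<lambda>\<kappa>. (c * \<kappa>)\<^sup>2 / exp (c * \<kappa>)) \<longlongrightarrow> 0) at_top"
    by (rule filterlim_compose[OF tendsto_power_div_exp_0])
      (rule filterlim_tendsto_pos_mult_at_top[OF tendsto_const c filterlim_ident])
  then have "((\<lambda>\<kappa>. C / c\<^sup>2 * ((c * \<kappa>)\<^sup>2 / exp (c * \<kappa>))) \<longlongrightarrow> C / c\<^sup>2 * 0) at_top"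
    by (intro tendsto_intros)
  moreover have "C / c\<^sup>2 * ((c * \<kappa>)\<^sup>2 / exp (c * \<kappa>)) =
      C * \<kappa>\<^sup>2 * exp (- 2 * a * \<kappa>) / exp (- 2 * a * \<kappa>) powr (1 - \<epsilon>)" for \<kappa>
  proof -
    have "exp (- 2 * a * \<kappa>) powr (1 - \<epsilon>) = exp ((1 - \<epsilon>) * (- 2 * a * \<kappa>))" by (simp add: powr_def)
    also have "\<dots> = exp (- 2 * a * \<kappa>) * exp (c * \<kappa>)"
      unfolding mult_exp_exp by (simp add: c_def algebra_simps)
    finally show ?thesis using c by (simp add: power_mult_distrib)
  qed
  ultimately show ?thesis by simp
qed

lemma abs_diff_le_cmod_diff_of_real:
  "\<bar>v - u\<bar> \<le> cmod (w - complex_of_real u) + cmod (w - complex_of_real v)"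
proof -
  have "\<bar>v - u\<bar> = cmod ((w - complex_of_real u) - (w - complex_of_real v))"
    by (simp flip: of_real_diff)
  then show ?thesis using norm_triangle_ineq4[of "w - complex_of_real u" "w - complex_of_real v"] by linarith
qed

text \<open>Below a level Y < b the potential can be replaced by a bounded C^1 function on the line,
  for which the transport equation is solvable. The expansion at x with cutoff y - x uses the
  initial values of B only on [x,y], so with y < Y the replacement beyond Y does no harm.\<close>

lemma A_function_local:
  fixes q :: "real \<Rightarrow> real" and A :: "real \<Rightarrow> real \<Rightarrow> real"
  assumes pot: "potential q b h" and C1: "C1_on q (half_open_dom b)" and A: "is_A_function q b h A"
    and Y: "0 < Y" "ereal Y < b"
  obtains A\<^sub>Y A\<^sub>\<alpha> A\<^sub>x :: "real \<Rightarrow> real \<Rightarrow> real" where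
    "\<And>\<alpha> x. 0 < \<alpha> \<Longrightarrow> 0 \<le> x \<Longrightarrow> \<alpha> + x < Y \<Longrightarrow> A \<alpha> x = A\<^sub>Y \<alpha> x"
    "continuous_on UNIV (\<lambda>(\<alpha>, x). A\<^sub>Y \<alpha> x)" "continuous_on UNIV (\<lambda>(\<alpha>, x). A\<^sub>\<alpha> \<alpha> x)"
    "continuous_on UNIV (\<lambda>(\<alpha>, x). A\<^sub>x \<alpha> x)"
    "\<And>\<alpha> x. 0 < \<alpha> \<Longrightarrow> \<alpha> < Y \<Longrightarrow>
      ((\<lambda>(\<alpha>, x). A\<^sub>Y \<alpha> x) has_derivative (\<lambda>(d, e). A\<^sub>\<alpha> \<alpha> x * d + A\<^sub>x \<alpha> x * e)) (at (\<alpha>, x))"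
    "\<And>\<alpha> x. 0 < \<alpha> \<Longrightarrow> \<alpha> < Y \<Longrightarrow>
      A\<^sub>x \<alpha> x = A\<^sub>\<alpha> \<alpha> x + integral {0..\<alpha>} (\<lambda>\<beta>. A\<^sub>Y \<beta> x * A\<^sub>Y (\<alpha> - \<beta>) x)"
proof -
  have sub: "{0..Y} \<subseteq> half_open_dom b"
  proof
    fix x assume "x \<in> {0..Y}"
    then show "x \<in> half_open_dom b" using Y le_less_trans[of "ereal x" "ereal Y" b] by simp
  qed
  have q_cont: "continuous_on (half_open_dom b) q"
  proof -
    obtain q' where "\<forall>s\<in>half_open_dom b. (q has_derivative blinfun_apply (q' s)) (at s within half_open_dom b)"
      using C1 unfolding C1_on_def by (elim exE conjE) (rule that)
    then show ?thesis
      unfolding continuous_on_eq_continuous_within by (intro ballI has_derivative_continuous) (erule (1) bspec)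
  qed
  obtain f f' :: "real \<Rightarrow> real" and K where f: "\<And>s. (f has_real_derivative f' s) (at s)" "continuous_on UNIV f'"
    "\<And>s. \<bar>f s\<bar> \<le> K" "\<And>s. \<bar>f' s\<bar> \<le> K" "\<And>s. s \<in> {0..Y} \<Longrightarrow> f s = q s"
    by (rule C1_extension[OF C1 sub less_imp_le[OF Y(1)]], rule that)
  obtain B B' P :: "real \<Rightarrow> real \<Rightarrow> real" where
    B_cont: "continuous_on UNIV (\<lambda>(\<alpha>, s). B \<alpha> s)" and B'_cont: "continuous_on UNIV (\<lambda>(\<alpha>, s). B' \<alpha> s)"
    and P_cont: "continuous_on UNIV (\<lambda>(\<alpha>, s). P \<alpha> s)" and B_0: "\<And>s. B 0 s = f s"
    and B': "\<And>\<alpha> s. ((\<lambda>\<alpha>. B \<alpha> s) has_real_derivative B' \<alpha> s) (at \<alpha>)"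
    and P: "\<And>\<alpha> s. \<alpha> \<in> {0..Y} \<Longrightarrow> ((\<lambda>s. B \<alpha> s) has_real_derivative P \<alpha> s) (at s)"
    and B'_eq: "\<And>\<alpha> s. \<alpha> \<in> {0..Y} \<Longrightarrow> B' \<alpha> s = - integral {0..\<alpha>} (\<lambda>\<beta>. B \<beta> (s - \<alpha> + \<beta>) * B (\<alpha> - \<beta>) (s - \<beta>))"
    by (rule transported_amplitude_exists[OF f(1-4) Y(1)], rule that)
  define A\<^sub>Y where "A\<^sub>Y \<alpha> x = B \<alpha> (x + \<alpha>)" for \<alpha> x
  have AY_at: "continuous_on S (\<lambda>z. A\<^sub>Y (g z) (k z))" if "continuous_on S g" "continuous_on S k"
    for S :: "'z::topological_space set" and g k
    unfolding A\<^sub>Y_def by (intro continuous_on_uncurry[OF B_cont] continuous_intros that)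
  have vanish: "integral {0..\<tau>} (\<lambda>\<alpha>. A \<alpha> x - A\<^sub>Y \<alpha> x) = 0"
    and A_int: "(\<lambda>\<alpha>. A \<alpha> x) absolutely_integrable_on {0..\<tau>}"
    if x: "0 \<le> x" and \<tau>: "0 < \<tau>" "\<tau> + x < Y" for x \<tau>
  proof -
    \<comment> \<open>A cutoff strictly between \<tau> + x and Y: then a = y - x exceeds \<tau>, as
      the uniqueness lemma demands, and both expansions of the same m-function are available up to
      a. Their difference is the Laplace integral of \<open>A - A\<^sub>Y\<close>.\<close>
    define y where "y = (\<tau> + x + Y) / 2"
    define a where "a = y - x"
    have y: "\<tau> + x < y" "y < Y" using \<tau> by (auto simp: y_def)
    have a: "\<tau> < a" "0 < a" using y \<tau> by (auto simp: a_def)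
    have yb: "ereal y < b" using y(2) Y(2) less_trans[of "ereal y" "ereal Y" b] by simp
    have xb: "ereal x < b" using yb a less_trans[of "ereal x" "ereal y" b] by (simp add: a_def)
    let ?m = "\<lambda>\<kappa>::real. m_function q b h (- (complex_of_real \<kappa>)\<^sup>2) x"
    let ?N = "\<lambda>A \<kappa>::real. - \<kappa> - integral {0..a} (\<lambda>\<alpha>. A \<alpha> x * exp (- 2 * \<alpha> * \<kappa>))"
    have A_a: "(\<lambda>\<alpha>. A \<alpha> x) absolutely_integrable_on {0..a}"
      and A_exp: "tilde_O (\<lambda>\<kappa>. ?m \<kappa> - complex_of_real (?N A \<kappa>)) (\<lambda>\<kappa>. exp (- 2 * a * \<kappa>)) at_top"
    proof -
      have "ereal (a + x) < b" using yb by (simp add: a_def)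
      from conjunct1[OF A[unfolded is_A_function_def, rule_format, OF conjI[OF x xb]], rule_format,
          OF conjI[OF a(2) this]]
      show "(\<lambda>\<alpha>. A \<alpha> x) absolutely_integrable_on {0..a}"
        "tilde_O (\<lambda>\<kappa>. ?m \<kappa> - complex_of_real (?N A \<kappa>)) (\<lambda>\<kappa>. exp (- 2 * a * \<kappa>)) at_top"
        by (rule conjunct1, rule conjunct2)
    qed
    have AY_a: "(\<lambda>\<alpha>. A\<^sub>Y \<alpha> x) absolutely_integrable_on {0..a}"
      by (intro absolutely_integrable_continuous_real AY_at continuous_intros)
    show "(\<lambda>\<alpha>. A \<alpha> x) absolutely_integrable_on {0..\<tau>}"
      by (rule absolutely_integrable_on_subinterval[OF A_a]) (use a in auto)
    have "\<exists>C \<kappa>\<^sub>0. \<forall>\<kappa>\<ge>\<kappa>\<^sub>0.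
        cmod (?m \<kappa> - complex_of_real (?N A\<^sub>Y \<kappa>)) \<le> C * \<kappa>\<^sup>2 * exp (- 2 * a * \<kappa>)"
      unfolding A\<^sub>Y_def a_def
    proof (rule m_function_expansion[OF pot q_cont x _ yb B' B_cont B'_cont])
      show "x < y" using y \<tau> by simp
      show "B 0 s = q s" if "s \<in> {x..y}" for s using that x y by (simp add: B_0 f(5))
      show "B' \<alpha> s = - integral {0..\<alpha>} (\<lambda>\<beta>. B \<beta> (s - \<alpha> + \<beta>) * B (\<alpha> - \<beta>) (s - \<beta>))" if "0 \<le> \<alpha>" "\<alpha> \<le> y - x" for \<alpha> s
        using that x y by (intro B'_eq) auto
    qed
    then obtain C \<kappa>\<^sub>0 where C: "\<forall>\<kappa>\<ge>\<kappa>\<^sub>0.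
        cmod (?m \<kappa> - complex_of_real (?N A\<^sub>Y \<kappa>)) \<le> C * \<kappa>\<^sup>2 * exp (- 2 * a * \<kappa>)"
      by (elim exE) (rule that)
    show "integral {0..\<tau>} (\<lambda>\<alpha>. A \<alpha> x - A\<^sub>Y \<alpha> x) = 0"
    proof (rule truncated_laplace_unique[OF _ \<tau>(1) a(1)])
      show "(\<lambda>\<alpha>. A \<alpha> x - A\<^sub>Y \<alpha> x) absolutely_integrable_on {0..a}"
        by (rule set_integral_diff(1)[OF A_a AY_a])
      fix \<epsilon> :: real assume \<epsilon>: "0 < \<epsilon>"
      let ?e = "\<lambda>\<kappa>. exp (- 2 * a * \<kappa>) powr (1 - \<epsilon>)"
      have lim1: "((\<lambda>\<kappa>. cmod (?m \<kappa> - complex_of_real (?N A \<kappa>)) / ?e \<kappa>) \<longlongrightarrow> 0) at_top"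
        using A_exp[unfolded tilde_O_def, rule_format, OF \<epsilon>] by (simp only: real_norm_def abs_exp_cancel)
      have lim: "((\<lambda>\<kappa>. cmod (?m \<kappa> - complex_of_real (?N A \<kappa>)) / ?e \<kappa> +
          C * \<kappa>\<^sup>2 * exp (- 2 * a * \<kappa>) / ?e \<kappa>) \<longlongrightarrow> 0) at_top"
        using tendsto_add[OF lim1 square_exp_ratio_tendsto_0[OF a(2) \<epsilon>, of C]] by simp
      show "((\<lambda>\<kappa>. \<bar>integral {0..a} (\<lambda>\<alpha>. (A \<alpha> x - A\<^sub>Y \<alpha> x) * exp (- 2 * \<alpha> * \<kappa>))\<bar> / ?e \<kappa>) \<longlongrightarrow> 0) at_top"
      proof (rule tendsto_sandwich[OF _ _ tendsto_const lim])
        show "eventually (\<lambda>\<kappa>. 0 \<le> \<bar>integral {0..a} (\<lambda>\<alpha>. (A \<alpha> x - A\<^sub>Y \<alpha> x) * exp (- 2 * \<alpha> * \<kappa>))\<bar> / ?e \<kappa>) at_top"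
          by (intro always_eventually allI divide_nonneg_nonneg) auto
        show "eventually (\<lambda>\<kappa>. \<bar>integral {0..a} (\<lambda>\<alpha>. (A \<alpha> x - A\<^sub>Y \<alpha> x) * exp (- 2 * \<alpha> * \<kappa>))\<bar> / ?e \<kappa> \<le>
            cmod (?m \<kappa> - complex_of_real (?N A \<kappa>)) / ?e \<kappa> + C * \<kappa>\<^sup>2 * exp (- 2 * a * \<kappa>) / ?e \<kappa>) at_top"
        proof (rule eventually_at_top_linorderI[of \<kappa>\<^sub>0])
          fix \<kappa> assume \<kappa>: "\<kappa>\<^sub>0 \<le> \<kappa>"
          have int: "(\<lambda>\<alpha>. g \<alpha> * exp (- 2 * \<alpha> * \<kappa>)) integrable_on {0..a}" if "g absolutely_integrable_on {0..a}" for g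
          proof -
            have "(\<lambda>\<alpha>. g \<alpha> * exp (- 2 * \<alpha> * \<kappa>)) absolutely_integrable_on {0..a}"
              by (intro absolutely_integrable_mult_continuous that continuous_intros)
            then show ?thesis by (simp add: absolutely_integrable_on_def)
          qed
          have diff: "integral {0..a} (\<lambda>\<alpha>. (A \<alpha> x - A\<^sub>Y \<alpha> x) * exp (- 2 * \<alpha> * \<kappa>)) = ?N A\<^sub>Y \<kappa> - ?N A \<kappa>"
            using Henstock_Kurzweil_Integration.integral_diff[OF int[OF A_a] int[OF AY_a]]
            unfolding left_diff_distrib by linarith
          have "\<bar>?N A\<^sub>Y \<kappa> - ?N A \<kappa>\<bar> \<le>
              cmod (?m \<kappa> - complex_of_real (?N A \<kappa>)) + C * \<kappa>\<^sup>2 * exp (- 2 * a * \<kappa>)"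
            by (rule order_trans[OF abs_diff_le_cmod_diff_of_real add_left_mono[OF C[rule_format, OF \<kappa>]]])
          then show "\<bar>integral {0..a} (\<lambda>\<alpha>. (A \<alpha> x - A\<^sub>Y \<alpha> x) * exp (- 2 * \<alpha> * \<kappa>))\<bar> / ?e \<kappa> \<le>
            cmod (?m \<kappa> - complex_of_real (?N A \<kappa>)) / ?e \<kappa> + C * \<kappa>\<^sup>2 * exp (- 2 * a * \<kappa>) / ?e \<kappa>"
            unfolding diff add_divide_distrib[symmetric] by (rule divide_right_mono) simp
        qed
      qed
    qed
  qed
  have eq: "A \<alpha> x = A\<^sub>Y \<alpha> x" if \<alpha>x: "0 < \<alpha>" "0 \<le> x" "\<alpha> + x < Y" for \<alpha> x
  proof -
    define c where "c = (\<alpha> + Y - x) / 2"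
    have c: "\<alpha> < c" "c + x < Y" "0 < c" using \<alpha>x by (simp_all add: c_def field_simps)
    let ?d = "\<lambda>\<beta>. A \<beta> x - A\<^sub>Y \<beta> x"
    have xb: "ereal x < b" using \<alpha>x Y(2) less_trans[of "ereal x" "ereal Y" b] by simp
    have "continuous_on {\<beta>. 0 < \<beta> \<and> ereal (\<beta> + x) < b} (\<lambda>\<beta>. A \<beta> x - q (\<beta> + x))"
      by (rule conjunct2[OF A[unfolded is_A_function_def, rule_format, OF conjI[OF \<alpha>x(2) xb]]])
    then have "continuous_on {0<..<c} (\<lambda>\<beta>. A \<beta> x - q (\<beta> + x))"
    proof (rule continuous_on_subset, intro subsetI CollectI conjI)
      fix \<beta> assume "\<beta> \<in> {0<..<c}"
      then show "0 < \<beta>" "ereal (\<beta> + x) < b"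
        using c Y(2) less_trans[of "ereal (\<beta> + x)" "ereal Y" b] by simp_all
    qed
    moreover have "continuous_on {0<..<c} (\<lambda>\<beta>. q (\<beta> + x))"
      by (rule continuous_on_compose2[OF continuous_on_subset[OF q_cont sub]])
        (use c \<alpha>x in \<open>auto intro!: continuous_intros\<close>)
    ultimately have "continuous_on {0<..<c} (\<lambda>\<beta>. (A \<beta> x - q (\<beta> + x)) + q (\<beta> + x))"
      by (rule continuous_on_add)
    then have "continuous_on {0<..<c} (\<lambda>\<beta>. A \<beta> x)" by simp
    then have d_cont: "continuous_on {0<..<c} ?d" by (intro continuous_intros AY_at)
    \<comment> \<open>From equality of integrals to equality at every point: the pointwise
      normalisation of A makes \<open>?d\<close> continuous on the open interval, so its value is
      the derivative of an indefinite integral that vanishes identically there.\<close>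
    have "((\<lambda>u. integral {0..u} ?d) has_vector_derivative ?d \<alpha>) (at \<alpha> within {0..c} - {})"
    proof (rule integral_has_vector_derivative_continuous_at)
      show "?d integrable_on {0..c}"
      proof (rule integrable_diff)
        show "(\<lambda>\<beta>. A \<beta> x) integrable_on {0..c}"
          using A_int[OF \<alpha>x(2) c(3,2)] by (simp add: absolutely_integrable_on_def)
        show "(\<lambda>\<beta>. A\<^sub>Y \<beta> x) integrable_on {0..c}"
          by (intro integrable_continuous_real AY_at continuous_intros)
      qed
      show "continuous (at \<alpha> within {0..c} - {}) ?d"
        using d_cont c(1) \<alpha>x(1) by (simp add: continuous_on_eq_continuous_at continuous_at_imp_continuous_within)
    qed (use c \<alpha>x in auto)
    then have "((\<lambda>u. integral {0..u} ?d) has_real_derivative ?d \<alpha>) (at \<alpha>)"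
      using c \<alpha>x by (simp add: has_real_derivative_iff_has_vector_derivative at_within_Icc_at)
    moreover have "((\<lambda>u. integral {0..u} ?d) has_real_derivative 0) (at \<alpha>)"
      by (rule has_field_derivative_transform_within_open[of "\<lambda>_. 0" 0 \<alpha> "{0<..<c}"])
        (use c \<alpha>x vanish in auto)
    ultimately have "?d \<alpha> = 0" by (rule DERIV_unique)
    then show ?thesis by simp
  qed
  \<comment> \<open>Chain rule for B \<alpha> (x + \<alpha>). The difference of the two partial
    derivatives is B', the negative of the convolution.\<close>
  define A\<^sub>\<alpha> where "A\<^sub>\<alpha> \<alpha> x = B' \<alpha> (x + \<alpha>) + P \<alpha> (x + \<alpha>)" for \<alpha> x
  define A\<^sub>x where "A\<^sub>x \<alpha> x = P \<alpha> (x + \<alpha>)" for \<alpha> x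
  show thesis
  proof (rule that[of A\<^sub>Y A\<^sub>\<alpha> A\<^sub>x])
    show "A \<alpha> x = A\<^sub>Y \<alpha> x" if "0 < \<alpha>" "0 \<le> x" "\<alpha> + x < Y" for \<alpha> x by (rule eq[OF that])
    show "continuous_on UNIV (\<lambda>(\<alpha>, x). A\<^sub>Y \<alpha> x)"
      unfolding case_prod_unfold by (intro AY_at continuous_intros)
    show "continuous_on UNIV (\<lambda>(\<alpha>, x). A\<^sub>\<alpha> \<alpha> x)"
      unfolding case_prod_unfold A\<^sub>\<alpha>_def
      by (intro continuous_intros continuous_on_uncurry[OF B'_cont] continuous_on_uncurry[OF P_cont])
    show "continuous_on UNIV (\<lambda>(\<alpha>, x). A\<^sub>x \<alpha> x)"
      unfolding case_prod_unfold A\<^sub>x_def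
      by (intro continuous_intros continuous_on_uncurry[OF P_cont])
    fix \<alpha> x :: real assume \<alpha>: "0 < \<alpha>" "\<alpha> < Y"
    \<comment> \<open>P is known to be the s-derivative only for \<alpha> in [0,Y], so the partial
      derivatives are combined within the open strip, which is a neighbourhood of the point.\<close>
    have "((\<lambda>(\<alpha>, s). B \<alpha> s) has_derivative (\<lambda>(d, e). B' \<alpha> (x + \<alpha>) * d + blinfun_apply (blinfun_scaleR_left (P \<alpha> (x + \<alpha>))) e))
        (at (\<alpha>, x + \<alpha>) within {0<..<Y} \<times> UNIV)"
    proof (rule has_derivative_partialsI[where fy = "\<lambda>\<alpha> s. blinfun_scaleR_left (P \<alpha> s)"])
      show "((\<lambda>\<alpha>. B \<alpha> (x + \<alpha>')) has_derivative (*) (B' \<alpha> (x + \<alpha>'))) (at \<alpha> within {0<..<Y})" for \<alpha>'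
        using has_field_derivative_at_within[OF B'] by (simp add: has_field_derivative_def)
      show "((\<lambda>s. B \<alpha> s) has_derivative blinfun_apply (blinfun_scaleR_left (P \<alpha> s))) (at s within UNIV)"
        if "\<alpha> \<in> {0<..<Y}" for \<alpha> s
        using P[of \<alpha> s] that by (simp add: has_field_derivative_def blinfun_scaleR_left.rep_eq mult_commute_abs)
      have "continuous_on UNIV (\<lambda>(\<alpha>, s). blinfun_scaleR_left (P \<alpha> s))"
        using P_cont by (auto simp: case_prod_unfold intro!: continuous_intros)
      then show "continuous (at (\<alpha>, x + \<alpha>) within {0<..<Y} \<times> UNIV) (\<lambda>(\<alpha>, s). blinfun_scaleR_left (P \<alpha> s))"
        by (metis UNIV_I continuous_on_eq_continuous_within continuous_within_subset subset_UNIV)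
    qed auto
    moreover have "at (\<alpha>, x + \<alpha>) within {0<..<Y} \<times> UNIV = at (\<alpha>, x + \<alpha>)"
      using \<alpha> by (intro at_within_open open_Times) auto
    ultimately have B_deriv: "((\<lambda>(\<alpha>, s). B \<alpha> s) has_derivative
        (\<lambda>(d, e). B' \<alpha> (x + \<alpha>) * d + blinfun_apply (blinfun_scaleR_left (P \<alpha> (x + \<alpha>))) e)) (at (\<alpha>, x + \<alpha>))"
      by simp
    have "((\<lambda>p::real \<times> real. (fst p, snd p + fst p)) has_derivative (\<lambda>p. (fst p, snd p + fst p))) (at (\<alpha>, x))"
      by (auto intro!: derivative_eq_intros)
    from has_derivative_compose[OF this, of "\<lambda>(\<alpha>, s). B \<alpha> s"
        "\<lambda>(d, e). B' \<alpha> (x + \<alpha>) * d + blinfun_apply (blinfun_scaleR_left (P \<alpha> (x + \<alpha>))) e"] B_deriv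
    show "((\<lambda>(\<alpha>, x). A\<^sub>Y \<alpha> x) has_derivative (\<lambda>(d, e). A\<^sub>\<alpha> \<alpha> x * d + A\<^sub>x \<alpha> x * e)) (at (\<alpha>, x))"
      by (simp add: A\<^sub>Y_def A\<^sub>\<alpha>_def A\<^sub>x_def case_prod_unfold blinfun_scaleR_left.rep_eq algebra_simps)
    show "A\<^sub>x \<alpha> x = A\<^sub>\<alpha> \<alpha> x + integral {0..\<alpha>} (\<lambda>\<beta>. A\<^sub>Y \<beta> x * A\<^sub>Y (\<alpha> - \<beta>) x)"
      using B'_eq[of \<alpha> "x + \<alpha>"] \<alpha> by (simp add: A\<^sub>x_def A\<^sub>\<alpha>_def A\<^sub>Y_def add_diff_eq)
  qed
qed

section \<open>From local representations to the whole domain\<close>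

theorem theorem6p1:
  fixes q :: "real \<Rightarrow> real" and b h :: ereal and A :: "real \<Rightarrow> real \<Rightarrow> real"
  assumes "potential q b h"
    and "C1_on q {x. 0 \<le> x \<and> ereal x < b}"
    and "is_A_function q b h A"
  shows "C1_on (\<lambda>(\<alpha>, x). A \<alpha> x) (A_domain b) \<and>
    (\<forall>(\<alpha>, x) \<in> A_domain b. \<exists>A\<^sub>\<alpha> I.
        ((\<lambda>\<beta>. A \<beta> x) has_real_derivative A\<^sub>\<alpha>) (at \<alpha>) \<and>
        ((\<lambda>\<beta>. A \<beta> x * A (\<alpha> - \<beta>) x) has_integral I) {0..\<alpha>} \<and>
        ((\<lambda>y. A \<alpha> y) has_real_derivative (A\<^sub>\<alpha> + I)) (at x within {y. (\<alpha>, y) \<in> A_domain b}))"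
proof -
  let ?S = "A_domain b"
  \<comment> \<open>The total derivative is written in terms of A itself, not of a local
    representative, so nothing has to be glued when Y varies with the point.\<close>
  define D where "D \<alpha> x = deriv (\<lambda>\<beta>. A \<beta> x) \<alpha>" for \<alpha> x
  define I where "I \<alpha> x = integral {0..\<alpha>} (\<lambda>\<beta>. A \<beta> x * A (\<alpha> - \<beta>) x)" for \<alpha> x
  define A' where "A' p = D (fst p) (snd p) *\<^sub>R (fst_blinfun :: (real \<times> real) \<Rightarrow>\<^sub>L real) +
    (D (fst p) (snd p) + I (fst p) (snd p)) *\<^sub>R snd_blinfun" for p
  have main: "continuous (at p within ?S) A'" "((\<lambda>(\<alpha>, x). A \<alpha> x) has_derivative blinfun_apply (A' p)) (at p within ?S)"
    "((\<lambda>\<beta>. A \<beta> (snd p)) has_real_derivative D (fst p) (snd p)) (at (fst p))"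
    "((\<lambda>\<beta>. A \<beta> (snd p) * A (fst p - \<beta>) (snd p)) has_integral I (fst p) (snd p)) {0..fst p}"
    "((\<lambda>y. A (fst p) y) has_real_derivative (D (fst p) (snd p) + I (fst p) (snd p)))
      (at (snd p) within {y. (fst p, y) \<in> ?S})"
    if p: "p \<in> ?S" for p
  proof -
    obtain \<alpha> x where p_eq: "p = (\<alpha>, x)" by (cases p)
    have \<alpha>x: "0 \<le> x" "0 < \<alpha>" "ereal (\<alpha> + x) < b" using p by (auto simp: A_domain_def p_eq)
    obtain Y where Y: "\<alpha> + x < Y" "ereal Y < b"
      using ereal_dense2[OF \<alpha>x(3)] by auto
    have "0 < Y" using \<alpha>x Y by simp
    obtain A\<^sub>Y A\<^sub>\<alpha> A\<^sub>x :: "real \<Rightarrow> real \<Rightarrow> real" where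
      eq: "\<And>\<alpha> x. 0 < \<alpha> \<Longrightarrow> 0 \<le> x \<Longrightarrow> \<alpha> + x < Y \<Longrightarrow> A \<alpha> x = A\<^sub>Y \<alpha> x"
      and AY_cont: "continuous_on UNIV (\<lambda>(\<alpha>, x). A\<^sub>Y \<alpha> x)" and A\<alpha>_cont: "continuous_on UNIV (\<lambda>(\<alpha>, x). A\<^sub>\<alpha> \<alpha> x)"
      and Ax_cont: "continuous_on UNIV (\<lambda>(\<alpha>, x). A\<^sub>x \<alpha> x)"
      and AY_deriv: "\<And>\<alpha> x. 0 < \<alpha> \<Longrightarrow> \<alpha> < Y \<Longrightarrow>
        ((\<lambda>(\<alpha>, x). A\<^sub>Y \<alpha> x) has_derivative (\<lambda>(d, e). A\<^sub>\<alpha> \<alpha> x * d + A\<^sub>x \<alpha> x * e)) (at (\<alpha>, x))"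
      and A\<^sub>x: "\<And>\<alpha> x. 0 < \<alpha> \<Longrightarrow> \<alpha> < Y \<Longrightarrow>
        A\<^sub>x \<alpha> x = A\<^sub>\<alpha> \<alpha> x + integral {0..\<alpha>} (\<lambda>\<beta>. A\<^sub>Y \<beta> x * A\<^sub>Y (\<alpha> - \<beta>) x)"
      by (rule A_function_local[OF assms \<open>0 < Y\<close> Y(2)], rule that)
    \<comment> \<open>An open set whose trace on the domain is a relative neighbourhood of p on
      which A coincides with \<open>A\<^sub>Y\<close>. Only the trace is used, as x = 0 is a
      boundary point of the domain.\<close>
    define W :: "(real \<times> real) set" where "W = {p. fst p + snd p < Y}"
    have W: "open W" "p \<in> W"
      unfolding W_def using Y by (auto intro!: open_Collect_less continuous_intros simp: p_eq)
    have deriv_\<alpha>: "((\<lambda>\<beta>. A \<beta> x) has_real_derivative A\<^sub>\<alpha> \<alpha> x) (at \<alpha>)"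
      if "0 < \<alpha>" "0 \<le> x" "\<alpha> + x < Y" for \<alpha> x
    proof -
      have "((\<lambda>\<beta>. (\<beta>, x)) has_derivative (\<lambda>d. (d, 0))) (at \<alpha>)"
        by (auto intro!: derivative_eq_intros)
      from has_derivative_compose[OF this, of "\<lambda>(\<alpha>, x). A\<^sub>Y \<alpha> x" "\<lambda>(d, e). A\<^sub>\<alpha> \<alpha> x * d + A\<^sub>x \<alpha> x * e"] AY_deriv[of \<alpha> x] that
      have "((\<lambda>\<beta>. A\<^sub>Y \<beta> x) has_real_derivative A\<^sub>\<alpha> \<alpha> x) (at \<alpha>)"
        by (simp add: has_field_derivative_def)
      then show ?thesis
        by (rule has_field_derivative_transform_within_open[where S = "{0<..<Y - x}"]) (use that eq in auto)
    qed
    have integral_eq: "((\<lambda>\<beta>. A \<beta> x * A (\<alpha> - \<beta>) x) has_integral A\<^sub>x \<alpha> x - A\<^sub>\<alpha> \<alpha> x) {0..\<alpha>}"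
      if "0 < \<alpha>" "0 \<le> x" "\<alpha> + x < Y" for \<alpha> x
    \<comment> \<open>The value of A at first argument 0 lies outside the domain and is
      unrestricted. It enters the integrand only at \<beta> = 0 and \<beta> = \<alpha>.\<close>
    proof (rule has_integral_spike_finite[where S = "{0, \<alpha>}"])
      have "(\<lambda>\<beta>. A\<^sub>Y \<beta> x * A\<^sub>Y (\<alpha> - \<beta>) x) integrable_on {0..\<alpha>}"
        by (intro integrable_continuous_real continuous_intros continuous_on_uncurry[OF AY_cont])
      then show "((\<lambda>\<beta>. A\<^sub>Y \<beta> x * A\<^sub>Y (\<alpha> - \<beta>) x) has_integral A\<^sub>x \<alpha> x - A\<^sub>\<alpha> \<alpha> x) {0..\<alpha>}"
        using A\<^sub>x[of \<alpha> x] that by (simp add: integrable_integral)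
      fix \<beta> assume "\<beta> \<in> {0..\<alpha>} - {0, \<alpha>}"
      then show "A \<beta> x * A (\<alpha> - \<beta>) x = A\<^sub>Y \<beta> x * A\<^sub>Y (\<alpha> - \<beta>) x" using that by (simp add: eq)
    qed simp
    have D: "D \<alpha> x = A\<^sub>\<alpha> \<alpha> x" and I: "I \<alpha> x = A\<^sub>x \<alpha> x - A\<^sub>\<alpha> \<alpha> x" if "0 < \<alpha>" "0 \<le> x" "\<alpha> + x < Y" for \<alpha> x
      using DERIV_imp_deriv[OF deriv_\<alpha>[OF that]] integral_unique[OF integral_eq[OF that]] by (simp_all add: D_def I_def)
    have in_W: "0 < fst r" "0 \<le> snd r" "fst r + snd r < Y" if "r \<in> ?S \<inter> W" for r
      using that by (auto simp: A_domain_def W_def)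
    have A'_eq: "A' r = A\<^sub>\<alpha> (fst r) (snd r) *\<^sub>R fst_blinfun + A\<^sub>x (fst r) (snd r) *\<^sub>R snd_blinfun" if "r \<in> ?S \<inter> W" for r
      unfolding A'_def using in_W[OF that] by (simp add: D I)
    have at_eq: "at p within ?S \<inter> W = at p within ?S"
      by (rule at_within_nhd[OF W(2,1)]) blast
    have px: "0 < \<alpha>" "0 \<le> x" "\<alpha> + x < Y" "\<alpha> < Y" using \<alpha>x Y by auto
    have pW: "p \<in> ?S \<inter> W" using p W by simp
    have "continuous_on (?S \<inter> W) A'"
      by (rule continuous_on_eq[where f = "\<lambda>r. A\<^sub>\<alpha> (fst r) (snd r) *\<^sub>R fst_blinfun + A\<^sub>x (fst r) (snd r) *\<^sub>R snd_blinfun"])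
        (auto intro!: continuous_intros continuous_on_uncurry[OF A\<alpha>_cont] continuous_on_uncurry[OF Ax_cont] simp: A'_eq)
    then show "continuous (at p within ?S) A'"
      using pW by (simp add: continuous_on_eq_continuous_within at_eq[symmetric] del: Int_iff)
    have "((\<lambda>(\<alpha>, x). A\<^sub>Y \<alpha> x) has_derivative blinfun_apply (A' p)) (at p within ?S \<inter> W)"
      using has_derivative_at_withinI[OF AY_deriv[OF px(1,4)], of x "?S \<inter> W"]
      unfolding A'_eq[OF pW] plus_blinfun.rep_eq scaleR_blinfun.rep_eq blinfun_apply_fst_blinfun blinfun_apply_snd_blinfun
      by (simp add: p_eq case_prod_unfold)
    then show "((\<lambda>(\<alpha>, x). A \<alpha> x) has_derivative blinfun_apply (A' p)) (at p within ?S)"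
      unfolding at_eq[symmetric]
      by (rule has_derivative_transform[OF pW, rotated]) (use in_W eq in \<open>auto simp: case_prod_unfold\<close>)
    show "((\<lambda>\<beta>. A \<beta> (snd p)) has_real_derivative D (fst p) (snd p)) (at (fst p))"
      using deriv_\<alpha>[OF px(1-3)] D[OF px(1-3)] by (simp add: p_eq)
    show "((\<lambda>\<beta>. A \<beta> (snd p) * A (fst p - \<beta>) (snd p)) has_integral I (fst p) (snd p)) {0..fst p}"
      using integral_eq[OF px(1-3)] I[OF px(1-3)] by (simp add: p_eq)
    have "((\<lambda>y. (\<alpha>, y)) has_derivative (\<lambda>d. (0, d))) (at x)"
      by (auto intro!: derivative_eq_intros)
    from has_derivative_compose[OF this, of "\<lambda>(\<alpha>, x). A\<^sub>Y \<alpha> x" "\<lambda>(d, e). A\<^sub>\<alpha> \<alpha> x * d + A\<^sub>x \<alpha> x * e"] AY_deriv[OF px(1,4), of x]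
    have "((\<lambda>y. A\<^sub>Y \<alpha> y) has_real_derivative A\<^sub>x \<alpha> x) (at x)"
      by (simp add: has_field_derivative_def)
    then have "((\<lambda>y. A\<^sub>Y \<alpha> y) has_real_derivative A\<^sub>x \<alpha> x) (at x within {y. (\<alpha>, y) \<in> ?S})"
      by (rule has_field_derivative_at_within)
    then have "((\<lambda>y. A \<alpha> y) has_real_derivative A\<^sub>x \<alpha> x) (at x within {y. (\<alpha>, y) \<in> ?S})"
    proof (rule has_field_derivative_transform_within[where d = "Y - \<alpha> - x"])
      show "A\<^sub>Y \<alpha> y = A \<alpha> y" if "y \<in> {y. (\<alpha>, y) \<in> ?S}" "dist y x < Y - \<alpha> - x" for y
        using that px by (intro eq[symmetric]) (auto simp: A_domain_def dist_real_def abs_if split: if_splits)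
    qed (use px p in \<open>auto simp: p_eq\<close>)
    then show "((\<lambda>y. A (fst p) y) has_real_derivative (D (fst p) (snd p) + I (fst p) (snd p)))
        (at (snd p) within {y. (fst p, y) \<in> ?S})"
      using D[OF px(1-3)] I[OF px(1-3)] by (simp add: p_eq)
  qed
  show ?thesis
  proof (intro conjI)
    show "C1_on (\<lambda>(\<alpha>, x). A \<alpha> x) ?S"
      unfolding C1_on_def
    proof (intro exI[of _ A'] conjI ballI)
      show "continuous_on ?S A'" by (simp add: continuous_on_eq_continuous_within main(1))
    qed (rule main(2))
    show "\<forall>(\<alpha>, x) \<in> ?S. \<exists>A\<^sub>\<alpha> I.
        ((\<lambda>\<beta>. A \<beta> x) has_real_derivative A\<^sub>\<alpha>) (at \<alpha>) \<and>
        ((\<lambda>\<beta>. A \<beta> x * A (\<alpha> - \<beta>) x) has_integral I) {0..\<alpha>} \<and>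
        ((\<lambda>y. A \<alpha> y) has_real_derivative (A\<^sub>\<alpha> + I)) (at x within {y. (\<alpha>, y) \<in> ?S})"
    proof (intro ballI, unfold case_prod_unfold)
      fix p assume p: "p \<in> ?S"
      show "\<exists>A\<^sub>\<alpha> I. ((\<lambda>\<beta>. A \<beta> (snd p)) has_real_derivative A\<^sub>\<alpha>) (at (fst p)) \<and>
        ((\<lambda>\<beta>. A \<beta> (snd p) * A (fst p - \<beta>) (snd p)) has_integral I) {0..fst p} \<and>
        ((\<lambda>y. A (fst p) y) has_real_derivative (A\<^sub>\<alpha> + I)) (at (snd p) within {y. (fst p, y) \<in> ?S})"
        by (intro exI conjI) (rule main(3-5)[OF p])+
    qed
  qed
qed

end
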